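(* Let $\Gamma$ be a metrized graph and let $\mu$ be a real-valued signed Borel measure on $\Gamma$ with $\mu(\Gamma)=1$ and $|\mu|(\Gamma)<\infty$. Let $\mathrm{Meas}(\Gamma)$ denote the space of all bounded signed Borel measures on $\Gamma$. Among all $\nu\in\mathrm{Meas}(\Gamma)$ with $\nu(\Gamma)=1$, $\mu$ is the unique measure minimizing the energy integral $$I_\mu(\nu)=\iint_{\Gamma\times\Gamma}g_\mu(x,y)\,d\nu(x)\,\overline{d\nu(y)}.$$
   Context: A metrized graph $\Gamma$ is a compact connected metric space such that for each $p\in\Gamma$ there are a radius $r_p>0$ and an integer $n_p\ge 1$ such that $p$ has a neighborhood isometric to the star $\{te^{2\pi i k/n_p}\in\mathbb{C}: 0\le t<r_p,\ k\in\mathbb{Z}\}$ with the path metric. $\mathrm{Vec}(p)$ is the set of $n_p$ formal unit vectors at $p$ (one for each ray of the star); $p+t\vec v$ is the point at distance $t$ from $p$ in direction $\vec v$ (small $t\ge0$), and $d_{\vec v}f(p)=\lim_{t\to0^+}(f(p+t\vec v)-f(p))/t$. Kernel $g_\mu$: $\mathrm{CPA}(\Gamma)$ is the space of continuous piecewise affine functions $f:\Gamma\to\mathbb{C}$; for such $f$, $\Delta f=-\sum_{p}\big(\sum_{\vec v\in\mathrm{Vec}(p)}d_{\vec v}f(p)\big)\delta_p$. For $\zeta,y\in\Gamma$, $x\mapsto j_\zeta(x,y)$ is the unique function in $\mathrm{CPA}(\Gamma)$ with $\Delta_x j_\zeta(x,y)=\delta_y-\delta_\zeta$ and $j_\zeta(\zeta,y)=0$;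 $j_\zeta(x,y)$ is jointly continuous in $(\zeta,x,y)$ and symmetric in $x,y$. Put $j_\mu(x,y)=\int_\Gamma j_\zeta(x,y)\,d\mu(\zeta)$; the number $c_\mu=\int_\Gamma j_\mu(x,y)\,d\mu(x)$ does not depend on $y$, and $g_\mu(x,y)=j_\mu(x,y)-c_\mu$. A bounded measure $\nu$ is one with $|\nu|(\Gamma)<\infty$. *)

theory Defs
  imports "HOL-Analysis.Analysis"
begin

section \<open>Metrized graphs\<close>

definition path_length :: "(real \<Rightarrow> 'a::metric_space) \<Rightarrow> ennreal" where
  "path_length \<gamma> = (SUP ts\<in>{ts. sorted ts \<and> set ts \<subseteq> {0..1}}.
      \<Sum>i<length ts - 1. ennreal (dist (\<gamma> (ts ! i)) (\<gamma> (ts ! Suc i))))"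

definition path_dist :: "'a::metric_space set \<Rightarrow> 'a \<Rightarrow> 'a \<Rightarrow> ennreal" where
  "path_dist S x y = (INF \<gamma>\<in>{\<gamma>. path \<gamma> \<and> path_image \<gamma> \<subseteq> S \<and> pathstart \<gamma> = x \<and> pathfinish \<gamma> = y}.
      path_length \<gamma>)"

definition star_set :: "nat \<Rightarrow> real \<Rightarrow> complex set" where
  "star_set n r = {of_real t * cis (2 * pi * of_int k / real n) | t (k::int). 0 \<le> t \<and> t < r}"

definition (in metric_space) star_chart :: "'a \<Rightarrow> nat \<Rightarrow> real \<Rightarrow> (complex \<Rightarrow> 'a) \<Rightarrow> bool" where
  "star_chart p n r \<phi> \<longleftrightarrow> 1 \<le> n \<and> 0 < r \<and> \<phi> 0 = p \<and>
     (\<exists>U. open U \<and> p \<in> U \<and> U \<subseteq> \<phi> ` star_set n r) \<and>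
     (\<forall>z\<in>star_set n r. \<forall>w\<in>star_set n r.
        ennreal (dist (\<phi> z) (\<phi> w)) = path_dist (star_set n r) z w)"

text \<open>The graph is the whole type, carrying the topology and the Borel sets of its metric.\<close>

class metrized_graph = metric_space +
  assumes compact_graph: "compact UNIV"
    and connected_graph: "connected UNIV"
    and star_chart_ex: "\<exists>n r \<phi>. star_chart p n r \<phi>"

text \<open>Formal unit vectors at \<open>p\<close> are encoded through an arbitrarily chosen star chart at \<open>p\<close>, as
  the unit vectors of \<open>\<complex>\<close> along the rays of the star. The number of rays does not depend on the
  chart, and another chart at \<open>p\<close> only permutes the germs of the rays.\<close>

definition graph_chart :: "'a::metrized_graph \<Rightarrow> nat \<times> real \<times> (complex \<Rightarrow> 'a)" where
  "graph_chart p = (SOME (n, r, \<phi>). star_chart p n r \<phi>)"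

definition valence :: "'a::metrized_graph \<Rightarrow> nat" where
  "valence p = fst (graph_chart p)"

definition Vec :: "'a::metrized_graph \<Rightarrow> complex set" where
  "Vec p = {cis (2 * pi * of_int k / real (valence p)) | k::int. True}"

text \<open>The point \<open>p + t v\<close>; meaningful for \<open>v \<in> Vec p\<close> and small \<open>t \<ge> 0\<close>.\<close>

definition graph_move :: "'a::metrized_graph \<Rightarrow> real \<Rightarrow> complex \<Rightarrow> 'a" where
  "graph_move p t v = snd (snd (graph_chart p)) (of_real t * v)"

definition dir_deriv :: "('a::metrized_graph \<Rightarrow> complex) \<Rightarrow> 'a \<Rightarrow> complex \<Rightarrow> complex" where
  "dir_deriv f p v = Lim (at_right 0) (\<lambda>t. (f (graph_move p t v) - f p) / of_real t)"


section \<open>Piecewise affine functions and the Laplacian\<close>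

text \<open>\<open>f\<close> is piecewise affine if it is affine in the arc length parameter on every open segment
  that avoids a suitable finite set \<open>S\<close>. Since \<open>S\<close> may always be enlarged by the finitely many
  points of valence other than 2, this is affineness on the edges of some subdivision.\<close>

definition piecewise_affine :: "('a::metrized_graph \<Rightarrow> complex) \<Rightarrow> bool" where
  "piecewise_affine f \<longleftrightarrow> (\<exists>S. finite S \<and>
     (\<forall>(a::real) b \<gamma>. (\<forall>s\<in>{a<..<b}. \<forall>t\<in>{a<..<b}. dist (\<gamma> s) (\<gamma> t) = \<bar>s - t\<bar>) \<and>
          \<gamma> ` {a<..<b} \<inter> S = {} \<longrightarrow>
        (\<exists>c d. \<forall>t\<in>{a<..<b}. f (\<gamma> t) = c + of_real t * d)))"

definition CPA :: "('a::metrized_graph \<Rightarrow> complex) set" where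
  "CPA = {f. continuous_on UNIV f \<and> piecewise_affine f}"

text \<open>Measures are represented by their set functions. For \<open>f \<in> CPA\<close> only finitely many terms of
  the sum are nonzero.\<close>

definition graph_laplacian :: "('a::metrized_graph \<Rightarrow> complex) \<Rightarrow> 'a set \<Rightarrow> complex" where
  "graph_laplacian f A = - (\<Sum>\<^sub>\<infinity>p\<in>A. \<Sum>v\<in>Vec p. dir_deriv f p v)"

definition dirac :: "'a \<Rightarrow> 'a set \<Rightarrow> complex" where
  "dirac y A = indicator A y"

definition j_kernel :: "'a::metrized_graph \<Rightarrow> 'a \<Rightarrow> 'a \<Rightarrow> complex" where
  "j_kernel \<zeta> x y = (THE f. f \<in> CPA \<and>
      (\<forall>A\<in>sets borel. graph_laplacian f A = dirac y A - dirac \<zeta> A) \<and> f \<zeta> = 0) x"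


section \<open>Bounded measures and integration\<close>

definition total_variation :: "('a::topological_space set \<Rightarrow> complex) \<Rightarrow> 'a set \<Rightarrow> ennreal" where
  "total_variation \<nu> A = (SUP P\<in>{P. finite P \<and> P \<subseteq> sets borel \<and> disjoint P \<and> \<Union>P = A}.
      \<Sum>E\<in>P. ennreal (norm (\<nu> E)))"

text \<open>Bounded Borel measures, with complex values as for \<open>CPA\<close>. As with \<open>emeasure\<close>, the value off the
  Borel sets is 0, so that equality of set functions is equality of measures.\<close>

definition Meas :: "('a::topological_space set \<Rightarrow> complex) set" where
  "Meas = {\<nu>. (\<forall>A::nat \<Rightarrow> 'a set. range A \<subseteq> sets borel \<longrightarrow> disjoint_family A \<longrightarrow>
                 (\<lambda>i. \<nu> (A i)) sums \<nu> (\<Union>i. A i)) \<and>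
              total_variation \<nu> UNIV < \<infinity> \<and>
              (\<forall>A. A \<notin> sets borel \<longrightarrow> \<nu> A = 0)}"

text \<open>The positive part of the Jordan decomposition, \<open>\<sigma>\<^sup>+(A) = sup {\<sigma>(B) | B \<subseteq> A}\<close>. The
  coercion \<open>ennreal\<close> truncates negative values to 0, which is harmless because \<open>B = {}\<close> is
  admissible. The negative part is the positive part of \<open>-\<sigma>\<close>.\<close>

definition pos_variation :: "('a::topological_space set \<Rightarrow> real) \<Rightarrow> 'a measure" where
  "pos_variation \<sigma> = measure_of UNIV (sets borel)
      (\<lambda>A. SUP B\<in>{B\<in>sets borel. B \<subseteq> A}. ennreal (\<sigma> B))"

definition signed_integral ::
  "('a::topological_space set \<Rightarrow> real) \<Rightarrow> ('a \<Rightarrow> complex) \<Rightarrow> complex" where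
  "signed_integral \<sigma> f =
     (\<integral>x. f x \<partial>pos_variation \<sigma>) - (\<integral>x. f x \<partial>pos_variation (\<lambda>A. - \<sigma> A))"

definition meas_integral ::
  "('a::topological_space set \<Rightarrow> complex) \<Rightarrow> ('a \<Rightarrow> complex) \<Rightarrow> complex" where
  "meas_integral \<nu> f =
     signed_integral (\<lambda>A. Re (\<nu> A)) f + \<i> * signed_integral (\<lambda>A. Im (\<nu> A)) f"


section \<open>The kernel and the energy\<close>

definition j_mu :: "('a::metrized_graph set \<Rightarrow> complex) \<Rightarrow> 'a \<Rightarrow> 'a \<Rightarrow> complex" where
  "j_mu \<mu> x y = meas_integral \<mu> (\<lambda>\<zeta>. j_kernel \<zeta> x y)"

definition c_mu :: "('a::metrized_graph set \<Rightarrow> complex) \<Rightarrow> complex" where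
  "c_mu \<mu> = (THE c. \<forall>y. c = meas_integral \<mu> (\<lambda>x. j_mu \<mu> x y))"

definition g_mu :: "('a::metrized_graph set \<Rightarrow> complex) \<Rightarrow> 'a \<Rightarrow> 'a \<Rightarrow> complex" where
  "g_mu \<mu> x y = j_mu \<mu> x y - c_mu \<mu>"

definition energy ::
  "('a::metrized_graph set \<Rightarrow> complex) \<Rightarrow> ('a set \<Rightarrow> complex) \<Rightarrow> complex" where
  "energy \<mu> \<nu> =
     meas_integral (\<lambda>A. cnj (\<nu> A)) (\<lambda>y. meas_integral \<nu> (\<lambda>x. g_mu \<mu> x y))"

end

theory Submission
  imports Defs "HOL-Library.Function_Algebras"
begin

text \<open>Fix a base point \<open>z\<close> and let \<open>k(x, y) = j\<^bsub>z\<^esub>(x, y)\<close>, the potential of a unit current that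
  enters at \<open>y\<close> and leaves at \<open>z\<close>. Moving the base point gives \<open>j\<^bsub>w\<^esub>(x, y) = k(x, y) - k(x, w) -
  k(w, y) + k(w, w)\<close>. Hence, with \<open>U(x) = \<integral>k(w, x) d\<mu>(w)\<close>, the kernel \<open>g\<^bsub>\<mu>\<^esub>(x, y)\<close> is \<open>k(x, y) -
  U(x) - U(y) + \<integral>U d\<mu>\<close>, and for a measure \<open>\<nu>\<close> of mass \<open>1\<close> the energy is the double integral of \<open>k\<close>
  against \<open>\<omega>\<close> and its conjugate, where \<open>\<omega> = \<nu> - \<mu>\<close> has mass \<open>0\<close>. The theorem therefore says that the
  symmetric kernel \<open>k\<close> is positive semidefinite and that the energy of \<open>\<omega>\<close> vanishes only for \<open>\<omega> =
  0\<close>.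

  The graph is never cut into finitely many edges. A real function is called locally affine if it is
  affine near every point on every ray that leaves the point; this is the same as being continuous
  and piecewise affine. Everything about such functions follows from the maximum principle
  (\<open>maximum_principle\<close>) and from tents supported in one star. A function that pairs with the
  Laplacians of all locally affine functions as a solution of \<open>\<Delta> u = B\<close> would is itself such a
  solution, as testing it against tents shows (\<open>weak_solution\<close>). This is used twice. A linear
  functional that vanishes on all Laplacians is a weakly harmonic function, hence a constant, so the
  dipole \<open>\<delta>\<^bsub>y\<^esub> - \<delta>\<^bsub>z\<^esub>\<close> is a Laplacian (\<open>dipole_exists\<close>); and \<open>y \<mapsto> k(x, y)\<close> solves weakly the problem
  that \<open>y \<mapsto> k(y, x)\<close> solves, so \<open>k\<close> is symmetric (\<open>green_symmetric\<close>).

  Positivity (\<open>green_positive_semidefinite\<close>) is the inequality \<open>\<Sum> f \<Delta>f \<ge> 0\<close> over the points that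
  carry \<open>\<Delta>f\<close>. The mass of \<open>\<Delta>f\<close> on each superlevel set \<open>{f > c}\<close> is nonnegative, because the
  Laplacian of \<open>max f c\<close> has total mass \<open>0\<close> and is nonpositive where that function is minimal;
  summation by levels gives the claim. The kernel is continuous because \<open>k(x, y)\<close> and \<open>k(x', y)\<close>
  differ at most by the distance of \<open>x\<close> and \<open>x'\<close> if these are near (\<open>green_lipschitz\<close>).

  Riemann sums over finer and finer finite partitions carry all of this over to measures: they turn
  the energy into a limit of finite positive semidefinite forms (\<open>energy_tendsto\<close>). If the energy is
  \<open>0\<close>, Cauchy-Schwarz against point masses shows that \<open>\<nu>\<close> and \<open>\<mu>\<close> have the same potential. Every
  locally affine function is a constant plus a combination of functions \<open>k(\<cdot>, q)\<close>, so \<open>\<nu>\<close> and \<open>\<mu>\<close>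
  integrate all of them equally; since these functions approximate the indicators of closed sets,
  the measures agree (\<open>measure_eq_if_locally_affine_integrals_eq\<close>).\<close>

section \<open>Stars and their rays\<close>

definition unit_roots :: "nat \<Rightarrow> complex set" where
  "unit_roots n = {cis (2 * pi * of_int k / real n) | k::int. True}"

lemma star_set_eq: "star_set n r = {of_real t * v | t v. v \<in> unit_roots n \<and> 0 \<le> t \<and> t < r}"
  unfolding star_set_def unit_roots_def by blast

lemma finite_unit_roots:
  assumes "1 \<le> n" shows "finite (unit_roots n)"
proof (rule finite_subset)
  show "unit_roots n \<subseteq> {z. z ^ n = 1}"
  proof
    fix z assume "z \<in> unit_roots n"
    then obtain k :: int where z: "z = cis (2 * pi * of_int k / real n)" by (auto simp: unit_roots_def)
    have "z ^ n = cis (2 * pi * of_int k)" using assms by (simp add: z Complex.DeMoivre)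
    also have "\<dots> = 1" by (rule cis_multiple_2pi) simp
    finally show "z \<in> {z. z ^ n = 1}" by simp
  qed
  show "finite {z::complex. z ^ n = 1}"
    using assms by (intro finite_roots_unity) auto
qed

lemma unit_roots_nonempty: "unit_roots n \<noteq> {}"
  unfolding unit_roots_def by blast

lemma norm_unit_root [simp]: "v \<in> unit_roots n \<Longrightarrow> norm v = 1"
  unfolding unit_roots_def by auto

text \<open>A primitive \<open>h\<close> of the speed bounds the length, since its increments telescope.\<close>

lemma path_length_le:
  fixes \<gamma> :: "real \<Rightarrow> 'a::metric_space" and h :: "real \<Rightarrow> real"
  assumes le: "\<And>s t. 0 \<le> s \<Longrightarrow> s \<le> t \<Longrightarrow> t \<le> 1 \<Longrightarrow> dist (\<gamma> s) (\<gamma> t) \<le> h t - h s"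
  shows "path_length \<gamma> \<le> ennreal (h 1 - h 0)"
  unfolding path_length_def
proof (rule SUP_least)
  have mono: "h s \<le> h t" if "0 \<le> s" "s \<le> t" "t \<le> 1" for s t
    using le[OF that] zero_le_dist[of "\<gamma> s" "\<gamma> t"] by linarith
  fix ts :: "real list" assume "ts \<in> {ts. sorted ts \<and> set ts \<subseteq> {0..1}}"
  then have ts: "sorted ts" "set ts \<subseteq> {0..1}" by auto
  have nth: "0 \<le> ts ! i" "ts ! i \<le> 1" if "i < length ts" for i
    using ts(2) that by (auto dest: nth_mem)
  have "(\<Sum>i<length ts - 1. ennreal (dist (\<gamma> (ts ! i)) (\<gamma> (ts ! Suc i))))
      = ennreal (\<Sum>i<length ts - 1. dist (\<gamma> (ts ! i)) (\<gamma> (ts ! Suc i)))"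
    by (rule sum_ennreal) auto
  also have "(\<Sum>i<length ts - 1. dist (\<gamma> (ts ! i)) (\<gamma> (ts ! Suc i)))
      \<le> (\<Sum>i<length ts - 1. h (ts ! Suc i) - h (ts ! i))"
    using ts nth by (intro sum_mono le) (auto intro!: sorted_nth_mono)
  also have "\<dots> = h (ts ! (length ts - 1)) - h (ts ! 0)"
    by (rule sum_lessThan_telescope)
  also have "\<dots> \<le> h 1 - h 0"
  proof (cases "ts = []")
    case False
    then show ?thesis
      using mono[of "ts ! (length ts - 1)" 1] mono[of 0 "ts ! 0"] nth[of "length ts - 1"] nth[of 0]
      by (auto simp: less_Suc_eq)
  next
    case True
    then show ?thesis using mono[of 0 1] by simp
  qed
  finally show "(\<Sum>i<length ts - 1. ennreal (dist (\<gamma> (ts ! i)) (\<gamma> (ts ! Suc i)))) \<le> ennreal (h 1 - h 0)"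
    by (simp add: ennreal_leI)
qed

lemma path_length_ge:
  assumes "0 \<le> u" "u \<le> 1"
  shows "ennreal (dist (\<gamma> 0) (\<gamma> u) + dist (\<gamma> u) (\<gamma> 1)) \<le> path_length \<gamma>"
proof -
  have "(\<Sum>i<length [0,u,1] - 1. ennreal (dist (\<gamma> ([0,u,1] ! i)) (\<gamma> ([0,u,1] ! Suc i))))
      \<le> path_length \<gamma>"
    unfolding path_length_def using assms by (intro SUP_upper) auto
  then show ?thesis by (simp add: numeral_2_eq_2 ennreal_plus)
qed

lemma path_length_ge_dist: "ennreal (dist (\<gamma> 0) (\<gamma> 1)) \<le> path_length \<gamma>"
  using path_length_ge[of 0 \<gamma>] by simp

lemma path_dist_star_same_ray:
  assumes v: "v \<in> unit_roots n" and s: "0 \<le> s" "s < r" and t: "0 \<le> t" "t < r"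
  shows "path_dist (star_set n r) (of_real s * v) (of_real t * v) = ennreal \<bar>s - t\<bar>"
proof (rule antisym)
  have dist_ray: "dist (complex_of_real a * v) (of_real b * v) = \<bar>a - b\<bar>" for a b :: real
  proof -
    have "complex_of_real a * v - of_real b * v = of_real (a - b) * v" by (simp add: algebra_simps)
    then show ?thesis using v by (simp only: dist_norm norm_mult norm_of_real norm_unit_root) simp
  qed
  let ?\<gamma> = "linepath (complex_of_real s * v) (of_real t * v)"
  have eq: "?\<gamma> u = of_real ((1 - u) * s + u * t) * v" for u
    by (simp add: linepath_def scaleR_conv_of_real algebra_simps)
  have "path_image ?\<gamma> \<subseteq> star_set n r"
  proof
    fix x assume "x \<in> path_image ?\<gamma>"
    then obtain u where u: "0 \<le> u" "u \<le> 1" "x = ?\<gamma> u" by (auto simp: path_image_def)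
    have "(1 - u) * s + u * t < r"
      using convex_bound_lt[OF s(2) t(2), of "1 - u" u] u by simp
    moreover have "0 \<le> (1 - u) * s + u * t" using u s t by simp
    ultimately show "x \<in> star_set n r" unfolding star_set_eq u(3) eq using v by blast
  qed
  then have "path_dist (star_set n r) (of_real s * v) (of_real t * v) \<le> path_length ?\<gamma>"
    unfolding path_dist_def by (intro INF_lower) auto
  also have "\<dots> \<le> ennreal ((\<lambda>u. u * \<bar>s - t\<bar>) 1 - (\<lambda>u. u * \<bar>s - t\<bar>) 0)"
  proof (rule path_length_le)
    fix a b :: real assume "0 \<le> a" "a \<le> b" "b \<le> 1"
    have "(1 - a) * s + a * t - ((1 - b) * s + b * t) = (b - a) * (s - t)" by (simp add: algebra_simps)
    then have "dist (?\<gamma> a) (?\<gamma> b) = \<bar>(b - a) * (s - t)\<bar>" unfolding eq dist_ray by simp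
    also have "\<dots> = (b - a) * \<bar>s - t\<bar>" using \<open>a \<le> b\<close> by (simp add: abs_mult)
    finally show "dist (?\<gamma> a) (?\<gamma> b) \<le> b * \<bar>s - t\<bar> - a * \<bar>s - t\<bar>"
      by (simp add: left_diff_distrib)
  qed
  finally show "path_dist (star_set n r) (of_real s * v) (of_real t * v) \<le> ennreal \<bar>s - t\<bar>" by simp
  show "ennreal \<bar>s - t\<bar> \<le> path_dist (star_set n r) (of_real s * v) (of_real t * v)"
    unfolding path_dist_def
  proof (rule INF_greatest)
    fix \<gamma> assume "\<gamma> \<in> {\<gamma>. path \<gamma> \<and> path_image \<gamma> \<subseteq> star_set n r \<and>
      pathstart \<gamma> = complex_of_real s * v \<and> pathfinish \<gamma> = complex_of_real t * v}"
    then show "ennreal \<bar>s - t\<bar> \<le> path_length \<gamma>"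
      using path_length_ge_dist[of \<gamma>] dist_ray[of s t] by (simp add: pathstart_def pathfinish_def)
  qed
qed

text \<open>Directions of the points of a path that avoids the centre form a connected subset of a
  finite set, so a path between different rays has to visit the centre.\<close>

lemma path_between_rays_through_0:
  assumes n: "1 \<le> n" and \<gamma>: "path \<gamma>" "path_image \<gamma> \<subseteq> star_set n r"
    and v: "v \<in> unit_roots n" "w \<in> unit_roots n" "v \<noteq> w"
    and st: "0 < s" "0 < t" "pathstart \<gamma> = of_real s * v" "pathfinish \<gamma> = of_real t * w"
  shows "\<exists>u\<in>{0..1}. \<gamma> u = 0"
proof (rule ccontr)
  assume neg: "\<not> (\<exists>u\<in>{0..1}. \<gamma> u = 0)"
  then have n0: "0 \<notin> path_image \<gamma>" by (auto simp: path_image_def)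
  have sgn_eq: "sgn (complex_of_real a * x) = x" if "0 < a" "x \<in> unit_roots n" for a x
    using that by (simp add: sgn_eq norm_mult)
  have "sgn ` path_image \<gamma> \<subseteq> unit_roots n"
  proof
    fix y assume "y \<in> sgn ` path_image \<gamma>"
    then obtain x where x: "x \<in> path_image \<gamma>" "y = sgn x" by auto
    then obtain a b where ab: "b \<in> unit_roots n" "0 \<le> a" "x = of_real a * b"
      using \<gamma> unfolding star_set_eq by blast
    moreover from this have "a \<noteq> 0" using n0 x by auto
    ultimately show "y \<in> unit_roots n" using x sgn_eq[of a b] by auto
  qed
  then have fin: "finite (sgn ` path_image \<gamma>)" using finite_unit_roots[OF n] finite_subset by blast
  have "connected (sgn ` path_image \<gamma>)"
    using n0 by (intro connected_continuous_image connected_path_image \<gamma> continuous_on_sgn) auto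
  then obtain x where "sgn ` path_image \<gamma> \<subseteq> {x}"
    using fin by (metis connected_finite_iff_sing subset_refl subset_empty empty_subsetI)
  moreover have "v \<in> sgn ` path_image \<gamma>" "w \<in> sgn ` path_image \<gamma>"
    using sgn_eq[of s v] sgn_eq[of t w] v st
    by (metis imageI pathstart_in_path_image pathfinish_in_path_image)+
  ultimately show False using v by auto
qed

lemma path_dist_star_different_rays:
  assumes n: "1 \<le> n" and v: "v \<in> unit_roots n" "w \<in> unit_roots n" "v \<noteq> w"
    and s: "0 \<le> s" "s < r" and t: "0 \<le> t" "t < r"
  shows "path_dist (star_set n r) (of_real s * v) (of_real t * w) = ennreal (s + t)"
proof (rule antisym)
  let ?\<gamma> = "linepath (complex_of_real s * v) 0 +++ linepath 0 (of_real t * w)"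
  have eq: "?\<gamma> u = (if u \<le> 1/2 then of_real ((1 - 2*u) * s) * v else of_real ((2*u - 1) * t) * w)" for u
    by (simp add: linepath_def joinpaths_def scaleR_conv_of_real algebra_simps)
  have "path_image ?\<gamma> \<subseteq> star_set n r"
  proof
    fix x assume "x \<in> path_image ?\<gamma>"
    then obtain u where u: "0 \<le> u" "u \<le> 1" "x = ?\<gamma> u" by (auto simp: path_image_def)
    show "x \<in> star_set n r"
    proof (cases "u \<le> 1/2")
      case True
      have "(1 - 2*u) * s \<le> 1 * s" using u s by (intro mult_right_mono) auto
      then have "(1 - 2*u) * s < r" "0 \<le> (1 - 2*u) * s" using s True by auto
      then show ?thesis unfolding star_set_eq u(3) eq using v True by (auto simp del: of_real_mult of_real_diff)
    next
      case False
      have "(2*u - 1) * t \<le> 1 * t" using u t by (intro mult_right_mono) auto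
      then have "(2*u - 1) * t < r" "0 \<le> (2*u - 1) * t" using t False by auto
      then show ?thesis unfolding star_set_eq u(3) eq using v False by (auto simp del: of_real_mult of_real_diff)
    qed
  qed
  moreover have "path ?\<gamma>" by (rule path_join_imp) auto
  ultimately have "path_dist (star_set n r) (of_real s * v) (of_real t * w) \<le> path_length ?\<gamma>"
    unfolding path_dist_def by (intro INF_lower) auto
  also have "\<dots> \<le> ennreal ((\<lambda>u. if u \<le> 1/2 then 2 * u * s else s + (2*u - 1) * t) 1
        - (\<lambda>u. if u \<le> 1/2 then 2 * u * s else s + (2*u - 1) * t) 0)"
  proof (rule path_length_le)
    fix a b :: real assume ab: "0 \<le> a" "a \<le> b" "b \<le> 1"
    have nv: "dist (complex_of_real c * x) (of_real d * x) = \<bar>c - d\<bar>" if "x \<in> unit_roots n" for c d :: real and x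
      using that norm_unit_root[OF that]
      by (metis dist_norm left_diff_distrib mult.right_neutral norm_mult norm_of_real of_real_diff)
    consider "b \<le> 1/2" | "1/2 < a" | "a \<le> 1/2" "1/2 < b" using ab by linarith
    then show "dist (?\<gamma> a) (?\<gamma> b) \<le> (if b \<le> 1/2 then 2 * b * s else s + (2*b - 1) * t)
        - (if a \<le> 1/2 then 2 * a * s else s + (2*a - 1) * t)"
    proof cases
      case 1
      then have "dist (?\<gamma> a) (?\<gamma> b) = \<bar>(1 - 2*a) * s - (1 - 2*b) * s\<bar>"
        unfolding eq using ab v by (simp add: nv del: of_real_mult of_real_diff)
      also have "(1 - 2*a) * s - (1 - 2*b) * s = (b - a) * (2 * s)" by (simp add: algebra_simps)
      also have "\<bar>\<dots>\<bar> = (b - a) * (2 * s)" using ab s by simp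
      finally have D: "dist (?\<gamma> a) (?\<gamma> b) = (b - a) * (2 * s)" .
      show ?thesis unfolding D using 1 ab by (simp add: algebra_simps)
    next
      case 2
      then have "dist (?\<gamma> a) (?\<gamma> b) = \<bar>(2*a - 1) * t - (2*b - 1) * t\<bar>"
        unfolding eq using ab v by (simp add: nv del: of_real_mult of_real_diff)
      also have "(2*a - 1) * t - (2*b - 1) * t = - ((b - a) * (2 * t))" by (simp add: algebra_simps)
      also have "\<bar>\<dots>\<bar> = (b - a) * (2 * t)" using ab t by simp
      finally have D: "dist (?\<gamma> a) (?\<gamma> b) = (b - a) * (2 * t)" .
      show ?thesis unfolding D using 2 ab by (simp add: algebra_simps)
    next
      case 3
      have "dist (?\<gamma> a) (?\<gamma> b) \<le> norm (?\<gamma> a) + norm (?\<gamma> b)"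
        by (simp add: dist_norm norm_triangle_ineq4)
      also have "norm (?\<gamma> a) = (1 - 2*a) * s"
        unfolding eq using 3 ab v s by (simp add: norm_mult abs_mult del: of_real_mult of_real_diff)
      also have "norm (?\<gamma> b) = (2*b - 1) * t"
        unfolding eq using 3 ab v t by (simp add: norm_mult abs_mult del: of_real_mult of_real_diff)
      finally have D: "dist (?\<gamma> a) (?\<gamma> b) \<le> (1 - 2*a) * s + (2*b - 1) * t" .
      show ?thesis by (rule order.trans[OF D]) (use 3 in \<open>simp add: algebra_simps\<close>)
    qed
  qed
  also have "(\<lambda>u. if u \<le> 1/2 then 2 * u * s else s + (2*u - 1) * t) 1
        - (\<lambda>u. if u \<le> 1/2 then 2 * u * s else s + (2*u - 1) * t) 0 = s + t" by simp
  finally show "path_dist (star_set n r) (of_real s * v) (of_real t * w) \<le> ennreal (s + t)" .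
  show "ennreal (s + t) \<le> path_dist (star_set n r) (of_real s * v) (of_real t * w)"
    unfolding path_dist_def
  proof (rule INF_greatest)
    fix \<gamma> assume "\<gamma> \<in> {\<gamma>. path \<gamma> \<and> path_image \<gamma> \<subseteq> star_set n r \<and>
      pathstart \<gamma> = complex_of_real s * v \<and> pathfinish \<gamma> = complex_of_real t * w}"
    then have \<gamma>: "path \<gamma>" "path_image \<gamma> \<subseteq> star_set n r"
      "pathstart \<gamma> = complex_of_real s * v" "pathfinish \<gamma> = complex_of_real t * w" by auto
    have n0: "norm (\<gamma> 0) = s" "norm (\<gamma> 1) = t"
      using \<gamma>(3,4) v s t by (simp_all add: pathstart_def pathfinish_def norm_mult)
    have "\<exists>u\<in>{0..1}. \<gamma> u = 0"
    proof (cases "s = 0 \<or> t = 0")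
      case True
      then have "\<gamma> 0 = 0 \<or> \<gamma> 1 = 0" using n0 by auto
      then show ?thesis by fastforce
    next
      case False
      then have "0 < s" "0 < t" using s t by auto
      then show ?thesis using path_between_rays_through_0[OF n \<gamma>(1,2) v _ _ \<gamma>(3,4)] by blast
    qed
    then obtain u where u: "0 \<le> u" "u \<le> 1" "\<gamma> u = 0" by auto
    then show "ennreal (s + t) \<le> path_length \<gamma>"
      using path_length_ge[OF u(1,2), of \<gamma>] n0 by (simp add: dist_norm)
  qed
qed

text \<open>Inside a good radius the star chart is an isometry onto a full ball. This is all that is used of the
  charts: \<open>graph_move p t v\<close> runs through the ball, the distance to \<open>p\<close> is the parameter \<open>t\<close>, and different
  rays are joined through \<open>p\<close>.\<close>

definition good_radius :: "'a::metrized_graph \<Rightarrow> real \<Rightarrow> bool" where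
  "good_radius p R \<longleftrightarrow> 0 < R \<and>
     (\<forall>v. graph_move p 0 v = p) \<and>
     (\<forall>v\<in>Vec p. \<forall>s\<in>{0..<R}. \<forall>t\<in>{0..<R}. dist (graph_move p s v) (graph_move p t v) = \<bar>s - t\<bar>) \<and>
     (\<forall>v\<in>Vec p. \<forall>w\<in>Vec p. \<forall>s\<in>{0..<R}. \<forall>t\<in>{0..<R}. v \<noteq> w \<longrightarrow>
        dist (graph_move p s v) (graph_move p t w) = s + t) \<and>
     (\<forall>x. dist p x < R \<longrightarrow> (\<exists>v\<in>Vec p. x = graph_move p (dist p x) v))"

lemma graph_chart:
  obtains n r \<phi> where "graph_chart (p::'a::metrized_graph) = (n, r, \<phi>)" "star_chart p n r \<phi>"
proof -
  have "\<exists>c. case c of (n, r, \<phi>) \<Rightarrow> star_chart p n r \<phi>" using star_chart_ex[of p] by auto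
  then have "case graph_chart p of (n, r, \<phi>) \<Rightarrow> star_chart p n r \<phi>"
    unfolding graph_chart_def by (rule someI_ex)
  then show ?thesis using that by (cases "graph_chart p") auto
qed

lemma Vec_finite: "finite (Vec p)" and Vec_nonempty: "Vec p \<noteq> {}"
proof -
  obtain n r \<phi> where c: "graph_chart p = (n, r, \<phi>)" "star_chart p n r \<phi>" by (rule graph_chart)
  then have "Vec p = unit_roots n" by (simp add: Vec_def unit_roots_def valence_def)
  then show "finite (Vec p)" "Vec p \<noteq> {}"
    using finite_unit_roots[of n] unit_roots_nonempty[of n] c(2) by (auto simp: star_chart_def)
qed

lemma good_radius_exists: "\<exists>R. good_radius (p::'a::metrized_graph) R"
proof -
  obtain n r \<phi> where c: "graph_chart p = (n, r, \<phi>)" "star_chart p n r \<phi>" by (rule graph_chart)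
  have V: "Vec p = unit_roots n" using c by (simp add: Vec_def unit_roots_def valence_def)
  have move: "graph_move p t v = \<phi> (of_real t * v)" for t v using c by (simp add: graph_move_def)
  have n: "1 \<le> n" "0 < r" "\<phi> 0 = p" using c(2) by (auto simp: star_chart_def)
  obtain U where U: "open U" "p \<in> U" "U \<subseteq> \<phi> ` star_set n r" using c(2) by (auto simp: star_chart_def)
  have iso: "ennreal (dist (\<phi> z) (\<phi> w)) = path_dist (star_set n r) z w"
    if "z \<in> star_set n r" "w \<in> star_set n r" for z w using c(2) that by (auto simp: star_chart_def)
  have mem: "of_real t * v \<in> star_set n r" if "v \<in> unit_roots n" "0 \<le> t" "t < r" for t v
    using that unfolding star_set_eq by blast
  have same: "dist (\<phi> (of_real s * v)) (\<phi> (of_real t * v)) = \<bar>s - t\<bar>"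
    if "v \<in> unit_roots n" "0 \<le> s" "s < r" "0 \<le> t" "t < r" for s t v
    using iso[OF mem mem] path_dist_star_same_ray that
    by (metis abs_ge_zero ennreal_inj zero_le_dist)
  have diff: "dist (\<phi> (of_real s * v)) (\<phi> (of_real t * w)) = s + t"
    if "v \<in> unit_roots n" "w \<in> unit_roots n" "v \<noteq> w" "0 \<le> s" "s < r" "0 \<le> t" "t < r" for s t v w
    using iso[OF mem mem] path_dist_star_different_rays[OF n(1)] that
    by (metis add_nonneg_nonneg ennreal_inj zero_le_dist)
  obtain e where e: "0 < e" "ball p e \<subseteq> U" using U open_contains_ball by blast
  let ?R = "min e r"
  have "\<exists>v\<in>Vec p. x = graph_move p (dist p x) v" if "dist p x < ?R" for x
  proof -
    have "x \<in> \<phi> ` star_set n r" using that e U by auto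
    then obtain t v where tv: "v \<in> unit_roots n" "0 \<le> t" "t < r" "x = \<phi> (of_real t * v)"
      unfolding star_set_eq by blast
    then have "dist p x = t" using same[of v 0 t] n by auto
    then show ?thesis using tv V move by auto
  qed
  then have "good_radius p ?R"
    unfolding good_radius_def using e n same diff by (auto simp: V move)
  then show ?thesis by blast
qed

section \<open>Locally affine functions and their Laplacian\<close>

lemma good_radiusD:
  assumes "good_radius p R"
  shows "0 < R" "graph_move p 0 v = p"
    "v \<in> Vec p \<Longrightarrow> 0 \<le> s \<Longrightarrow> s < R \<Longrightarrow> 0 \<le> t \<Longrightarrow> t < R \<Longrightarrow>
       dist (graph_move p s v) (graph_move p t v) = \<bar>s - t\<bar>"
    "v \<in> Vec p \<Longrightarrow> w \<in> Vec p \<Longrightarrow> v \<noteq> w \<Longrightarrow> 0 \<le> s \<Longrightarrow> s < R \<Longrightarrow> 0 \<le> t \<Longrightarrow> t < R \<Longrightarrow>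
       dist (graph_move p s v) (graph_move p t w) = s + t"
    "dist p x < R \<Longrightarrow> \<exists>v\<in>Vec p. x = graph_move p (dist p x) v"
  using assms unfolding good_radius_def by auto

lemma finite_ball_cover:
  assumes "\<And>p. 0 < r p"
  obtains F :: "'a::metrized_graph set" where "finite F" "\<And>x. \<exists>p\<in>F. dist p x < r p"
proof -
  obtain F where F: "finite F" "UNIV \<subseteq> (\<Union>p\<in>F. ball p (r p))"
  proof (rule compactE_image[OF compact_graph, of UNIV "\<lambda>p. ball p (r p)"])
    show "UNIV \<subseteq> (\<Union>p. ball p (r p))" using assms centre_in_ball by blast
  qed auto
  have "\<exists>p\<in>F. dist p x < r p" for x
  proof -
    have "x \<in> (\<Union>p\<in>F. ball p (r p))" using F(2) by blast
    then show ?thesis by auto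
  qed
  then show ?thesis using that[OF F(1)] by blast
qed

lemma graph_move_0 [simp]: "graph_move p 0 v = p"
  using good_radius_exists good_radiusD(2) by metis

lemma dist_center_move:
  assumes "good_radius p R" "v \<in> Vec p" "0 \<le> t" "t < R"
  shows "dist p (graph_move p t v) = t"
  using good_radiusD(1)[OF assms(1)] good_radiusD(3)[OF assms(1,2), of 0 t] assms by auto

lemma inj_on_move:
  assumes "good_radius p R" "0 < s" "s < R"
  shows "inj_on (graph_move p s) (Vec p)"
proof (rule inj_onI, rule ccontr)
  fix v w assume "v \<in> Vec p" "w \<in> Vec p" "graph_move p s v = graph_move p s w" "v \<noteq> w"
  then show False using good_radiusD(4)[OF assms(1), of v w s s] assms by simp
qed

lemma sphere_eq_move:
  assumes "good_radius p R" "0 < s" "s < R"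
  shows "{x. dist p x = s} = graph_move p s ` Vec p"
proof (intro equalityI subsetI)
  fix x assume "x \<in> {x. dist p x = s}"
  then show "x \<in> graph_move p s ` Vec p" using good_radiusD(5)[OF assms(1), of x] assms by auto
qed (use dist_center_move[OF assms(1)] assms in auto)

lemma sum_sphere:
  assumes "good_radius p R" "0 < s" "s < R"
  shows "(\<Sum>x | dist p x = s. g x) = (\<Sum>v\<in>Vec p. g (graph_move p s v))"
  unfolding sphere_eq_move[OF assms] by (simp add: sum.reindex[OF inj_on_move[OF assms]])

text \<open>Affine on a neighbourhood of \<open>p\<close> along each of the rays at \<open>p\<close>. Near any other point the rays of its own
  chart have to be compared with those at \<open>p\<close>; see \<open>lapl_inside_ray\<close>.\<close>

definition ray_affine :: "('a::metrized_graph \<Rightarrow> real) \<Rightarrow> 'a \<Rightarrow> bool" where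
  "ray_affine f p \<longleftrightarrow> (\<exists>\<sigma>>0. \<exists>\<alpha>. \<forall>v\<in>Vec p. \<forall>t\<in>{0..<\<sigma>}. f (graph_move p t v) = f p + t * \<alpha> v)"

definition ray_slope :: "('a::metrized_graph \<Rightarrow> real) \<Rightarrow> 'a \<Rightarrow> complex \<Rightarrow> real" where
  "ray_slope f p v = Lim (at_right 0) (\<lambda>t. (f (graph_move p t v) - f p) / t)"

definition lapl :: "('a::metrized_graph \<Rightarrow> real) \<Rightarrow> 'a \<Rightarrow> real" where
  "lapl f p = - (\<Sum>v\<in>Vec p. ray_slope f p v)"

definition locally_affine :: "('a::metrized_graph \<Rightarrow> real) \<Rightarrow> bool" where
  "locally_affine f \<longleftrightarrow> (\<forall>p. ray_affine f p)"

lemma ray_slope_eq: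
  assumes "\<sigma> > 0" "\<And>t. 0 \<le> t \<Longrightarrow> t < \<sigma> \<Longrightarrow> f (graph_move p t v) = f p + t * \<alpha>"
  shows "ray_slope f p v = \<alpha>"
  unfolding ray_slope_def
proof (rule tendsto_Lim)
  have "eventually (\<lambda>t::real. 0 < t \<and> t < \<sigma>) (at_right 0)"
    using assms(1) by (auto simp: eventually_at_right_field)
  then have "eventually (\<lambda>t. \<alpha> = (f (graph_move p t v) - f p) / t) (at_right 0)"
    by eventually_elim (simp add: assms)
  then show "((\<lambda>t. (f (graph_move p t v) - f p) / t) \<longlongrightarrow> \<alpha>) (at_right 0)"
    by (rule tendsto_eventually[OF eventually_mono]) auto
qed auto

lemma lapl_at_center:
  assumes "\<sigma> > 0" "\<And>v t. v \<in> Vec p \<Longrightarrow> 0 \<le> t \<Longrightarrow> t < \<sigma> \<Longrightarrow> f (graph_move p t v) = f p + t * \<alpha> v"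
  shows "ray_affine f p" "lapl f p = - (\<Sum>v\<in>Vec p. \<alpha> v)"
proof -
  show "ray_affine f p" unfolding ray_affine_def using assms by force
  have "(\<Sum>v\<in>Vec p. ray_slope f p v) = (\<Sum>v\<in>Vec p. \<alpha> v)"
    by (intro sum.cong refl ray_slope_eq[OF assms(1)] assms(2)) auto
  then show "lapl f p = - (\<Sum>v\<in>Vec p. \<alpha> v)" by (simp add: lapl_def)
qed

lemma ray_affineE:
  assumes "ray_affine f p"
  obtains \<sigma> where "\<sigma> > 0"
    "\<And>v t. v \<in> Vec p \<Longrightarrow> 0 \<le> t \<Longrightarrow> t < \<sigma> \<Longrightarrow> f (graph_move p t v) = f p + t * ray_slope f p v"
proof -
  obtain \<sigma> \<alpha> where \<sigma>: "\<sigma> > 0"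
    "\<And>v t. v \<in> Vec p \<Longrightarrow> 0 \<le> t \<Longrightarrow> t < \<sigma> \<Longrightarrow> f (graph_move p t v) = f p + t * \<alpha> v"
    using assms unfolding ray_affine_def by force
  then have "ray_slope f p v = \<alpha> v" if "v \<in> Vec p" for v using that by (intro ray_slope_eq) auto
  with \<sigma> show ?thesis by (intro that[of \<sigma>]) auto
qed

text \<open>A description of the Laplacian by distances alone. It makes the Laplacian at a point computable in
  the chart of a neighbouring point.\<close>

lemma lapl_sphere:
  assumes "ray_affine f p"
  obtains \<sigma> where "\<sigma> > 0"
    "\<And>s. 0 < s \<Longrightarrow> s < \<sigma> \<Longrightarrow> (\<Sum>x | dist p x = s. f p - f x) = s * lapl f p"
    "\<And>s. 0 < s \<Longrightarrow> s < \<sigma> \<Longrightarrow> finite {x. dist p x = s}"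
proof -
  obtain \<sigma> where \<sigma>: "\<sigma> > 0"
    "\<And>v t. v \<in> Vec p \<Longrightarrow> 0 \<le> t \<Longrightarrow> t < \<sigma> \<Longrightarrow> f (graph_move p t v) = f p + t * ray_slope f p v"
    using ray_affineE[OF assms] by blast
  obtain R where R: "good_radius p R" using good_radius_exists by blast
  show ?thesis
  proof (rule that[of "min \<sigma> R"])
    show "0 < min \<sigma> R" using \<sigma>(1) good_radiusD(1)[OF R] by simp
    fix s assume s: "0 < s" "s < min \<sigma> R"
    then have sR: "s < R" by simp
    show "(\<Sum>x | dist p x = s. f p - f x) = s * lapl f p"
      unfolding sum_sphere[OF R s(1) sR] lapl_def using s
      by (simp add: \<sigma> sum_negf sum_distrib_left)
    show "finite {x. dist p x = s}"
      unfolding sphere_eq_move[OF R s(1) sR] using Vec_finite by blast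
  qed
qed

lemma ray_affine_nearE:
  assumes "ray_affine f p"
  obtains \<sigma> where "\<sigma> > 0"
    "\<And>x. dist p x < \<sigma> \<Longrightarrow> \<exists>v\<in>Vec p. x = graph_move p (dist p x) v \<and> f x = f p + dist p x * ray_slope f p v"
proof -
  obtain \<sigma> where \<sigma>: "\<sigma> > 0"
    "\<And>v t. v \<in> Vec p \<Longrightarrow> 0 \<le> t \<Longrightarrow> t < \<sigma> \<Longrightarrow> f (graph_move p t v) = f p + t * ray_slope f p v"
    using ray_affineE[OF assms] by blast
  obtain R where R: "good_radius p R" using good_radius_exists by blast
  show ?thesis
  proof (rule that[of "min \<sigma> R"])
    show "0 < min \<sigma> R" using \<sigma>(1) good_radiusD(1)[OF R] by simp
    fix x assume x: "dist p x < min \<sigma> R"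
    then obtain v where "v \<in> Vec p" "x = graph_move p (dist p x) v"
      using good_radiusD(5)[OF R] by auto
    then show "\<exists>v\<in>Vec p. x = graph_move p (dist p x) v \<and> f x = f p + dist p x * ray_slope f p v"
      using \<sigma>(2)[of v "dist p x"] x by auto
  qed
qed

lemma points_near_ray:
  assumes R: "good_radius p R" and v: "v \<in> Vec p"
    and x: "dist (graph_move p t v) x = s" "s < t" "t + s < R"
  shows "x = graph_move p (t + s) v \<or> x = graph_move p (t - s) v"
proof -
  have s0: "0 \<le> s" using x(1) zero_le_dist by metis
  have "dist p x \<le> dist p (graph_move p t v) + s" using x(1) dist_triangle[of p x "graph_move p t v"] by simp
  also have "dist p (graph_move p t v) = t" using dist_center_move[OF R v] x s0 by simp
  finally have "dist p x < R" using x by simp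
  then obtain w where w: "w \<in> Vec p" "x = graph_move p (dist p x) w" using good_radiusD(5)[OF R] by auto
  have "w = v"
  proof (rule ccontr)
    assume "w \<noteq> v"
    then have "dist (graph_move p t v) (graph_move p (dist p x) w) = t + dist p x"
      using good_radiusD(4)[OF R v w(1), of t "dist p x"] x s0 \<open>dist p x < R\<close> by auto
    then show False using x w(2) zero_le_dist[of p x] by simp
  qed
  then have "s = \<bar>t - dist p x\<bar>"
    using good_radiusD(3)[OF R v, of t "dist p x"] x s0 \<open>dist p x < R\<close> w(2) by auto
  then have "dist p x = t + s \<or> dist p x = t - s" by linarith
  then show ?thesis using w \<open>w = v\<close> by metis
qed

text \<open>A point inside a ray has exactly two points at each small distance, one on each side. A ray
  that starts there cannot change sides, since its points at distances \<open>s\<close> and \<open>s'\<close>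
  are \<open>\<bar>s - s'\<bar>\<close> and not \<open>s + s'\<close> apart.\<close>

lemma lapl_inside_ray:
  assumes R: "good_radius p R" and v: "v \<in> Vec p" and t: "0 < t" "t < R"
    and \<sigma>: "\<sigma> > 0"
    and right: "\<And>s. 0 \<le> s \<Longrightarrow> s < \<sigma> \<Longrightarrow> t + s < R \<Longrightarrow>
      f (graph_move p (t + s) v) = f (graph_move p t v) + s * \<alpha>"
    and left: "\<And>s. 0 \<le> s \<Longrightarrow> s < \<sigma> \<Longrightarrow> s < t \<Longrightarrow>
      f (graph_move p (t - s) v) = f (graph_move p t v) + s * \<beta>"
  shows "ray_affine f (graph_move p t v)" "lapl f (graph_move p t v) = - (\<alpha> + \<beta>)"
proof -
  define q where "q = graph_move p t v"
  obtain Q where Q: "good_radius q Q" using good_radius_exists by blast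
  define \<tau> where "\<tau> = min (min \<sigma> Q) (min t (R - t))"
  have \<tau>: "0 < \<tau>" "\<tau> \<le> \<sigma>" "\<tau> \<le> Q" "\<tau> \<le> t" "t + \<tau> \<le> R"
    using \<sigma> t good_radiusD(1)[OF Q] unfolding \<tau>_def by auto
  define r l where "r s = graph_move p (t + s) v" and "l s = graph_move p (t - s) v" for s
  have two: "x = r s \<or> x = l s" if "dist q x = s" "s < \<tau>" for x s
    using points_near_ray[OF R v, of t x s] that \<tau> unfolding q_def r_def l_def by auto
  have fr: "f (r s) = f q + s * \<alpha>" if "0 \<le> s" "s < \<tau>" for s
    unfolding r_def q_def using right[of s] that \<tau> by auto
  have fl: "f (l s) = f q + s * \<beta>" if "0 \<le> s" "s < \<tau>" for s
    unfolding l_def q_def using left[of s] that \<tau> by auto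
  have drl: "dist (r a) (l b) = a + b" if "0 \<le> a" "a < \<tau>" "0 \<le> b" "b < \<tau>" for a b
    unfolding r_def l_def using good_radiusD(3)[OF R v, of "t + a" "t - b"] that \<tau> by auto
  have dqr: "dist q (r s) = s" "dist q (l s) = s" if "0 \<le> s" "s < \<tau>" for s
    using good_radiusD(3)[OF R v, of "t" "t + s"] good_radiusD(3)[OF R v, of "t" "t - s"] that \<tau> t
    unfolding r_def l_def q_def by auto
  \<comment> \<open>One point of the ray \<open>w\<close> tells on which side the whole short ray runs.\<close>
  define \<gamma> where "\<gamma> w = (if graph_move q (\<tau>/2) w = r (\<tau>/2) then \<alpha> else \<beta>)" for w
  have slope: "f (graph_move q s w) = f q + s * \<gamma> w" if w: "w \<in> Vec q" and s: "0 \<le> s" "s < \<tau>" for s w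
  proof (cases "s = 0")
    case False
    have d: "dist q (graph_move q s w) = s" "dist q (graph_move q (\<tau>/2) w) = \<tau>/2"
      using dist_center_move[OF Q w] s \<tau> by auto
    have dd: "dist (graph_move q s w) (graph_move q (\<tau>/2) w) = \<bar>s - \<tau>/2\<bar>"
      using good_radiusD(3)[OF Q w] s \<tau> by auto
    have ne: "\<bar>s - \<tau>/2\<bar> \<noteq> s + \<tau>/2" using s False \<tau> by linarith
    have a: "graph_move q s w = r s \<or> graph_move q s w = l s" using two[OF d(1)] s by auto
    have b: "graph_move q (\<tau>/2) w = r (\<tau>/2) \<or> graph_move q (\<tau>/2) w = l (\<tau>/2)"
      using two[OF d(2)] \<tau> by auto
    have "graph_move q s w = r s \<longleftrightarrow> graph_move q (\<tau>/2) w = r (\<tau>/2)"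
      using a b dd ne drl[of s "\<tau>/2"] drl[of "\<tau>/2" s] s \<tau> by (auto simp: dist_commute)
    then show ?thesis using a fr[of s] fl[of s] s unfolding \<gamma>_def by auto
  qed auto
  show ra: "ray_affine f (graph_move p t v)"
    using lapl_at_center(1)[OF \<tau>(1), of q f \<gamma>] slope unfolding q_def by blast
  obtain \<rho> where \<rho>: "\<rho> > 0"
    "\<And>s. 0 < s \<Longrightarrow> s < \<rho> \<Longrightarrow> (\<Sum>x | dist q x = s. f q - f x) = s * lapl f q"
    using lapl_sphere[OF ra] unfolding q_def by metis
  define s where "s = min \<rho> \<tau> / 2"
  have s: "0 < s" "s < \<rho>" "s < \<tau>" using \<rho> \<tau> unfolding s_def by auto
  have "{x. dist q x = s} = {r s, l s}" using two[of _ s] dqr[of s] s by auto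
  moreover have "r s \<noteq> l s" using drl[of s s] s by auto
  ultimately have "(\<Sum>x | dist q x = s. f q - f x) = - s * (\<alpha> + \<beta>)"
    using fr[of s] fl[of s] s by (simp add: algebra_simps)
  then have "s * lapl f q = s * (- (\<alpha> + \<beta>))" using \<rho>(2)[of s] s by (simp add: algebra_simps)
  then show "lapl f (graph_move p t v) = - (\<alpha> + \<beta>)" using s unfolding q_def by simp
qed

lemma lapl_cong:
  assumes eps: "\<epsilon> > 0" and eq: "\<And>x. dist p x < \<epsilon> \<Longrightarrow> f x = g x" and f: "ray_affine f p"
  shows "ray_affine g p" "lapl g p = lapl f p"
proof -
  obtain \<sigma> where \<sigma>: "\<sigma> > 0"
    "\<And>v t. v \<in> Vec p \<Longrightarrow> 0 \<le> t \<Longrightarrow> t < \<sigma> \<Longrightarrow> f (graph_move p t v) = f p + t * ray_slope f p v"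
    using ray_affineE[OF f] by blast
  obtain R where R: "good_radius p R" using good_radius_exists by blast
  have pos: "min (min \<sigma> \<epsilon>) R > 0" using \<sigma> eps good_radiusD(1)[OF R] by auto
  have g: "g (graph_move p t v) = g p + t * ray_slope f p v"
    if "v \<in> Vec p" "0 \<le> t" "t < min (min \<sigma> \<epsilon>) R" for v t
    using \<sigma>(2)[of v t] eq[of p] eq[of "graph_move p t v"] dist_center_move[OF R, of v t] that eps by auto
  show "ray_affine g p" using lapl_at_center(1)[OF pos g] by blast
  show "lapl g p = lapl f p" using lapl_at_center(2)[OF pos g] by (simp add: lapl_def)
qed

lemma lapl_const [simp]: "ray_affine (\<lambda>x. c) p" "lapl (\<lambda>x. c) p = 0"
  using lapl_at_center[of 1 p "\<lambda>x. c" "\<lambda>v. 0"] by auto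

lemma lapl_locally_const:
  assumes "\<epsilon> > 0" "\<And>x. dist p x < \<epsilon> \<Longrightarrow> f x = c"
  shows "ray_affine f p" "lapl f p = 0"
  using lapl_cong[of \<epsilon> p "\<lambda>x. c" f] assms by auto

lemma lapl_add:
  assumes "ray_affine f p" "ray_affine g p"
  shows "ray_affine (\<lambda>x. f x + g x) p" "lapl (\<lambda>x. f x + g x) p = lapl f p + lapl g p"
proof -
  obtain \<sigma> where \<sigma>: "\<sigma> > 0"
    "\<And>v t. v \<in> Vec p \<Longrightarrow> 0 \<le> t \<Longrightarrow> t < \<sigma> \<Longrightarrow> f (graph_move p t v) = f p + t * ray_slope f p v"
    using ray_affineE[OF assms(1)] by blast
  obtain \<tau> where \<tau>: "\<tau> > 0"
    "\<And>v t. v \<in> Vec p \<Longrightarrow> 0 \<le> t \<Longrightarrow> t < \<tau> \<Longrightarrow> g (graph_move p t v) = g p + t * ray_slope g p v"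
    using ray_affineE[OF assms(2)] by blast
  have pos: "min \<sigma> \<tau> > 0" using \<sigma> \<tau> by auto
  have fg: "(\<lambda>x. f x + g x) (graph_move p t v) = (\<lambda>x. f x + g x) p + t * (ray_slope f p v + ray_slope g p v)"
    if "v \<in> Vec p" "0 \<le> t" "t < min \<sigma> \<tau>" for v t
    using \<sigma>(2)[of v t] \<tau>(2)[of v t] that by (simp add: algebra_simps)
  show "ray_affine (\<lambda>x. f x + g x) p" "lapl (\<lambda>x. f x + g x) p = lapl f p + lapl g p"
    using lapl_at_center[OF pos fg] by (simp_all add: lapl_def sum.distrib)
qed

lemma lapl_cmult:
  assumes "ray_affine f p"
  shows "ray_affine (\<lambda>x. c * f x) p" "lapl (\<lambda>x. c * f x) p = c * lapl f p"
proof -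
  obtain \<sigma> where \<sigma>: "\<sigma> > 0"
    "\<And>v t. v \<in> Vec p \<Longrightarrow> 0 \<le> t \<Longrightarrow> t < \<sigma> \<Longrightarrow> f (graph_move p t v) = f p + t * ray_slope f p v"
    using ray_affineE[OF assms] by blast
  have cf: "(\<lambda>x. c * f x) (graph_move p t v) = (\<lambda>x. c * f x) p + t * (c * ray_slope f p v)"
    if "v \<in> Vec p" "0 \<le> t" "t < \<sigma>" for v t
    using \<sigma>(2)[of v t] that by (simp add: algebra_simps)
  show "ray_affine (\<lambda>x. c * f x) p" "lapl (\<lambda>x. c * f x) p = c * lapl f p"
    using lapl_at_center[OF \<sigma>(1) cf] by (simp_all add: lapl_def sum_distrib_left)
qed

lemma lapl_diff:
  assumes "ray_affine f p" "ray_affine g p"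
  shows "ray_affine (\<lambda>x. f x - g x) p" "lapl (\<lambda>x. f x - g x) p = lapl f p - lapl g p"
  using lapl_add[OF assms(1) lapl_cmult(1)[OF assms(2), of "-1"]] lapl_cmult(2)[OF assms(2), of "-1"]
  by simp_all

lemma lapl_sum:
  assumes "finite I" "\<And>i. i \<in> I \<Longrightarrow> ray_affine (f i) p"
  shows "ray_affine (\<lambda>x. \<Sum>i\<in>I. f i x) p" "lapl (\<lambda>x. \<Sum>i\<in>I. f i x) p = (\<Sum>i\<in>I. lapl (f i) p)"
proof -
  have "ray_affine (\<lambda>x. \<Sum>i\<in>I. f i x) p \<and> lapl (\<lambda>x. \<Sum>i\<in>I. f i x) p = (\<Sum>i\<in>I. lapl (f i) p)"
    using assms
  proof (induction I)
    case (insert i I)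
    have IH: "ray_affine (\<lambda>x. \<Sum>i\<in>I. f i x) p" "lapl (\<lambda>x. \<Sum>i\<in>I. f i x) p = (\<Sum>i\<in>I. lapl (f i) p)"
      using insert.IH insert.prems by auto
    have "ray_affine (f i) p" using insert.prems by auto
    from lapl_add[OF this IH(1)] IH(2) insert.hyps show ?case by (simp only: sum.insert) simp
  qed simp
  then show "ray_affine (\<lambda>x. \<Sum>i\<in>I. f i x) p" "lapl (\<lambda>x. \<Sum>i\<in>I. f i x) p = (\<Sum>i\<in>I. lapl (f i) p)"
    by auto
qed

lemma ray_affine_continuous:
  assumes "ray_affine f p" shows "isCont f p"
proof -
  obtain \<sigma> where \<sigma>: "\<sigma> > 0"
    "\<And>x. dist p x < \<sigma> \<Longrightarrow> \<exists>v\<in>Vec p. x = graph_move p (dist p x) v \<and> f x = f p + dist p x * ray_slope f p v"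
    using ray_affine_nearE[OF assms] by blast
  define M where "M = (\<Sum>v\<in>Vec p. \<bar>ray_slope f p v\<bar>)"
  have near: "\<bar>f x - f p\<bar> \<le> M * dist p x" if "dist p x < \<sigma>" for x
  proof -
    obtain v where v: "v \<in> Vec p" "f x = f p + dist p x * ray_slope f p v" using \<sigma>(2)[OF \<open>dist p x < \<sigma>\<close>] by blast
    have "\<bar>ray_slope f p v\<bar> \<le> M" unfolding M_def using v Vec_finite by (intro member_le_sum) auto
    then show ?thesis using v by (simp add: abs_mult mult.commute[of M] mult_left_mono)
  qed
  have "((\<lambda>x. f x - f p) \<longlongrightarrow> 0) (at p)"
  proof (rule Lim_null_comparison)
    show "eventually (\<lambda>x. norm (f x - f p) \<le> M * dist p x) (at p)"
      using \<sigma>(1) near by (auto simp: eventually_at dist_commute)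
    have "((\<lambda>x. M * dist p x) \<longlongrightarrow> M * dist p p) (at p)" by (intro tendsto_intros)
    then show "((\<lambda>x. M * dist p x) \<longlongrightarrow> 0) (at p)" by simp
  qed
  then show ?thesis unfolding isCont_def using LIM_zero_iff by blast
qed

text \<open>Where \<open>f p \<noteq> c\<close> the truncation agrees near \<open>p\<close> with \<open>f\<close> or with \<open>c\<close>; where \<open>f p = c\<close> it replaces the
  negative slopes by \<open>0\<close>.\<close>

lemma lapl_max_const:
  assumes f: "ray_affine f p"
  shows "ray_affine (\<lambda>x. max (f x) c) p"
    "f p > c \<Longrightarrow> lapl (\<lambda>x. max (f x) c) p = lapl f p"
    "f p < c \<Longrightarrow> lapl (\<lambda>x. max (f x) c) p = 0"
proof -
  have cont: "(f \<longlongrightarrow> f p) (nhds p)"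
    using ray_affine_continuous[OF f] by (simp add: isCont_def tendsto_at_iff_tendsto_nhds)
  have less: "ray_affine (\<lambda>x. max (f x) c) p \<and> lapl (\<lambda>x. max (f x) c) p = 0" if lt: "f p < c"
  proof -
    obtain \<epsilon> where \<epsilon>: "\<epsilon> > 0" "\<And>x. dist p x < \<epsilon> \<Longrightarrow> f x < c"
      using order_tendstoD(2)[OF cont lt] by (auto simp: eventually_nhds_metric dist_commute)
    have "max (f x) c = c" if "dist p x < \<epsilon>" for x using \<epsilon>(2)[OF that] by simp
    then show ?thesis using lapl_locally_const[where f = "\<lambda>x. max (f x) c", OF \<epsilon>(1)] by blast
  qed
  have gt: "ray_affine (\<lambda>x. max (f x) c) p \<and> lapl (\<lambda>x. max (f x) c) p = lapl f p" if gt: "f p > c"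
  proof -
    obtain \<epsilon> where \<epsilon>: "\<epsilon> > 0" "\<And>x. dist p x < \<epsilon> \<Longrightarrow> c < f x"
      using order_tendstoD(1)[OF cont gt] by (auto simp: eventually_nhds_metric dist_commute)
    have "f x = max (f x) c" if "dist p x < \<epsilon>" for x using \<epsilon>(2)[OF that] by simp
    then show ?thesis using lapl_cong[where g = "\<lambda>x. max (f x) c", OF \<epsilon>(1) _ f] by blast
  qed
  have "ray_affine (\<lambda>x. max (f x) c) p" if eq: "f p = c"
  proof -
    obtain \<sigma> where \<sigma>: "\<sigma> > 0"
      "\<And>v t. v \<in> Vec p \<Longrightarrow> 0 \<le> t \<Longrightarrow> t < \<sigma> \<Longrightarrow> f (graph_move p t v) = f p + t * ray_slope f p v"
      using ray_affineE[OF f] by blast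
    have "max (f (graph_move p t v)) c = max (f p) c + t * max (ray_slope f p v) 0"
      if "v \<in> Vec p" "0 \<le> t" "t < \<sigma>" for v t
    proof (cases "0 \<le> ray_slope f p v")
      case True
      then have "0 \<le> t * ray_slope f p v" using that by simp
      then show ?thesis using \<sigma>(2)[of v t] that eq True by (simp add: max_absorb1)
    next
      case False
      then have "t * ray_slope f p v \<le> 0" using that by (simp add: mult_nonneg_nonpos)
      then show ?thesis using \<sigma>(2)[of v t] that eq False by (simp add: max_def)
    qed
    then show ?thesis by (intro lapl_at_center(1)[OF \<sigma>(1)]) auto
  qed
  then show "ray_affine (\<lambda>x. max (f x) c) p" using less gt by (metis linorder_less_linear)
  show "f p > c \<Longrightarrow> lapl (\<lambda>x. max (f x) c) p = lapl f p" using gt by blast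
  show "f p < c \<Longrightarrow> lapl (\<lambda>x. max (f x) c) p = 0" using less by blast
qed

lemma locally_affineD: "locally_affine f \<Longrightarrow> ray_affine f p"
  by (simp add: locally_affine_def)

lemma locally_affine_continuous: "locally_affine f \<Longrightarrow> continuous_on S f"
  using ray_affine_continuous locally_affineD by (metis continuous_at_imp_continuous_on)

lemma locally_affine_intros:
  "locally_affine (\<lambda>x. c)"
  "locally_affine f \<Longrightarrow> locally_affine g \<Longrightarrow> locally_affine (\<lambda>x. f x + g x)"
  "locally_affine f \<Longrightarrow> locally_affine g \<Longrightarrow> locally_affine (\<lambda>x. f x - g x)"
  "locally_affine f \<Longrightarrow> locally_affine (\<lambda>x. c * f x)"
  "finite I \<Longrightarrow> (\<And>i. i \<in> I \<Longrightarrow> locally_affine (F i)) \<Longrightarrow> locally_affine (\<lambda>x. \<Sum>i\<in>I. F i x)"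
  "locally_affine f \<Longrightarrow> locally_affine (\<lambda>x. max (f x) c)"
  by (simp_all add: locally_affine_def lapl_const lapl_add lapl_diff lapl_cmult lapl_sum lapl_max_const)

lemma locally_affine_min_const: "locally_affine f \<Longrightarrow> locally_affine (\<lambda>x. min (f x) c)"
proof -
  assume "locally_affine f"
  then have "locally_affine (\<lambda>x. (-1) * max ((-1) * f x) (- c))" by (intro locally_affine_intros)
  moreover have "(\<lambda>x. (-1) * max ((-1) * f x) (- c)) = (\<lambda>x. min (f x) c)" by (auto simp: max_def min_def)
  ultimately show ?thesis by simp
qed

text \<open>The support of the Laplacian is finite because it is discrete and closed in a compact space:
  near \<open>p\<close> the function is affine on every ray, so only \<open>p\<close> itself can carry mass.\<close>

lemma finite_lapl_support:
  assumes f: "locally_affine f"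
  shows "finite {p. lapl f p \<noteq> 0}"
proof -
  have "\<exists>\<epsilon>>0. \<forall>x. dist p x < \<epsilon> \<longrightarrow> x \<noteq> p \<longrightarrow> lapl f x = 0" for p
  proof -
    obtain \<sigma> where \<sigma>: "\<sigma> > 0"
      "\<And>v t. v \<in> Vec p \<Longrightarrow> 0 \<le> t \<Longrightarrow> t < \<sigma> \<Longrightarrow> f (graph_move p t v) = f p + t * ray_slope f p v"
      using ray_affineE[OF locally_affineD[OF f]] by blast
    obtain R where R: "good_radius p R" using good_radius_exists by blast
    have "lapl f x = 0" if x: "dist p x < min \<sigma> R" "x \<noteq> p" for x
    proof -
      obtain v where v: "v \<in> Vec p" "x = graph_move p (dist p x) v"
        using good_radiusD(5)[OF R, of x] x by auto
      have pos: "0 < dist p x" using x by auto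
      have "lapl f (graph_move p (dist p x) v) = - (ray_slope f p v + - ray_slope f p v)"
        using \<sigma>(2)[OF v(1)] pos x
        by (intro lapl_inside_ray(2)[OF R v(1) pos, where \<sigma> = "\<sigma> - dist p x"]) (auto simp: algebra_simps)
      then show ?thesis using v by simp
    qed
    then show ?thesis using \<sigma> good_radiusD(1)[OF R] by (intro exI[of _ "min \<sigma> R"]) auto
  qed
  then obtain \<epsilon> where \<epsilon>: "\<And>p. \<epsilon> p > 0" "\<And>p x. dist p x < \<epsilon> p \<Longrightarrow> x \<noteq> p \<Longrightarrow> lapl f x = 0" by metis
  obtain C where C: "finite C" "\<And>x. \<exists>p\<in>C. dist p x < \<epsilon> p" using finite_ball_cover[of \<epsilon>] \<epsilon>(1) by blast
  have "x \<in> C" if "lapl f x \<noteq> 0" for x using C(2)[of x] \<epsilon>(2) that by blast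
  then have "{p. lapl f p \<noteq> 0} \<subseteq> C" by blast
  then show ?thesis using C finite_subset by blast
qed

section \<open>The maximum principle\<close>

lemma lapl_at_max:
  assumes f: "ray_affine f p" and \<epsilon>: "\<epsilon> > 0" "\<And>x. dist p x < \<epsilon> \<Longrightarrow> f x \<le> f p"
  shows "0 \<le> lapl f p"
proof -
  obtain \<sigma> where \<sigma>: "\<sigma> > 0"
    "\<And>s. 0 < s \<Longrightarrow> s < \<sigma> \<Longrightarrow> (\<Sum>x | dist p x = s. f p - f x) = s * lapl f p"
    using lapl_sphere[OF f] by metis
  define s where "s = min \<sigma> \<epsilon> / 2"
  have s: "0 < s" "s < \<sigma>" "s < \<epsilon>" using \<sigma> \<epsilon> unfolding s_def by auto
  have "0 \<le> (\<Sum>x | dist p x = s. f p - f x)" by (intro sum_nonneg) (use \<epsilon> s in auto)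
  then show ?thesis using \<sigma>(2)[of s] s by (simp add: zero_le_mult_iff)
qed

lemma lapl_at_min:
  assumes f: "ray_affine f p" and \<epsilon>: "\<epsilon> > 0" "\<And>x. dist p x < \<epsilon> \<Longrightarrow> f p \<le> f x"
  shows "lapl f p \<le> 0"
  using lapl_at_max[OF lapl_cmult(1)[OF f, of "-1"] \<epsilon>(1)] lapl_cmult(2)[OF f, of "-1"] \<epsilon>(2) by simp

text \<open>At a maximum point with nonpositive Laplacian the nonnegative differences to the points of a small
  sphere have a nonpositive sum, so they vanish. Thus the maximum set is open, and the graph is connected.\<close>

lemma maximum_principle:
  assumes f: "locally_affine f" and sub: "\<And>p. (\<And>x. f x \<le> f p) \<Longrightarrow> lapl f p \<le> 0"
  shows "f x = f y"
proof -
  obtain m where m: "\<And>x. f x \<le> f m"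
    using continuous_attains_sup[OF compact_graph _ locally_affine_continuous[OF f]] by auto
  let ?M = "{x. f x = f m}"
  have "open ?M"
  proof (subst open_dist, intro ballI)
    fix p assume "p \<in> ?M"
    then have p: "f p = f m" by simp
    then have max: "f x \<le> f p" for x using m by simp
    obtain \<sigma> where \<sigma>: "\<sigma> > 0"
      "\<And>s. 0 < s \<Longrightarrow> s < \<sigma> \<Longrightarrow> (\<Sum>x | dist p x = s. f p - f x) = s * lapl f p"
      "\<And>s. 0 < s \<Longrightarrow> s < \<sigma> \<Longrightarrow> finite {x. dist p x = s}"
      using lapl_sphere[OF locally_affineD[OF f]] by metis
    have "f x = f m" if x: "dist x p < \<sigma>" for x
    proof (cases "x = p")
      case False
      then have s: "0 < dist p x" "dist p x < \<sigma>" using x by (auto simp: dist_commute)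
      have "(\<Sum>y | dist p y = dist p x. f p - f y) \<le> 0"
        using \<sigma>(2)[OF s] sub[OF max] s by (simp add: mult_nonneg_nonpos)
      moreover have "f p - f x \<le> (\<Sum>y | dist p y = dist p x. f p - f y)"
        using \<sigma>(3)[OF s] max by (intro member_le_sum) auto
      ultimately show ?thesis using max[of x] p by linarith
    qed (use p in auto)
    then show "\<exists>e>0. \<forall>y. dist y p < e \<longrightarrow> y \<in> ?M" using \<sigma>(1) by auto
  qed
  moreover have "closed ?M"
    using continuous_closed_preimage_constant[OF locally_affine_continuous[OF f] closed_UNIV, of "f m"] by simp
  moreover have "m \<in> ?M" by simp
  ultimately have "?M = UNIV" using connected_graph by (auto simp: connected_clopen)
  then show ?thesis by (metis (mono_tags, lifting) UNIV_I mem_Collect_eq)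
qed

lemma harmonic_const:
  assumes "locally_affine f" "\<And>p. lapl f p = 0" shows "f x = f y"
  using maximum_principle[OF assms(1)] assms(2) by simp

section \<open>Tents supported in a single star\<close>

text \<open>At the point at distance \<open>a\<close> on the ray \<open>v\<close> the slope jumps by \<open>\<alpha> v a\<close>. The jumps with \<open>a = 0\<close> are
  the slopes at \<open>p\<close> itself, so that the formula also holds there.\<close>

lemma radial_function_lapl:
  fixes f :: "'a::metrized_graph \<Rightarrow> real"
  assumes R: "good_radius p R" and A: "finite A" "A \<subseteq> {0..<R}"
    and off: "R' < R" "\<And>x. R' < dist p x \<Longrightarrow> f x = 0"
    and on: "\<And>v t. v \<in> Vec p \<Longrightarrow> 0 \<le> t \<Longrightarrow> t < R \<Longrightarrow>
      f (graph_move p t v) = h + (\<Sum>a\<in>A. \<alpha> v a * max 0 (t - a))"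
  shows "ray_affine f q"
    "lapl f q = - (\<Sum>v\<in>Vec p. \<Sum>a\<in>A. \<alpha> v a * of_bool (q = graph_move p a v))"
proof -
  have R0: "0 < R" using good_radiusD(1)[OF R] .
  have A': "0 \<le> a" "a < R" if "a \<in> A" for a using A that by auto
  consider "R \<le> dist p q" | "q = p" | "0 < dist p q" "dist p q < R" by fastforce
  then have "ray_affine f q \<and>
    lapl f q = - (\<Sum>v\<in>Vec p. \<Sum>a\<in>A. \<alpha> v a * of_bool (q = graph_move p a v))"
  proof cases
    case 1
    then have pos: "0 < dist p q - R'" using off by linarith
    have zero: "f x = 0" if "dist q x < dist p q - R'" for x
      using off(2)[of x] dist_triangle[of p q x] that by (simp add: dist_commute)
    have lc: "ray_affine f q" "lapl f q = 0"
      using lapl_locally_const[where f = f and c = 0, OF pos zero] by blast+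
    have "q \<noteq> graph_move p a v" if "a \<in> A" "v \<in> Vec p" for a v
      using dist_center_move[OF R that(2) A'[OF that(1)]] A'[OF that(1)] 1 by auto
    then show ?thesis using lc by simp
  next
    case 2
    obtain \<delta> where \<delta>0: "\<delta> > 0" "\<forall>a\<in>A. a \<noteq> 0 \<longrightarrow> \<delta> \<le> dist 0 a"
      using finite_set_avoid[OF A(1), of 0] by blast
    then have \<delta>: "\<delta> > 0" "\<And>a. a \<in> A \<Longrightarrow> a \<noteq> 0 \<Longrightarrow> \<delta> \<le> a"
      using A' by (auto simp: dist_real_def)
    obtain v0 where v0: "v0 \<in> Vec p" using Vec_nonempty by blast
    have "(\<Sum>a\<in>A. \<alpha> v0 a * max 0 (0 - a)) = 0" by (intro sum.neutral) (auto simp: max_absorb1 A')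
    then have p: "f p = h" using on[OF v0, of 0] R0 by simp
    have pos: "min \<delta> R > 0" using \<delta> R0 by simp
    have c: "f (graph_move p t v) = f p + t * (\<Sum>a\<in>A. \<alpha> v a * of_bool (a = 0))"
      if v: "v \<in> Vec p" and t: "0 \<le> t" "t < min \<delta> R" for v t
    proof -
      have "\<alpha> v a * max 0 (t - a) = t * (\<alpha> v a * of_bool (a = 0))" if "a \<in> A" for a
        using \<delta>(2)[OF that] t by (cases "a = 0") auto
      then have "(\<Sum>a\<in>A. \<alpha> v a * max 0 (t - a)) = (\<Sum>a\<in>A. t * (\<alpha> v a * of_bool (a = 0)))"
        by (rule sum.cong[OF refl])
      then show ?thesis using on[OF v, of t] t p by (simp add: sum_distrib_left)
    qed
    have "p = graph_move p a v \<longleftrightarrow> a = 0" if "a \<in> A" "v \<in> Vec p" for a v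
      using dist_center_move[OF R that(2) A'[OF that(1)]] by auto
    moreover have "ray_affine f p" "lapl f p = - (\<Sum>v\<in>Vec p. \<Sum>a\<in>A. \<alpha> v a * of_bool (a = 0))"
      by (rule lapl_at_center[OF pos]; (rule c; assumption))+
    ultimately show ?thesis using 2 by (simp cong: sum.cong)
  next
    case 3
    define t where "t = dist p q"
    have t: "0 < t" "t < R" using 3 by (auto simp: t_def)
    obtain v where v: "v \<in> Vec p" "q = graph_move p t v" using good_radiusD(5)[OF R] t unfolding t_def by blast
    obtain \<delta> where "\<delta> > 0" "\<forall>a\<in>A. a \<noteq> t \<longrightarrow> \<delta> \<le> dist t a"
      using finite_set_avoid[OF A(1), of t] by blast
    then have \<delta>: "\<delta> > 0" "\<And>a. a \<in> A \<Longrightarrow> a \<noteq> t \<Longrightarrow> \<delta> \<le> \<bar>t - a\<bar>"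
      by (auto simp: dist_real_def)
    have r: "f (graph_move p (t + s) v) = f (graph_move p t v) + s * (\<Sum>a\<in>A. \<alpha> v a * of_bool (a \<le> t))"
      if s: "0 \<le> s" "s < \<delta>" "t + s < R" for s
    proof -
      have "\<alpha> v a * max 0 (t + s - a) = \<alpha> v a * max 0 (t - a) + s * (\<alpha> v a * of_bool (a \<le> t))"
        if "a \<in> A" for a
        using \<delta>(2)[OF that] s by (cases "a \<le> t") (auto simp: algebra_simps)
      then have "(\<Sum>a\<in>A. \<alpha> v a * max 0 (t + s - a))
          = (\<Sum>a\<in>A. \<alpha> v a * max 0 (t - a) + s * (\<alpha> v a * of_bool (a \<le> t)))"
        by (rule sum.cong[OF refl])
      then show ?thesis using on[OF v(1), of "t + s"] on[OF v(1), of t] s t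
        by (simp add: sum_distrib_left sum.distrib)
    qed
    have l: "f (graph_move p (t - s) v) = f (graph_move p t v) + s * - (\<Sum>a\<in>A. \<alpha> v a * of_bool (a < t))"
      if s: "0 \<le> s" "s < \<delta>" "s < t" for s
    proof -
      have "\<alpha> v a * max 0 (t - s - a) = \<alpha> v a * max 0 (t - a) - s * (\<alpha> v a * of_bool (a < t))"
        if "a \<in> A" for a
        using \<delta>(2)[OF that] s by (cases "a < t") (auto simp: algebra_simps)
      then have "(\<Sum>a\<in>A. \<alpha> v a * max 0 (t - s - a))
          = (\<Sum>a\<in>A. \<alpha> v a * max 0 (t - a) - s * (\<alpha> v a * of_bool (a < t)))"
        by (rule sum.cong[OF refl])
      then show ?thesis using on[OF v(1), of "t - s"] on[OF v(1), of t] s t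
        by (simp add: sum_distrib_left sum_subtractf)
    qed
    have lr: "ray_affine f q" "lapl f q = - ((\<Sum>a\<in>A. \<alpha> v a * of_bool (a \<le> t)) + - (\<Sum>a\<in>A. \<alpha> v a * of_bool (a < t)))"
      unfolding v(2) by (rule lapl_inside_ray[OF R v(1) t \<delta>(1)]; (rule r l; assumption))+
    have eq: "q = graph_move p a w \<longleftrightarrow> w = v \<and> a = t" if "a \<in> A" "w \<in> Vec p" for a w
    proof
      assume qa: "q = graph_move p a w"
      have "a = dist p q" unfolding qa using dist_center_move[OF R that(2) A'[OF that(1)]] by simp
      then have at: "a = t" by (simp only: t_def)
      have "w = v"
      proof (rule ccontr)
        assume "w \<noteq> v"
        then have "dist (graph_move p t v) (graph_move p a w) = t + a"
          using good_radiusD(4)[OF R v(1) that(2), of t a] t at by auto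
        then have "dist q q = t + a" using qa v(2) by metis
        then show False using t at by simp
      qed
      then show "w = v \<and> a = t" using at by blast
    next
      assume "w = v \<and> a = t"
      then show "q = graph_move p a w" using v(2) by blast
    qed
    have "(\<Sum>w\<in>Vec p. \<Sum>a\<in>A. \<alpha> w a * of_bool (q = graph_move p a w))
        = (\<Sum>w\<in>Vec p. if w = v then \<Sum>a\<in>A. \<alpha> v a * of_bool (a = t) else 0)"
    proof (intro sum.cong refl)
      fix w assume w: "w \<in> Vec p"
      show "(\<Sum>a\<in>A. \<alpha> w a * of_bool (q = graph_move p a w))
          = (if w = v then \<Sum>a\<in>A. \<alpha> v a * of_bool (a = t) else 0)"
        using eq[OF _ w] by (cases "w = v") (simp_all cong: sum.cong)
    qed
    also have "\<dots> = (\<Sum>a\<in>A. \<alpha> v a * of_bool (a = t))"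
      by (simp only: sum.delta[OF Vec_finite] v(1) if_True)
    also have "\<dots> = (\<Sum>a\<in>A. \<alpha> v a * of_bool (a \<le> t)) - (\<Sum>a\<in>A. \<alpha> v a * of_bool (a < t))"
      unfolding sum_subtractf[symmetric] by (intro sum.cong) auto
    finally show ?thesis using lr by simp
  qed
  then show "ray_affine f q"
    "lapl f q = - (\<Sum>v\<in>Vec p. \<Sum>a\<in>A. \<alpha> v a * of_bool (q = graph_move p a v))" by auto
qed

lemma sum_over_support:
  fixes L :: "'a \<Rightarrow> real"
  assumes "finite S" "{q. L q \<noteq> 0} \<subseteq> S"
  shows "(\<Sum>q | L q \<noteq> 0. g q * L q) = (\<Sum>q\<in>S. g q * L q)"
  using assms by (intro sum.mono_neutral_left) auto

text \<open>A continuous function that is piecewise affine along the rays at \<open>p\<close>, with slope changes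
  \<open>\<alpha> v a\<close> at distance \<open>a\<close>, closes up to \<open>0\<close> at the rim of the star exactly under the two moment
  conditions below. Pairing its Laplacian with \<open>u\<close> evaluates \<open>u\<close> at the break points.\<close>

lemma radial_tent:
  fixes p :: "'a::metrized_graph"
  assumes R: "good_radius p R" and A: "finite A" "A \<subseteq> {0..<R}"
    and moments: "\<And>v. v \<in> Vec p \<Longrightarrow> (\<Sum>a\<in>A. \<alpha> v a) = 0" "\<And>v. v \<in> Vec p \<Longrightarrow> (\<Sum>a\<in>A. \<alpha> v a * a) = h"
  obtains T where "locally_affine T"
    "\<And>v t. v \<in> Vec p \<Longrightarrow> 0 \<le> t \<Longrightarrow> t < R \<Longrightarrow>
      T (graph_move p t v) = h + (\<Sum>a\<in>A. \<alpha> v a * max 0 (t - a))"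
    "\<And>x. R \<le> dist p x \<Longrightarrow> T x = 0"
    "\<And>u. (\<Sum>q | lapl T q \<noteq> 0. u q * lapl T q) = - (\<Sum>v\<in>Vec p. \<Sum>a\<in>A. \<alpha> v a * u (graph_move p a v))"
proof -
  define dir where "dir x = (SOME v. v \<in> Vec p \<and> x = graph_move p (dist p x) v)" for x
  define T where "T x = (if dist p x < R then h + (\<Sum>a\<in>A. \<alpha> (dir x) a * max 0 (dist p x - a)) else 0)" for x
  have R0: "0 < R" using good_radiusD(1)[OF R] .
  have A': "0 \<le> a" "a < R" if "a \<in> A" for a using A that by auto
  have dir: "dir x \<in> Vec p \<and> x = graph_move p (dist p x) (dir x)" if "dist p x < R" for x
    using someI_ex[OF good_radiusD(5)[OF R that, unfolded Bex_def]] unfolding dir_def .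
  have dir_eq: "dir (graph_move p t v) = v" if v: "v \<in> Vec p" and t: "0 < t" "t < R" for v t
  proof (rule ccontr)
    have d: "dist p (graph_move p t v) = t" using dist_center_move[OF R v] t by simp
    have "dist p (graph_move p t v) < R" using d t by simp
    note e = dir[OF this, unfolded d]
    assume "dir (graph_move p t v) \<noteq> v"
    then have "dist (graph_move p t (dir (graph_move p t v))) (graph_move p t v) = t + t"
      using good_radiusD(4)[OF R conjunct1[OF e] v, of t t] t by auto
    then have "dist (graph_move p t v) (graph_move p t v) = t + t" using e by metis
    then show False using t by simp
  qed
  have on: "T (graph_move p t v) = h + (\<Sum>a\<in>A. \<alpha> v a * max 0 (t - a))"
    if v: "v \<in> Vec p" and t: "0 \<le> t" "t < R" for v t
  proof (cases "t = 0")
    case True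
    have "(\<Sum>a\<in>A. \<alpha> w a * max 0 (0 - a)) = 0" for w
      by (intro sum.neutral) (auto simp: max_absorb1 A')
    then show ?thesis using R0 True by (simp add: T_def)
  next
    case False
    then show ?thesis using dist_center_move[OF R v t] dir_eq[OF v] t by (simp add: T_def)
  qed
  \<comment> \<open>Beyond the last break point the moment conditions make \<open>T\<close> vanish identically.\<close>
  define R' where "R' = Max (insert 0 A)"
  have R': "R' < R" "\<And>a. a \<in> A \<Longrightarrow> a \<le> R'" using A A' R0 unfolding R'_def by auto
  have off: "T x = 0" if "R' < dist p x" for x
  proof (cases "dist p x < R")
    case True
    let ?t = "dist p x"
    have "(\<Sum>a\<in>A. \<alpha> (dir x) a * max 0 (?t - a)) = (\<Sum>a\<in>A. \<alpha> (dir x) a * ?t - \<alpha> (dir x) a * a)"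
      using R'(2) that by (intro sum.cong refl) (force simp: max_def algebra_simps)
    also have "\<dots> = - h" using moments dir[OF True] by (simp add: sum_subtractf flip: sum_distrib_right)
    finally show ?thesis using True by (simp add: T_def)
  qed (simp add: T_def)
  have L: "ray_affine T q" "lapl T q = - (\<Sum>v\<in>Vec p. \<Sum>a\<in>A. \<alpha> v a * of_bool (q = graph_move p a v))" for q
    by (rule radial_function_lapl[OF R A R'(1)]; (rule off on; assumption))+
  have pairing: "(\<Sum>q | lapl T q \<noteq> 0. u q * lapl T q) = - (\<Sum>v\<in>Vec p. \<Sum>a\<in>A. \<alpha> v a * u (graph_move p a v))" for u
  proof -
    let ?S = "(\<lambda>(v, a). graph_move p a v) ` (Vec p \<times> A)"
    have fin: "finite ?S" using A(1) Vec_finite by blast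
    have "{q. lapl T q \<noteq> 0} \<subseteq> ?S"
    proof
      fix q assume q: "q \<in> {q. lapl T q \<noteq> 0}"
      show "q \<in> ?S"
      proof (rule ccontr)
        assume "q \<notin> ?S"
        then have ne: "q \<noteq> graph_move p a v" if "v \<in> Vec p" "a \<in> A" for v a using that by force
        have "lapl T q = 0" unfolding L(2) using ne by (simp cong: sum.cong)
        then show False using q by simp
      qed
    qed
    then have "(\<Sum>q | lapl T q \<noteq> 0. u q * lapl T q) = (\<Sum>q\<in>?S. u q * lapl T q)"
      using sum_over_support[OF fin] by blast
    also have "\<dots> = - (\<Sum>q\<in>?S. \<Sum>(v, a)\<in>Vec p \<times> A. u q * (\<alpha> v a * of_bool (q = graph_move p a v)))"
      unfolding L(2) by (simp add: sum.cartesian_product sum_distrib_left sum_negf case_prod_beta)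
    also have "\<dots> = - (\<Sum>(v, a)\<in>Vec p \<times> A. \<Sum>q\<in>?S. u q * (\<alpha> v a * of_bool (q = graph_move p a v)))"
      by (subst sum.swap) (simp add: case_prod_beta)
    also have "\<dots> = - (\<Sum>(v, a)\<in>Vec p \<times> A. \<alpha> v a * u (graph_move p a v))"
    proof (intro arg_cong[where f = uminus] sum.cong refl, clarify)
      fix v a assume "v \<in> Vec p" "a \<in> A"
      then have m: "graph_move p a v \<in> ?S" by force
      have "(\<Sum>q\<in>?S. u q * (\<alpha> v a * of_bool (q = graph_move p a v)))
          = (\<Sum>q\<in>?S. if q = graph_move p a v then \<alpha> v a * u (graph_move p a v) else 0)"
        by (intro sum.cong refl) auto
      also have "\<dots> = \<alpha> v a * u (graph_move p a v)" using m fin by simp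
      finally show "(\<Sum>q\<in>?S. u q * (\<alpha> v a * of_bool (q = graph_move p a v))) = \<alpha> v a * u (graph_move p a v)" .
    qed
    finally show ?thesis by (simp add: sum.cartesian_product)
  qed
  show ?thesis
    using that[of T] L(1) on pairing unfolding locally_affine_def by (auto simp: T_def)
qed

text \<open>A tent over the segment from \<open>p\<close> to the point at distance \<open>c\<close>, of slopes \<open>1 / t\<close> and \<open>- 1 / (c - t)\<close>. It
  tests whether \<open>u\<close> is affine at the three points \<open>0 < t < c\<close>.\<close>

lemma segment_tent:
  fixes p :: "'a::metrized_graph"
  assumes R: "good_radius p R" and v: "v \<in> Vec p" and t: "0 < t" "t < c" "c < R"
  obtains T where "locally_affine T"
    "\<And>x. T x \<noteq> 0 \<Longrightarrow> \<exists>s. 0 < s \<and> s < c \<and> x = graph_move p s v"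
    "\<And>u. (\<Sum>q | lapl T q \<noteq> 0. u q * lapl T q) =
       (1 / t + 1 / (c - t)) * u (graph_move p t v) - u p / t - u (graph_move p c v) / (c - t)"
proof -
  define \<alpha> where "\<alpha> w a = (if w = v then if a = 0 then 1 / t else if a = t then - (1 / t + 1 / (c - t))
    else 1 / (c - t) else 0)" for w :: complex and a :: real
  have A: "finite {0, t, c}" "{0, t, c} \<subseteq> {0..<R}" using t by auto
  have sumA: "(\<Sum>a\<in>{0, t, c}. g a) = g 0 + g t + g c" for g :: "real \<Rightarrow> real" using t by simp
  have m: "(\<Sum>a\<in>{0, t, c}. \<alpha> w a) = 0" "(\<Sum>a\<in>{0, t, c}. \<alpha> w a * a) = 0" for w
  proof -
    have "c / (c - t) = 1 + t / (c - t)" "(- (1 / t) - 1 / (c - t)) * t = - 1 - t / (c - t)"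
      using t by (simp_all add: field_simps)
    then show "(\<Sum>a\<in>{0, t, c}. \<alpha> w a) = 0" "(\<Sum>a\<in>{0, t, c}. \<alpha> w a * a) = 0"
      unfolding sumA using t by (auto simp: \<alpha>_def distrib_right)
  qed
  obtain T where T: "locally_affine T"
    "\<And>w s. w \<in> Vec p \<Longrightarrow> 0 \<le> s \<Longrightarrow> s < R \<Longrightarrow>
      T (graph_move p s w) = 0 + (\<Sum>a\<in>{0, t, c}. \<alpha> w a * max 0 (s - a))"
    "\<And>x. R \<le> dist p x \<Longrightarrow> T x = 0"
    "\<And>u. (\<Sum>q | lapl T q \<noteq> 0. u q * lapl T q) = - (\<Sum>w\<in>Vec p. \<Sum>a\<in>{0, t, c}. \<alpha> w a * u (graph_move p a w))"
    by (rule radial_tent[where \<alpha> = \<alpha>, OF R A m]) (rule that)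
  show ?thesis
  proof (rule that[OF T(1)])
    fix x assume x: "T x \<noteq> 0"
    then have d: "dist p x < R" using T(3)[of x] by fastforce
    then obtain w where w: "w \<in> Vec p" "x = graph_move p (dist p x) w" using good_radiusD(5)[OF R] by blast
    have Tx: "T x = (\<Sum>a\<in>{0, t, c}. \<alpha> w a * max 0 (dist p x - a))"
      using T(2)[OF w(1) _ d] w by simp
    have "w = v" using x unfolding Tx by (rule contrapos_np) (simp add: \<alpha>_def)
    moreover have "0 < dist p x" using x unfolding Tx sumA by (rule contrapos_np) (use t in simp)
    moreover have "dist p x < c" using x unfolding Tx sumA
    proof (rule contrapos_np)
      assume "\<not> dist p x < c"
      then have mx: "max 0 (dist p x - a) = dist p x - a" if "a \<le> c" for a using that by simp
      have "\<alpha> w 0 * (dist p x - 0) + \<alpha> w t * (dist p x - t) + \<alpha> w c * (dist p x - c)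
        = (\<Sum>a\<in>{0, t, c}. \<alpha> w a) * dist p x - (\<Sum>a\<in>{0, t, c}. \<alpha> w a * a)"
        unfolding sumA by (simp add: algebra_simps)
      then show "\<alpha> w 0 * max 0 (dist p x - 0) + \<alpha> w t * max 0 (dist p x - t) + \<alpha> w c * max 0 (dist p x - c) = 0"
        using mx[of 0] mx[of t] mx[of c] t m[of w] by simp
    qed
    ultimately show "\<exists>s. 0 < s \<and> s < c \<and> x = graph_move p s v" using w by blast
  next
    fix u :: "'a \<Rightarrow> real"
    have "(\<Sum>w\<in>Vec p. \<Sum>a\<in>{0, t, c}. \<alpha> w a * u (graph_move p a w))
      = (\<Sum>w\<in>Vec p. if w = v then \<Sum>a\<in>{0, t, c}. \<alpha> v a * u (graph_move p a v) else 0)"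
      by (intro sum.cong refl) (simp add: \<alpha>_def)
    also have "\<dots> = (\<Sum>a\<in>{0, t, c}. \<alpha> v a * u (graph_move p a v))"
      by (simp only: sum.delta[OF Vec_finite] v if_True)
    finally show "(\<Sum>q | lapl T q \<noteq> 0. u q * lapl T q) =
       (1 / t + 1 / (c - t)) * u (graph_move p t v) - u p / t - u (graph_move p c v) / (c - t)"
      unfolding T(4) sumA using t by (simp add: \<alpha>_def algebra_simps)
  qed
qed

text \<open>The cone over the ball of radius \<open>s\<close>; it tests the sum of the slopes of \<open>u\<close> at \<open>p\<close>.\<close>

lemma star_tent:
  fixes p :: "'a::metrized_graph"
  assumes R: "good_radius p R" and s: "0 < s" "s < R"
  obtains T where "locally_affine T" "\<And>x. T x = max 0 (s - dist p x)"
    "\<And>u. (\<Sum>q | lapl T q \<noteq> 0. u q * lapl T q) = (\<Sum>v\<in>Vec p. u p - u (graph_move p s v))"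
proof -
  define \<alpha> where "\<alpha> a = (if a = 0 then - 1 else 1 :: real)" for a :: real
  have A: "finite {0, s}" "{0, s} \<subseteq> {0..<R}" using s by auto
  have sumA: "(\<Sum>a\<in>{0, s}. g a) = g 0 + g s" for g :: "real \<Rightarrow> real" using s by simp
  have m: "(\<Sum>a\<in>{0, s}. \<alpha> a) = 0" "(\<Sum>a\<in>{0, s}. \<alpha> a * a) = s"
    unfolding sumA using s by (auto simp: \<alpha>_def)
  obtain T where T: "locally_affine T"
    "\<And>w t. w \<in> Vec p \<Longrightarrow> 0 \<le> t \<Longrightarrow> t < R \<Longrightarrow>
      T (graph_move p t w) = s + (\<Sum>a\<in>{0, s}. \<alpha> a * max 0 (t - a))"
    "\<And>x. R \<le> dist p x \<Longrightarrow> T x = 0"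
    "\<And>u. (\<Sum>q | lapl T q \<noteq> 0. u q * lapl T q) = - (\<Sum>w\<in>Vec p. \<Sum>a\<in>{0, s}. \<alpha> a * u (graph_move p a w))"
    by (rule radial_tent[where \<alpha> = "\<lambda>w. \<alpha>", OF R A m]) (rule that)
  show ?thesis
  proof (rule that[OF T(1)])
    fix x
    show "T x = max 0 (s - dist p x)"
    proof (cases "dist p x < R")
      case True
      then obtain w where w: "w \<in> Vec p" "x = graph_move p (dist p x) w" using good_radiusD(5)[OF R] by blast
      have "T x = s + (\<Sum>a\<in>{0, s}. \<alpha> a * max 0 (dist p x - a))"
        using T(2)[OF w(1) _ True] w by simp
      then show ?thesis unfolding sumA using s by (auto simp: \<alpha>_def max_def)
    next
      case False
      then show ?thesis using T(3)[of x] s by simp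
    qed
  next
    fix u :: "'a \<Rightarrow> real"
    show "(\<Sum>q | lapl T q \<noteq> 0. u q * lapl T q) = (\<Sum>v\<in>Vec p. u p - u (graph_move p s v))"
      unfolding T(4) sumA using s by (simp add: \<alpha>_def flip: sum_negf)
  qed
qed

section \<open>Weak solutions and existence\<close>

lemma three_point_affine:
  fixes x y z t c :: real
  assumes t: "0 < t" "t < c" and E: "(1 / t + 1 / (c - t)) * y - x / t - z / (c - t) = 0"
  shows "y = x + t * ((z - x) / c)"
proof -
  define d where "d = c - t"
  have d: "0 < d" "c = t + d" using t by (simp_all add: d_def)
  have "(1 / t + 1 / d) * y - x / t - z / d = ((d + t) * y - d * x - t * z) / (t * d)"
    using t(1) d(1) by (simp add: field_simps)
  then have "(d + t) * y = d * x + t * z" using E[folded d_def] t(1) d(1) by simp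
  then show ?thesis unfolding d(2) using t(1) d(1) by (simp add: field_simps)
qed

text \<open>Near \<open>p\<close> there is no mass of \<open>B\<close> except possibly at \<open>p\<close>. Segment tents, which vanish at \<open>p\<close>, show
  that \<open>u\<close> is affine on each ray; a star tent then gives the Laplacian at \<open>p\<close>. The tests evaluate \<open>u\<close> at
  finitely many points, so \<open>u\<close> may come from an arbitrary linear functional.\<close>

theorem weak_solution:
  fixes u B :: "'a::metrized_graph \<Rightarrow> real"
  assumes B: "finite {q. B q \<noteq> 0}"
    and weak: "\<And>T. locally_affine T \<Longrightarrow>
      (\<Sum>q | lapl T q \<noteq> 0. u q * lapl T q) = (\<Sum>q | B q \<noteq> 0. B q * T q)"
  shows "locally_affine u" "lapl u p = B p"
proof -
  have "ray_affine u p \<and> lapl u p = B p" for p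
  proof -
    obtain R where R: "good_radius p R" using good_radius_exists by blast
    obtain \<delta> where \<delta>: "\<delta> > 0" "\<And>q. B q \<noteq> 0 \<Longrightarrow> q \<noteq> p \<Longrightarrow> \<delta> \<le> dist p q"
      using finite_set_avoid[OF B, of p] by auto
    \<comment> \<open>No charge of \<open>B\<close> lies within distance \<open>c\<close> of \<open>p\<close>, except at \<open>p\<close>.\<close>
    define c where "c = min \<delta> R / 2"
    have c: "0 < c" "c < \<delta>" "c < R" using \<delta> good_radiusD(1)[OF R] unfolding c_def by auto
    define m where "m v = (u (graph_move p c v) - u p) / c" for v
    have affine: "u (graph_move p t v) = u p + t * m v" if v: "v \<in> Vec p" and t: "0 \<le> t" "t < c" for v t
    proof (cases "t = 0")
      case False
      then have t0: "0 < t" using t by simp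
      obtain T where T: "locally_affine T"
        "\<And>x. T x \<noteq> 0 \<Longrightarrow> \<exists>s. 0 < s \<and> s < c \<and> x = graph_move p s v"
        "\<And>u. (\<Sum>q | lapl T q \<noteq> 0. u q * lapl T q) =
           (1 / t + 1 / (c - t)) * u (graph_move p t v) - u p / t - u (graph_move p c v) / (c - t)"
        using segment_tent[OF R v t0 t(2) c(3)] by blast
      have "B q * T q = 0" for q
      proof (rule ccontr)
        assume neq: "B q * T q \<noteq> 0"
        then obtain s where s: "0 < s" "s < c" "q = graph_move p s v" using T(2)[of q] by auto
        then have "dist p q = s" using dist_center_move[OF R v, of s] c by auto
        moreover from this have "q \<noteq> p" using s by auto
        ultimately show False using \<delta>(2)[of q] neq s c by auto
      qed
      then have "(\<Sum>q | B q \<noteq> 0. B q * T q) = 0" by (intro sum.neutral) blast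
      then have "(1 / t + 1 / (c - t)) * u (graph_move p t v) - u p / t - u (graph_move p c v) / (c - t) = 0"
        using weak[OF T(1)] T(3) by simp
      then show ?thesis unfolding m_def by (rule three_point_affine[OF t0 t(2)])
    qed simp
    have L: "ray_affine u p" "lapl u p = - (\<Sum>v\<in>Vec p. m v)"
      by (rule lapl_at_center[OF c(1)]; (rule affine; assumption))+
    define s where "s = c / 2"
    have s: "0 < s" "s < c" "s < R" using c unfolding s_def by auto
    obtain T where T: "locally_affine T" "\<And>x. T x = max 0 (s - dist p x)"
      "\<And>u. (\<Sum>q | lapl T q \<noteq> 0. u q * lapl T q) = (\<Sum>v\<in>Vec p. u p - u (graph_move p s v))"
      using star_tent[OF R s(1) s(3)] by blast
    have "(\<Sum>v\<in>Vec p. u p - u (graph_move p s v)) = (\<Sum>v\<in>Vec p. - (s * m v))"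
      using affine s by (intro sum.cong refl) auto
    also have "\<dots> = s * lapl u p" unfolding L(2) by (simp add: sum_negf sum_distrib_left)
    finally have "s * lapl u p = (\<Sum>q | B q \<noteq> 0. B q * T q)" using weak[OF T(1)] T(3) by simp
    also have "\<dots> = (\<Sum>q | B q \<noteq> 0. if q = p then s * B p else 0)"
    proof (intro sum.cong refl)
      fix q assume "q \<in> {q. B q \<noteq> 0}"
      then show "B q * T q = (if q = p then s * B p else 0)"
        using \<delta>(2)[of q] s c by (auto simp: T(2))
    qed
    also have "\<dots> = s * B p" using B by simp
    finally show ?thesis using s L(1) by simp
  qed
  then show "locally_affine u" "lapl u p = B p" unfolding locally_affine_def by auto
qed

lemma real_functions_vector_space:
  "vector_space (\<lambda>c (f :: 'a \<Rightarrow> real) x. c * f x)"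
  by unfold_locales (auto simp: fun_eq_iff algebra_simps)

text \<open>The class instance of \<open>Function_Algebras\<close> makes functions an additive group, so that the abstract
  theory of vector spaces applies to them; a basis of \<open>W\<close> together with \<open>w\<close> extends to a basis of the
  whole space.\<close>

lemma annihilating_functional:
  fixes W :: "('a \<Rightarrow> real) set" and w :: "'a \<Rightarrow> real"
  assumes zero: "(\<lambda>x. 0) \<in> W" and add: "\<forall>f\<in>W. \<forall>g\<in>W. (\<lambda>x. f x + g x) \<in> W"
    and scale: "\<forall>c. \<forall>f\<in>W. (\<lambda>x. c * f x) \<in> W" and w: "w \<notin> W"
  obtains L :: "('a \<Rightarrow> real) \<Rightarrow> real" where "L w = 1" "\<And>f. f \<in> W \<Longrightarrow> L f = 0"
    "\<And>f g. L (\<lambda>x. f x + g x) = L f + L g" "\<And>c f. L (\<lambda>x. c * f x) = c * L f"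
proof -
  let ?s = "\<lambda>c (f :: 'a \<Rightarrow> real) x. c * f x"
  interpret V: vector_space ?s by (rule real_functions_vector_space)
  interpret R: vector_space "(*) :: real \<Rightarrow> real \<Rightarrow> real" by unfold_locales (auto simp: algebra_simps)
  interpret VR: vector_space_pair ?s "(*) :: real \<Rightarrow> real \<Rightarrow> real" by unfold_locales
  have sub: "V.subspace W"
    unfolding V.subspace_def using assms(1-3) by (auto simp: plus_fun_def zero_fun_def)
  obtain B where B: "B \<subseteq> W" "V.independent B" "W \<subseteq> V.span B"
    using V.maximal_independent_subset[of W] by blast
  have "V.span B \<subseteq> W" using V.span_minimal[OF B(1) sub] .
  then have "w \<notin> V.span B" using w by blast
  then have "V.independent (insert w B)" using B(2) by (metis V.independent_insert)
  then obtain L where L: "Vector_Spaces.linear ?s (*) L" "\<forall>x\<in>insert w B. L x = (if x = w then 1 else 0)"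
    using VR.linear_independent_extend[of "insert w B" "\<lambda>x. if x = w then 1 else 0"] by blast
  have "w \<notin> B" using w B(1) by blast
  then have B0: "L x = 0" if "x \<in> B" for x using L(2) that by auto
  show ?thesis
  proof (rule that[of L])
    show "L w = 1" using L(2) by simp
    show "L f = 0" if "f \<in> W" for f
      using VR.linear_eq_0_on_span[OF L(1) B0] B(3) that by blast
    show "L (\<lambda>x. f x + g x) = L f + L g" for f g
      using VR.linear_add[OF L(1), of f g] by (simp add: plus_fun_def)
    show "L (\<lambda>x. c * f x) = c * L f" for c f
      using VR.linear_scale[OF L(1), of c f] by simp
  qed
qed

text \<open>If the dipole were not a Laplacian, some linear functional \<open>L\<close> would vanish on all Laplacians but
  not on the dipole. The function \<open>x \<mapsto> L(\<delta>\<^bsub>x\<^esub>)\<close> would be weakly harmonic, hence constant, and then \<open>L\<close>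
  would vanish on the dipole as well.\<close>

theorem dipole_exists:
  fixes y z :: "'a::metrized_graph"
  shows "\<exists>f. locally_affine f \<and> (\<forall>q. lapl f q = of_bool (q = y) - of_bool (q = z))"
proof (rule ccontr)
  assume neg: "\<not> ?thesis"
  let ?W = "lapl ` {f :: 'a \<Rightarrow> real. locally_affine f}"
  let ?d = "\<lambda>x q. of_bool (q = x) :: real"
  have w: "(\<lambda>q. ?d y q - ?d z q) \<notin> ?W" using neg by (auto simp: fun_eq_iff)
  have zero: "(\<lambda>x. 0) \<in> ?W"
    by (rule image_eqI[where x = "\<lambda>x. 0"]) (auto simp: locally_affine_intros)
  have add: "(\<lambda>x. f x + g x) \<in> ?W" if fg: "f \<in> ?W" "g \<in> ?W" for f g
  proof -
    obtain F G where "locally_affine F" "locally_affine G" "f = lapl F" "g = lapl G"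
      using fg unfolding image_iff mem_Collect_eq by blast
    then show ?thesis
      by (intro image_eqI[where x = "\<lambda>x. F x + G x"]) (auto simp: locally_affine_intros lapl_add locally_affineD)
  qed
  have scale: "(\<lambda>x. c * f x) \<in> ?W" if fg: "f \<in> ?W" for c f
  proof -
    obtain F where "locally_affine F" "f = lapl F"
      using fg unfolding image_iff mem_Collect_eq by blast
    then show ?thesis
      by (intro image_eqI[where x = "\<lambda>x. c * F x"]) (auto simp: locally_affine_intros lapl_cmult locally_affineD)
  qed
  obtain L :: "('a \<Rightarrow> real) \<Rightarrow> real" where L: "L (\<lambda>q. ?d y q - ?d z q) = 1" "\<And>f. f \<in> ?W \<Longrightarrow> L f = 0"
    and lin: "\<And>f g. L (\<lambda>x. f x + g x) = L f + L g" "\<And>c f. L (\<lambda>x. c * f x) = c * L f"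
  proof (rule annihilating_functional[OF zero _ _ w])
    show "\<forall>f\<in>?W. \<forall>g\<in>?W. (\<lambda>x. f x + g x) \<in> ?W" using add by blast
    show "\<forall>c. \<forall>f\<in>?W. (\<lambda>x. c * f x) \<in> ?W" using scale by blast
  qed (rule that)
  \<comment> \<open>\<open>L\<close> applied to a finitely supported function is a linear combination of values of \<open>u\<close>, so \<open>u\<close> is weakly harmonic.\<close>
  define u where "u x = L (?d x)" for x
  have L0: "L (\<lambda>x. 0) = 0" using lin(2)[of 0 "\<lambda>x. 0"] by simp
  have L_sum: "L (\<lambda>q. \<Sum>x\<in>S. c x * ?d x q) = (\<Sum>x\<in>S. c x * u x)" if "finite S" for S c
    using that
  proof (induction S)
    case (insert x S)
    have "(\<lambda>q. \<Sum>x\<in>insert x S. c x * ?d x q) = (\<lambda>q. c x * ?d x q + (\<Sum>x\<in>S. c x * ?d x q))"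
      by (intro ext sum.insert insert.hyps)
    then have "L (\<lambda>q. \<Sum>x\<in>insert x S. c x * ?d x q) = c x * u x + L (\<lambda>q. \<Sum>x\<in>S. c x * ?d x q)"
      by (simp only: lin u_def)
    then show ?case by (simp only: insert.IH sum.insert[OF insert.hyps])
  qed (simp add: L0)
  have weak: "(\<Sum>q | lapl T q \<noteq> 0. u q * lapl T q) = (\<Sum>q | (0::real) \<noteq> 0. 0 * T q)"
    if T: "locally_affine T" for T
  proof -
    have fin: "finite {q. lapl T q \<noteq> 0}" by (rule finite_lapl_support[OF T])
    have "lapl T q = (\<Sum>x | lapl T x \<noteq> 0. lapl T x * ?d x q)" for q
    proof -
      have "(\<Sum>x | lapl T x \<noteq> 0. lapl T x * ?d x q) = (\<Sum>x | lapl T x \<noteq> 0. if x = q then lapl T q else 0)"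
        by (intro sum.cong refl) auto
      then show ?thesis using fin by (simp add: sum.delta)
    qed
    then have "lapl T = (\<lambda>q. \<Sum>x | lapl T x \<noteq> 0. lapl T x * ?d x q)" by (rule ext)
    moreover have "L (lapl T) = 0" using L(2) T by blast
    ultimately have "L (\<lambda>q. \<Sum>x | lapl T x \<noteq> 0. lapl T x * ?d x q) = 0" by simp
    then show ?thesis using L_sum[OF fin, of "lapl T"] by (simp add: mult.commute)
  qed
  have "locally_affine u" "lapl u p = 0" for p
    using weak_solution[of "\<lambda>q. 0" u] weak by simp_all
  then have "u y = u z" by (intro harmonic_const)
  moreover have "L (\<lambda>q. ?d y q - ?d z q) = u y - u z"
    using lin(1)[of "?d y" "\<lambda>q. (-1) * ?d z q"] lin(2)[of "-1" "?d z"] by (simp add: u_def)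
  ultimately show False using L(1) by simp
qed

section \<open>The Green function\<close>

definition green :: "'a::metrized_graph \<Rightarrow> 'a \<Rightarrow> 'a \<Rightarrow> real" where
  "green z y = (SOME f. locally_affine f \<and> (\<forall>q. lapl f q = of_bool (q = y) - of_bool (q = z)) \<and> f z = 0)"

lemma green:
  shows locally_affine_green: "locally_affine (green z y)"
    and lapl_green: "lapl (green z y) q = of_bool (q = y) - of_bool (q = z)"
    and green_base [simp]: "green z y z = 0"
proof -
  obtain f where f: "locally_affine f" "\<And>q. lapl f q = of_bool (q = y) - of_bool (q = z)"
    using dipole_exists by blast
  have "locally_affine (\<lambda>x. f x - f z)" using f by (intro locally_affine_intros)
  moreover have "lapl (\<lambda>x. f x - f z) q = of_bool (q = y) - of_bool (q = z)" for q
    using lapl_diff(2)[of f q "\<lambda>x. f z"] f by (simp add: locally_affineD)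
  ultimately have "\<exists>f. locally_affine f \<and> (\<forall>q. lapl f q = of_bool (q = y) - of_bool (q = z)) \<and> f z = 0"
    by (intro exI[of _ "\<lambda>x. f x - f z"]) simp
  from someI_ex[OF this] show "locally_affine (green z y)"
    "lapl (green z y) q = of_bool (q = y) - of_bool (q = z)" "green z y z = 0"
    unfolding green_def by blast+
qed

lemma lapl_eq_imp_diff_eq:
  assumes "locally_affine f" "locally_affine g" "\<And>q. lapl f q = lapl g q"
  shows "f x - g x = f y - g y"
  by (rule harmonic_const[of "\<lambda>x. f x - g x"])
    (use assms in \<open>auto intro: locally_affine_intros simp: lapl_diff locally_affineD\<close>)

lemma green_unique:
  assumes "locally_affine f" "\<And>q. lapl f q = of_bool (q = y) - of_bool (q = z)" "f z = 0"
  shows "f = green z y"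
  using lapl_eq_imp_diff_eq[OF assms(1) locally_affine_green[of z y]] assms(2,3) lapl_green[of z y] green_base
  by (metis diff_eq_diff_eq diff_self ext)

lemma lapl_sum_green:
  assumes "finite S"
  shows "locally_affine (\<lambda>x. \<Sum>q\<in>S. c q * green z q x)"
    "lapl (\<lambda>x. \<Sum>q\<in>S. c q * green z q x) p = (if p \<in> S then c p else 0) - sum c S * of_bool (p = z)"
proof -
  show "locally_affine (\<lambda>x. \<Sum>q\<in>S. c q * green z q x)"
    by (intro locally_affine_intros assms locally_affine_green)
  have "lapl (\<lambda>x. \<Sum>q\<in>S. c q * green z q x) p = (\<Sum>q\<in>S. c q * (of_bool (p = q) - of_bool (p = z)))"
    by (simp add: lapl_sum(2)[OF assms] lapl_cmult locally_affineD locally_affine_green lapl_green)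
  also have "\<dots> = (\<Sum>q\<in>S. (if q = p then c p else 0) - c q * of_bool (p = z))"
    by (intro sum.cong refl) (auto simp: algebra_simps)
  also have "\<dots> = (if p \<in> S then c p else 0) - sum c S * of_bool (p = z)"
    using assms by (simp add: sum_subtractf sum_distrib_right)
  finally show "lapl (\<lambda>x. \<Sum>q\<in>S. c q * green z q x) p = (if p \<in> S then c p else 0) - sum c S * of_bool (p = z)" .
qed

text \<open>Subtracting the potential of its own Laplacian from \<open>f\<close> leaves a function whose Laplacian is a
  single point mass. By the maximum principle a single point mass is not a Laplacian unless it
  vanishes.\<close>

lemma lapl_total_mass:
  assumes f: "locally_affine f"
  shows "(\<Sum>q | lapl f q \<noteq> 0. lapl f q) = 0"
    and "f x = f z + (\<Sum>q | lapl f q \<noteq> 0. lapl f q * green z q x)"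
proof -
  let ?S = "{q. lapl f q \<noteq> 0}"
  define m where "m = (\<Sum>q | lapl f q \<noteq> 0. lapl f q)"
  have fin: "finite ?S" by (rule finite_lapl_support[OF f])
  define h where "h x = f x - (\<Sum>q\<in>?S. lapl f q * green z q x)" for x
  have h: "locally_affine h" unfolding h_def by (intro locally_affine_intros f lapl_sum_green fin)
  have lh: "lapl h p = m * of_bool (p = z)" for p
    unfolding h_def using lapl_sum_green[OF fin, of "lapl f" z]
    by (simp add: lapl_diff locally_affineD f m_def)
  have m0: "m = 0"
  proof (cases "m \<le> 0")
    case True
    have const: "h x = h z" for x
      by (rule maximum_principle[OF h]) (use True in \<open>simp add: lh\<close>)
    have "lapl h z = 0" by (rule lapl_locally_const(2)[of 1 z h "h z"]) (use const in auto)
    then show ?thesis by (simp add: lh)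
  next
    case False
    have h': "locally_affine (\<lambda>x. (-1) * h x)" by (intro locally_affine_intros h)
    have "(-1) * h x = (-1) * h z" for x
      by (rule maximum_principle[OF h']) (use False in \<open>simp add: lapl_cmult(2)[OF locally_affineD[OF h], of "-1", simplified] lh\<close>)
    then have const: "h x = h z" for x by simp
    have "lapl h z = 0" by (rule lapl_locally_const(2)[of 1 z h "h z"]) (use const in auto)
    then show ?thesis by (simp add: lh)
  qed
  then show "(\<Sum>q\<in>?S. lapl f q) = 0" by (simp add: m_def)
  have "h x = h z" by (rule harmonic_const[OF h]) (simp add: lh m0)
  then show "f x = f z + (\<Sum>q\<in>?S. lapl f q * green z q x)" by (simp add: h_def)
qed

lemma green_diag_base [simp]: "green z z x = 0"
  using harmonic_const[OF locally_affine_green, of z z x z] by (simp add: lapl_green)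

text \<open>By the representation of a locally affine \<open>T\<close> through its Laplacian, \<open>y \<mapsto> green z y x\<close> pairs with the
  Laplacian of \<open>T\<close> to \<open>T x - T z\<close>. So it is a weak solution of the problem that defines \<open>green z x\<close>.\<close>

theorem green_symmetric: "green z y x = green z x y"
proof -
  define B where "B q = (of_bool (q = x) - of_bool (q = z) :: real)" for q
  have sB: "{q. B q \<noteq> 0} \<subseteq> {x, z}" by (auto simp: B_def)
  then have fB: "finite {q. B q \<noteq> 0}" by (rule finite_subset) simp
  have weak: "(\<Sum>q | lapl T q \<noteq> 0. green z q x * lapl T q) = (\<Sum>q | B q \<noteq> 0. B q * T q)"
    if T: "locally_affine T" for T
  proof -
    have "(\<Sum>q | lapl T q \<noteq> 0. green z q x * lapl T q) = T x - T z"
      using lapl_total_mass(2)[OF T, of x z] by (simp add: mult.commute)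
    also have "\<dots> = (\<Sum>q\<in>{x, z}. B q * T q)" by (cases "x = z") (auto simp: B_def)
    also have "\<dots> = (\<Sum>q | B q \<noteq> 0. B q * T q)" using sB by (intro sum.mono_neutral_right) auto
    finally show ?thesis .
  qed
  have "(\<lambda>y. green z y x) = green z x"
  proof (rule green_unique)
    show "locally_affine (\<lambda>y. green z y x)" by (rule weak_solution(1)[OF fB]) (rule weak)
    have "lapl (\<lambda>y. green z y x) q = B q" for q by (rule weak_solution(2)[OF fB]) (rule weak)
    then show "lapl (\<lambda>y. green z y x) q = of_bool (q = x) - of_bool (q = z)" for q by (simp add: B_def)
  qed simp
  then show ?thesis by (rule fun_cong)
qed

section \<open>Positivity\<close>

text \<open>Truncating \<open>f\<close> from below at \<open>c\<close> moves the mass of the Laplacian from \<open>{f < c}\<close> to \<open>{f = c}\<close>, where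
  the truncated function has a minimum; as the total mass is \<open>0\<close>, the mass on \<open>{f > c}\<close> is nonnegative.\<close>

lemma lapl_superlevel_mass:
  assumes f: "locally_affine f"
  shows "0 \<le> (\<Sum>q\<in>{q\<in>{q. lapl f q \<noteq> 0}. c < f q}. lapl f q)"
proof -
  define h where "h x = max (f x) c" for x
  have h: "locally_affine h" unfolding h_def by (intro locally_affine_intros f)
  define S where "S = {q. lapl f q \<noteq> 0} \<union> {q. lapl h q \<noteq> 0}"
  have fin: "finite S" unfolding S_def using finite_lapl_support f h by blast
  have "0 = (\<Sum>q\<in>S. lapl h q)"
  proof -
    have "(\<Sum>q | lapl h q \<noteq> 0. lapl h q) = (\<Sum>q\<in>S. lapl h q)"
      by (intro sum.mono_neutral_left fin) (auto simp: S_def)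
    then show ?thesis using lapl_total_mass(1)[OF h] by metis
  qed
  also have "\<dots> = (\<Sum>q\<in>{q\<in>S. c < f q}. lapl h q) + (\<Sum>q\<in>{q\<in>S. \<not> c < f q}. lapl h q)"
  proof -
    have "S = {q\<in>S. c < f q} \<union> {q\<in>S. \<not> c < f q}" by blast
    moreover have "sum (lapl h) ({q\<in>S. c < f q} \<union> {q\<in>S. \<not> c < f q})
        = sum (lapl h) {q\<in>S. c < f q} + sum (lapl h) {q\<in>S. \<not> c < f q}"
      using fin by (intro sum.union_disjoint) auto
    ultimately show ?thesis by metis
  qed
  also have "(\<Sum>q\<in>{q\<in>S. c < f q}. lapl h q) = (\<Sum>q\<in>{q\<in>S. c < f q}. lapl f q)"
    unfolding h_def using lapl_max_const(2)[OF locally_affineD[OF f]] by (intro sum.cong) auto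
  also have "\<dots> = (\<Sum>q\<in>{q\<in>{q. lapl f q \<noteq> 0}. c < f q}. lapl f q)"
  proof (rule sum.mono_neutral_right)
    show "finite {q\<in>S. c < f q}" using fin by simp
  qed (auto simp: S_def)
  also have "(\<Sum>q\<in>{q\<in>S. \<not> c < f q}. lapl h q) \<le> 0"
  proof (rule sum_nonpos)
    fix q assume q: "q \<in> {q\<in>S. \<not> c < f q}"
    show "lapl h q \<le> 0"
    proof (cases "f q < c")
      case True
      then show ?thesis unfolding h_def by (simp only: lapl_max_const(3)[OF locally_affineD[OF f]] order.refl)
    next
      case False
      then have "h q \<le> h x" for x using q by (simp add: h_def)
      then show ?thesis by (rule lapl_at_min[OF locally_affineD[OF h] zero_less_one])
    qed
  qed
  finally show ?thesis by simp
qed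

lemma step_function_has_integral:
  fixes m a M :: real
  assumes "m \<le> a" "a \<le> M"
  shows "((\<lambda>c. if c < a then 1 else 0) has_integral (a - m)) {m..M}"
proof -
  have "((\<lambda>c. 1::real) has_integral (a - m)) {m..a}" using has_integral_const_real[of "1::real" m a] assms by simp
  then have 1: "((\<lambda>c. if c < a then 1 else 0::real) has_integral (a - m)) {m..a}"
    by (rule has_integral_spike_finite[of "{a}", rotated 2]) auto
  have 2: "((\<lambda>c. if c < a then 1 else 0::real) has_integral 0) {a..M}"
    by (rule has_integral_is_0) auto
  show ?thesis using has_integral_combine[OF assms 1 2] by simp
qed

text \<open>The layer-cake formula: \<open>f p - m\<close> is the integral over \<open>c \<ge> m\<close> of the indicator of \<open>c < f p\<close>.\<close>

lemma sum_nonneg_if_superlevel_sums_nonneg: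
  fixes f w :: "'a \<Rightarrow> real"
  assumes S: "finite S" and level: "\<And>c. 0 \<le> (\<Sum>p\<in>{p\<in>S. c < f p}. w p)" and total: "sum w S = 0"
  shows "0 \<le> (\<Sum>p\<in>S. f p * w p)"
proof (cases "S = {}")
  case False
  define m M where "m = Min (f ` S)" and "M = Max (f ` S)"
  have mM: "m \<le> f p" "f p \<le> M" if "p \<in> S" for p using S that by (auto simp: m_def M_def)
  have "((\<lambda>c. \<Sum>p\<in>S. w p * (if c < f p then 1 else 0)) has_integral (\<Sum>p\<in>S. w p * (f p - m))) {m..M}"
    by (intro has_integral_sum S has_integral_mult_right step_function_has_integral mM)
  moreover have "0 \<le> (\<Sum>p\<in>S. w p * (if c < f p then 1 else 0))" for c
  proof -
    have "(\<Sum>p\<in>S. w p * (if c < f p then 1 else 0)) = (\<Sum>p\<in>{p\<in>S. c < f p}. w p)"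
      using S by (subst sum.inter_filter) (auto intro!: sum.cong)
    then show ?thesis using level by simp
  qed
  ultimately have "0 \<le> (\<Sum>p\<in>S. w p * (f p - m))" by (rule has_integral_nonneg)
  also have "\<dots> = (\<Sum>p\<in>S. f p * w p) - m * sum w S"
    by (simp add: algebra_simps sum_subtractf sum_distrib_left)
  finally show ?thesis using total by simp
qed simp

text \<open>The quadratic form is the sum of \<open>f \<Delta>f\<close> for the potential \<open>f\<close> of the charges \<open>c\<close>; the
  compensating charge at \<open>z\<close> drops out because \<open>f z = 0\<close>.\<close>

theorem green_positive_semidefinite:
  assumes X: "finite X"
  shows "0 \<le> (\<Sum>x\<in>X. \<Sum>y\<in>X. c x * c y * green z x y)"
proof -
  define f where "f x = (\<Sum>q\<in>X. c q * green z q x)" for x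
  have f: "locally_affine f" unfolding f_def by (rule lapl_sum_green(1)[OF X])
  have lf: "lapl f p = (if p \<in> X then c p else 0) - sum c X * of_bool (p = z)" for p
    unfolding f_def by (rule lapl_sum_green(2)[OF X])
  have fz: "f z = 0" by (simp add: f_def)
  let ?S = "{q. lapl f q \<noteq> 0}"
  have "0 \<le> (\<Sum>p\<in>?S. f p * lapl f p)"
    by (intro sum_nonneg_if_superlevel_sums_nonneg finite_lapl_support f lapl_superlevel_mass lapl_total_mass)
  also have "\<dots> = (\<Sum>p\<in>insert z X. f p * lapl f p)"
    using X lf by (intro sum.mono_neutral_left) auto
  also have "\<dots> = (\<Sum>p\<in>insert z X. f p * (if p \<in> X then c p else 0))"
    using fz by (intro sum.cong refl) (auto simp: lf)
  also have "\<dots> = (\<Sum>p\<in>X. f p * (if p \<in> X then c p else 0))"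
    using X by (intro sum.mono_neutral_right) (auto simp: fz)
  also have "\<dots> = (\<Sum>x\<in>X. \<Sum>y\<in>X. c x * c y * green z x y)"
    unfolding f_def by (simp add: sum_distrib_left sum_distrib_right green_symmetric mult_ac cong: sum.cong)
  finally show ?thesis .
qed

section \<open>Continuity\<close>

lemma dipole_max:
  assumes g: "locally_affine g" and lg: "\<And>q. lapl g q = of_bool (q = x) - of_bool (q = x0)"
  shows "g y \<le> g x"
proof (rule ccontr)
  assume neg: "\<not> g y \<le> g x"
  have "g x = g y"
  proof (rule maximum_principle[OF g])
    fix p assume "\<And>x. g x \<le> g p"
    then have "p \<noteq> x" using neg by metis
    then show "lapl g p \<le> 0" by (simp add: lg)
  qed
  then show False using neg by simp
qed

text \<open>The difference \<open>g\<close> is the potential of a unit current from \<open>x\<close> to \<open>x0\<close>, so it lies between its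
  values there. It is affine on the segment between them, and no more than the unit current
  that arrives at \<open>x0\<close> flows through this segment.\<close>

lemma green_lipschitz:
  assumes R: "good_radius x0 R" and x: "dist x0 x < R"
  shows "\<bar>green z x y - green z x0 y\<bar> \<le> dist x0 x"
proof (cases "x = x0")
  case False
  define s where "s = dist x0 x"
  have s: "0 < s" "s < R" using False x by (auto simp: s_def)
  obtain v where v: "v \<in> Vec x0" "x = graph_move x0 s v"
    using good_radiusD(5)[OF R x] unfolding s_def by blast
  define g where "g y = green z x y - green z x0 y" for y
  have g: "locally_affine g" unfolding g_def by (intro locally_affine_intros locally_affine_green)
  have lg: "lapl g q = of_bool (q = x) - of_bool (q = x0)" for q
    unfolding g_def by (simp add: lapl_diff locally_affineD locally_affine_green lapl_green)
  have pair: "(\<Sum>q | lapl T q \<noteq> 0. g q * lapl T q) = T x - T x0" if T: "locally_affine T" for T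
  proof -
    have "(\<Sum>q | lapl T q \<noteq> 0. g q * lapl T q) =
        (\<Sum>q | lapl T q \<noteq> 0. lapl T q * green z q x) - (\<Sum>q | lapl T q \<noteq> 0. lapl T q * green z q x0)"
      unfolding sum_subtractf[symmetric] g_def
      by (intro sum.cong refl) (simp add: green_symmetric[of z x] green_symmetric[of z x0] algebra_simps)
    then show ?thesis using lapl_total_mass(2)[OF T, of x z] lapl_total_mass(2)[OF T, of x0 z] by simp
  qed
  have upper: "g y \<le> g x" for y by (rule dipole_max[OF g lg])
  have "- g y \<le> - g x0" for y
  proof (rule dipole_max)
    show "locally_affine (\<lambda>y. - g y)" using locally_affine_intros(4)[OF g, of "-1"] by simp
    show "lapl (\<lambda>y. - g y) q = of_bool (q = x0) - of_bool (q = x)" for q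
      using lapl_cmult(2)[OF locally_affineD[OF g], of "-1"] by (simp add: lg)
  qed
  then have lower: "g x0 \<le> g y" for y by simp
  define D where "D = g x - g x0"
  obtain \<sigma> where \<sigma>: "\<sigma> > 0"
    "\<And>t. 0 < t \<Longrightarrow> t < \<sigma> \<Longrightarrow> (\<Sum>y | dist x0 y = t. g x0 - g y) = t * lapl g x0"
    "\<And>t. 0 < t \<Longrightarrow> t < \<sigma> \<Longrightarrow> finite {y. dist x0 y = t}"
    using lapl_sphere[OF locally_affineD[OF g]] by metis
  define t where "t = min \<sigma> s / 2"
  have t: "0 < t" "t < s" "t < \<sigma>" "t < R" using \<sigma>(1) s by (auto simp: t_def)
  obtain T where T: "locally_affine T"
    "\<And>x. T x \<noteq> 0 \<Longrightarrow> \<exists>r. 0 < r \<and> r < s \<and> x = graph_move x0 r v"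
    "\<And>u. (\<Sum>q | lapl T q \<noteq> 0. u q * lapl T q) =
       (1 / t + 1 / (s - t)) * u (graph_move x0 t v) - u x0 / t - u (graph_move x0 s v) / (s - t)"
    using segment_tent[OF R v(1) t(1,2) s(2)] by blast
  have T0: "T y = 0" if "dist x0 y = 0 \<or> dist x0 y = s" for y
  proof (rule ccontr)
    assume "T y \<noteq> 0"
    then obtain r where r: "0 < r" "r < s" "y = graph_move x0 r v" using T(2) by blast
    then have "dist x0 y = r" using dist_center_move[OF R v(1), of r] s by simp
    then show False using that r by auto
  qed
  have "(1 / t + 1 / (s - t)) * g (graph_move x0 t v) - g x0 / t - g x / (s - t) = T x - T x0"
    using pair[OF T(1)] T(3)[of g] v(2) by simp
  also have "T x = 0" by (rule T0) (simp add: s_def)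
  also have "T x0 = 0" by (rule T0) simp
  finally have seg: "g (graph_move x0 t v) = g x0 + t * (D / s)"
    unfolding D_def by (intro three_point_affine[OF t(1,2)]) simp
  have dm: "dist x0 (graph_move x0 t v) = t" using dist_center_move[OF R v(1)] t by simp
  \<comment> \<open>The slopes of \<open>g\<close> at \<open>x0\<close> are nonnegative and add up to the unit current, so each is at most \<open>1\<close>.\<close>
  have "- t = (\<Sum>y | dist x0 y = t. g x0 - g y)" using \<sigma>(2)[OF t(1,3)] lg[of x0] False by auto
  then have "t = (\<Sum>y | dist x0 y = t. g y - g x0)" by (simp add: sum_subtractf)
  also have "\<dots> \<ge> g (graph_move x0 t v) - g x0"
    by (rule member_le_sum[where f = "\<lambda>y. g y - g x0"]) (use dm lower \<sigma>(3)[OF t(1,3)] in auto)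
  finally have "t * (D / s) \<le> t" unfolding seg by simp
  then have "D \<le> s" using t s by (simp add: field_simps)
  moreover have "g z = 0" by (simp add: g_def)
  then have "\<bar>g y\<bar> \<le> D" using upper[of y] lower[of y] upper[of z] lower[of z] unfolding D_def by linarith
  ultimately show ?thesis unfolding g_def s_def by linarith
qed simp

theorem continuous_green: "continuous_on UNIV (\<lambda>(x, y). green z x y)"
  unfolding continuous_on_eq_continuous_within
proof
  fix xy0 :: "'a \<times> 'a"
  obtain x0 y0 where xy0: "xy0 = (x0, y0)" by fastforce
  obtain R where R: "good_radius x0 R" using good_radius_exists by blast
  obtain Q where Q: "good_radius y0 Q" using good_radius_exists by blast
  define r where "r = min R Q"
  have r: "0 < r" using good_radiusD(1)[OF R] good_radiusD(1)[OF Q] by (simp add: r_def)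
  have near: "\<bar>green z x y - green z x0 y0\<bar> \<le> dist x0 x + dist y0 y" if "dist x0 x < r" "dist y0 y < r" for x y
    using green_lipschitz[OF R, of x z y] green_lipschitz[OF Q, of y z x0] that
    by (simp add: r_def green_symmetric[of z x0])
  show "continuous (at xy0 within UNIV) (\<lambda>(x, y). green z x y)"
    unfolding continuous_within_eps_delta
  proof (intro allI impI)
    fix e :: real assume e: "0 < e"
    show "\<exists>d>0. \<forall>xy\<in>UNIV. dist xy xy0 < d \<longrightarrow> dist (case xy of (x, y) \<Rightarrow> green z x y) (case xy0 of (x, y) \<Rightarrow> green z x y) < e"
    proof (intro exI[of _ "min r (e / 2)"] conjI ballI impI)
      show "0 < min r (e / 2)" using r e by simp
      fix xy assume d: "dist xy xy0 < min r (e / 2)"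
      obtain x y where xy: "xy = (x, y)" by fastforce
      have "dist x0 x \<le> dist xy xy0" "dist y0 y \<le> dist xy xy0"
        unfolding xy xy0 using dist_fst_le[of "(x, y)" "(x0, y0)"] dist_snd_le[of "(x, y)" "(x0, y0)"]
        by (simp_all add: dist_commute)
      then have "dist x0 x < r" "dist y0 y < r" "dist x0 x < e / 2" "dist y0 y < e / 2" using d by auto
      then show "dist (case xy of (x, y) \<Rightarrow> green z x y) (case xy0 of (x, y) \<Rightarrow> green z x y) < e"
        using near[of x y] by (simp add: xy xy0 dist_real_def)
    qed
  qed
qed

lemma green_equicontinuous:
  assumes "\<epsilon> > 0"
  shows "\<exists>d>0. \<forall>x x' y. dist x x' < d \<longrightarrow> \<bar>green z x y - green z x' y\<bar> < \<epsilon>"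
proof -
  have "compact (UNIV :: ('a \<times> 'a) set)" using compact_Times[OF compact_graph compact_graph] by simp
  then have "uniformly_continuous_on UNIV (\<lambda>(x, y). green z x y)"
    using compact_uniformly_continuous continuous_green by blast
  then obtain d where d: "d > 0" "\<And>a b :: 'a \<times> 'a. dist b a < d \<Longrightarrow>
      dist (case b of (x, y) \<Rightarrow> green z x y) (case a of (x, y) \<Rightarrow> green z x y) < \<epsilon>"
    unfolding uniformly_continuous_on_def using assms by (metis UNIV_I)
  have "\<bar>green z x y - green z x' y\<bar> < \<epsilon>" if "dist x x' < d" for x x' y
    using d(2)[of "(x, y)" "(x', y)"] that by (simp add: dist_Pair_Pair dist_real_def)
  then show ?thesis using d(1) by blast
qed

section \<open>Piecewise affine functions\<close>

lemma affine_on_interval_if_locally: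
  fixes h :: "real \<Rightarrow> real"
  assumes loc: "\<And>t. a < t \<Longrightarrow> t < b \<Longrightarrow> \<exists>\<delta>>0. \<exists>c d. \<forall>s. \<bar>s - t\<bar> < \<delta> \<longrightarrow> h s = c + s * d"
  shows "\<exists>c d. \<forall>t\<in>{a<..<b}. h t = c + t * d"
proof -
  have "\<exists>\<delta> c d. a < t \<longrightarrow> t < b \<longrightarrow> 0 < \<delta> \<and> (\<forall>s. \<bar>s - t\<bar> < \<delta> \<longrightarrow> h s = c + s * d)" for t
    using loc[of t] by metis
  then obtain \<delta> c d where \<delta>: "\<And>t. a < t \<Longrightarrow> t < b \<Longrightarrow> 0 < \<delta> t"
    and h: "\<And>t s. a < t \<Longrightarrow> t < b \<Longrightarrow> \<bar>s - t\<bar> < \<delta> t \<Longrightarrow> h s = c t + s * d t" by metis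
  have ev: "eventually (\<lambda>s. \<bar>s - t\<bar> < \<delta> t) (nhds t)" if "a < t" "t < b" for t
    using \<delta>[OF that] by (auto simp: eventually_nhds_metric dist_real_def)
  have der: "(h has_field_derivative d t) (at s)" if t: "a < t" "t < b" and s: "\<bar>s - t\<bar> < \<delta> t" for s t
  proof -
    have "((\<lambda>s. c t + s * d t) has_field_derivative d t) (at s)" by (auto intro!: derivative_eq_intros)
    moreover have "eventually (\<lambda>r. h r = c t + r * d t) (nhds s)"
    proof -
      have "eventually (\<lambda>r. r \<in> {t - \<delta> t<..<t + \<delta> t}) (nhds s)"
        using s by (intro eventually_nhds_in_open) auto
      then show ?thesis by eventually_elim (use h t in \<open>simp add: abs_less_iff\<close>)
    qed
    ultimately show ?thesis using DERIV_cong_ev[OF refl _ refl] by fast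
  qed
  have "(d has_field_derivative 0) (at t within {a<..<b})" if t: "a < t" "t < b" for t
  proof -
    have "eventually (\<lambda>s. s \<in> {a<..<b}) (nhds t)" using t by (intro eventually_nhds_in_open) auto
    with ev[OF t] have e: "eventually (\<lambda>s. d s = d t) (nhds t)"
    proof eventually_elim
      case (elim s)
      have "(h has_field_derivative d t) (at s)" using der[OF t] elim by blast
      moreover have "(h has_field_derivative d s) (at s)" using der[of s s] elim \<delta>[of s] by auto
      ultimately show "d s = d t" using DERIV_unique by blast
    qed
    have "((\<lambda>s. d t) has_field_derivative 0) (at t)" by (rule DERIV_const)
    then have "(d has_field_derivative 0) (at t)" using DERIV_cong_ev[OF refl e refl] by fast
    then show ?thesis by (rule has_field_derivative_at_within)
  qed
  then obtain m where m: "\<And>t. a < t \<Longrightarrow> t < b \<Longrightarrow> d t = m"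
    using has_field_derivative_zero_constant[of "{a<..<b}" d] by fastforce
  have "((\<lambda>t. h t - t * m) has_field_derivative 0) (at t within {a<..<b})" if t: "a < t" "t < b" for t
  proof -
    have "(h has_field_derivative m) (at t)" using der[OF t, of t] \<delta>[OF t] m[OF t] by simp
    then have "((\<lambda>t. h t - t * m) has_field_derivative 0) (at t)" by (auto intro!: derivative_eq_intros)
    then show ?thesis by (rule has_field_derivative_at_within)
  qed
  then obtain k where "\<And>t. a < t \<Longrightarrow> t < b \<Longrightarrow> h t - t * m = k"
    using has_field_derivative_zero_constant[of "{a<..<b}" "\<lambda>t. h t - t * m"] by fastforce
  then have "\<forall>t\<in>{a<..<b}. h t = k + t * m" by (fastforce simp: algebra_simps)
  then show ?thesis by blast
qed

text \<open>The reference point \<open>r\<close> decides the sign: a point on the wrong side of \<open>\<rho> t\<close> would have the wrong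
  distance to \<open>\<rho> r\<close>.\<close>

lemma isometry_into_reals_near_point:
  fixes \<rho> :: "real \<Rightarrow> real"
  assumes iso: "\<And>s s'. \<bar>s - t\<bar> < \<delta> \<Longrightarrow> \<bar>s' - t\<bar> < \<delta> \<Longrightarrow> \<bar>\<rho> s - \<rho> s'\<bar> = \<bar>s - s'\<bar>" and \<delta>: "\<delta> > 0"
  shows "\<exists>e. \<forall>s. \<bar>s - t\<bar> < \<delta> \<longrightarrow> \<rho> s = \<rho> t + e * (s - t)"
proof -
  define r where "r = t + \<delta> / 2"
  define e where "e = (if \<rho> r - \<rho> t = \<delta> / 2 then 1 else - 1 :: real)"
  have r: "\<bar>\<rho> r - \<rho> t\<bar> = \<delta> / 2" using iso[of r t] \<delta> by (simp add: r_def)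
  have "\<rho> s = \<rho> t + e * (s - t)" if s: "\<bar>s - t\<bar> < \<delta>" for s
  proof -
    have "\<bar>\<rho> s - \<rho> t\<bar> = \<bar>s - t\<bar>" using iso[OF s, of t] \<delta> by simp
    moreover have "\<bar>\<rho> s - \<rho> r\<bar> = \<bar>s - r\<bar>" using iso[OF s, of r] \<delta> by (simp add: r_def)
    ultimately show ?thesis using r \<delta> unfolding e_def r_def by (auto simp: abs_if split: if_splits)
  qed
  then show ?thesis by blast
qed

text \<open>The centres of a finite cover by stars on which \<open>f\<close> is affine along the rays serve as break
  points: an isometric segment that avoids them runs locally inside a single ray.\<close>

lemma locally_affine_piecewise_affine:
  assumes f: "locally_affine f"
  shows "piecewise_affine (\<lambda>x. complex_of_real (f x))"
proof -
  have "\<exists>\<sigma>. good_radius p \<sigma> \<and> (\<forall>v\<in>Vec p. \<forall>t. 0 \<le> t \<longrightarrow> t < \<sigma> \<longrightarrow> f (graph_move p t v) = f p + t * ray_slope f p v)" for p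
  proof -
    obtain \<sigma> where \<sigma>: "\<sigma> > 0"
      "\<And>v t. v \<in> Vec p \<Longrightarrow> 0 \<le> t \<Longrightarrow> t < \<sigma> \<Longrightarrow> f (graph_move p t v) = f p + t * ray_slope f p v"
      using ray_affineE[OF locally_affineD[OF f]] by blast
    obtain R where R: "good_radius p R" using good_radius_exists by blast
    have "good_radius p (min \<sigma> R)" using R \<sigma>(1) unfolding good_radius_def by simp
    then show ?thesis using \<sigma>(2) by (intro exI[of _ "min \<sigma> R"]) auto
  qed
  then obtain \<sigma> where \<sigma>: "\<And>p. good_radius p (\<sigma> p)"
    "\<And>p v t. v \<in> Vec p \<Longrightarrow> 0 \<le> t \<Longrightarrow> t < \<sigma> p \<Longrightarrow> f (graph_move p t v) = f p + t * ray_slope f p v" by metis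
  have pos: "\<sigma> p > 0" for p using good_radiusD(1)[OF \<sigma>(1)] .
  obtain S where S: "finite S" "\<And>x. \<exists>p\<in>S. dist p x < \<sigma> p" using finite_ball_cover[of \<sigma>] pos by blast
  show ?thesis
    unfolding piecewise_affine_def
  proof (intro exI[of _ S] conjI S(1) allI impI)
    fix a b :: real and \<gamma> :: "real \<Rightarrow> 'a"
    assume "(\<forall>s\<in>{a<..<b}. \<forall>t\<in>{a<..<b}. dist (\<gamma> s) (\<gamma> t) = \<bar>s - t\<bar>) \<and> \<gamma> ` {a<..<b} \<inter> S = {}"
    then have iso: "\<And>s t. a < s \<Longrightarrow> s < b \<Longrightarrow> a < t \<Longrightarrow> t < b \<Longrightarrow> dist (\<gamma> s) (\<gamma> t) = \<bar>s - t\<bar>"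
      and im: "\<gamma> ` {a<..<b} \<inter> S = {}" by auto
    have avoid: "\<gamma> t \<notin> S" if "a < t" "t < b" for t
    proof -
      have "\<gamma> t \<in> \<gamma> ` {a<..<b}" using that by simp
      then show ?thesis using im by blast
    qed
    have "\<exists>c d. \<forall>t\<in>{a<..<b}. f (\<gamma> t) = c + t * d"
    proof (rule affine_on_interval_if_locally)
      fix t assume t: "a < t" "t < b"
      obtain p where p: "p \<in> S" "dist p (\<gamma> t) < \<sigma> p" using S(2) by blast
      define \<rho> where "\<rho> s = dist p (\<gamma> s)" for s
      have "\<gamma> t \<noteq> p" using avoid[OF t] p(1) by auto
      then have \<rho>t: "0 < \<rho> t" "\<rho> t < \<sigma> p" using p(2) by (auto simp: \<rho>_def)
      obtain v where v: "v \<in> Vec p" "\<gamma> t = graph_move p (\<rho> t) v"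
        using good_radiusD(5)[OF \<sigma>(1) p(2)] unfolding \<rho>_def by blast
      define \<delta> where "\<delta> = min (min (\<rho> t) (\<sigma> p - \<rho> t)) (min (t - a) (b - t))"
      have \<delta>: "0 < \<delta>" "\<delta> \<le> \<rho> t" "\<rho> t + \<delta> \<le> \<sigma> p" "a \<le> t - \<delta>" "t + \<delta> \<le> b"
        using \<rho>t t unfolding \<delta>_def by auto
      have ray: "\<gamma> s = graph_move p (\<rho> s) v \<and> 0 \<le> \<rho> s \<and> \<rho> s < \<sigma> p" if s: "\<bar>s - t\<bar> < \<delta>" for s
      proof -
        have ds: "dist (\<gamma> t) (\<gamma> s) = \<bar>s - t\<bar>" using iso[of t s] s \<delta> t by (auto simp: abs_less_iff abs_minus_commute)
        then have lt: "\<rho> s < \<sigma> p" using dist_triangle[of p "\<gamma> s" "\<gamma> t"] s \<delta> unfolding \<rho>_def by linarith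
        then obtain w where w: "w \<in> Vec p" "\<gamma> s = graph_move p (\<rho> s) w"
          using good_radiusD(5)[OF \<sigma>(1)] unfolding \<rho>_def by blast
        have ge: "0 \<le> \<rho> s" by (simp add: \<rho>_def)
        have "w = v"
        proof (rule ccontr)
          assume "w \<noteq> v"
          then have "dist (graph_move p (\<rho> t) v) (graph_move p (\<rho> s) w) = \<rho> t + \<rho> s"
            using good_radiusD(4)[OF \<sigma>(1) v(1) w(1)] \<rho>t lt ge by auto
          then have "dist (\<gamma> t) (\<gamma> s) = \<rho> t + \<rho> s" using v(2) w(2) by metis
          then show False using ds s \<delta> ge by linarith
        qed
        then show ?thesis using w lt ge by blast
      qed
      have "\<exists>e. \<forall>s. \<bar>s - t\<bar> < \<delta> \<longrightarrow> \<rho> s = \<rho> t + e * (s - t)"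
      proof (rule isometry_into_reals_near_point[OF _ \<delta>(1)])
        fix s s' assume s: "\<bar>s - t\<bar> < \<delta>" "\<bar>s' - t\<bar> < \<delta>"
        have "\<bar>\<rho> s - \<rho> s'\<bar> = dist (graph_move p (\<rho> s) v) (graph_move p (\<rho> s') v)"
          using good_radiusD(3)[OF \<sigma>(1) v(1)] ray[OF s(1)] ray[OF s(2)] by simp
        also have "\<dots> = dist (\<gamma> s) (\<gamma> s')" using ray[OF s(1)] ray[OF s(2)] by metis
        also have "\<dots> = \<bar>s - s'\<bar>" using iso[of s s'] s \<delta> by (auto simp: abs_less_iff)
        finally show "\<bar>\<rho> s - \<rho> s'\<bar> = \<bar>s - s'\<bar>" .
      qed
      then obtain e where e: "\<And>s. \<bar>s - t\<bar> < \<delta> \<Longrightarrow> \<rho> s = \<rho> t + e * (s - t)" by blast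
      have "f (\<gamma> s) = (f p + (\<rho> t - e * t) * ray_slope f p v) + s * (e * ray_slope f p v)" if s: "\<bar>s - t\<bar> < \<delta>" for s
      proof -
        have "f (\<gamma> s) = f p + \<rho> s * ray_slope f p v" using \<sigma>(2)[OF v(1)] ray[OF s] by metis
        then show ?thesis unfolding e[OF s] by (simp add: algebra_simps)
      qed
      then show "\<exists>\<delta>>0. \<exists>c d. \<forall>s. \<bar>s - t\<bar> < \<delta> \<longrightarrow> f (\<gamma> s) = c + s * d" using \<delta>(1) by blast
    qed
    then obtain c d where cd: "\<And>t. t \<in> {a<..<b} \<Longrightarrow> f (\<gamma> t) = c + t * d" by blast
    then show "\<exists>c d. \<forall>t\<in>{a<..<b}. complex_of_real (f (\<gamma> t)) = c + complex_of_real t * d"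
      by (intro exI[of _ "complex_of_real c"] exI[of _ "complex_of_real d"]) simp
  qed
qed

lemma locally_affine_in_CPA: "locally_affine f \<Longrightarrow> (\<lambda>x. complex_of_real (f x)) \<in> CPA"
  unfolding CPA_def mem_Collect_eq
  by (intro conjI continuous_on_of_real locally_affine_continuous locally_affine_piecewise_affine)

text \<open>A short open ray at \<open>p\<close> is an isometric segment that avoids the finite exceptional set, except for its
  origin \<open>p\<close>, where continuity takes over.\<close>

lemma CPA_affine_on_rays:
  assumes "f \<in> CPA"
  obtains \<sigma> d where "\<sigma> > 0"
    "\<And>v t. v \<in> Vec p \<Longrightarrow> 0 \<le> t \<Longrightarrow> t < \<sigma> \<Longrightarrow> f (graph_move p t v) = f p + of_real t * d v"
proof -
  obtain R where R: "good_radius p R" using good_radius_exists by blast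
  have "piecewise_affine f" using assms by (simp add: CPA_def)
  then obtain S where S: "finite S" "\<forall>(a::real) b \<gamma>. (\<forall>s\<in>{a<..<b}. \<forall>t\<in>{a<..<b}. dist (\<gamma> s) (\<gamma> t) = \<bar>s - t\<bar>) \<and>
        \<gamma> ` {a<..<b} \<inter> S = {} \<longrightarrow> (\<exists>c d. \<forall>t\<in>{a<..<b}. f (\<gamma> t) = c + of_real t * d)"
    unfolding piecewise_affine_def by (elim exE conjE)
  obtain \<delta> where \<delta>: "\<delta> > 0" "\<forall>q\<in>S. q \<noteq> p \<longrightarrow> \<delta> \<le> dist p q"
    using finite_set_avoid[OF S(1), of p] by blast
  define \<sigma> where "\<sigma> = min \<delta> R"
  have \<sigma>: "0 < \<sigma>" "\<sigma> \<le> \<delta>" "\<sigma> \<le> R" using \<delta> good_radiusD(1)[OF R] by (auto simp: \<sigma>_def)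
  have "\<exists>d. \<forall>t. 0 \<le> t \<longrightarrow> t < \<sigma> \<longrightarrow> f (graph_move p t v) = f p + of_real t * d" if v: "v \<in> Vec p" for v
  proof -
    let ?\<gamma> = "\<lambda>t. graph_move p t v"
    have "\<exists>c d. \<forall>t\<in>{0<..<\<sigma>}. f (?\<gamma> t) = c + of_real t * d"
    proof (rule S(2)[rule_format, OF conjI])
      show "\<forall>s\<in>{0<..<\<sigma>}. \<forall>t\<in>{0<..<\<sigma>}. dist (?\<gamma> s) (?\<gamma> t) = \<bar>s - t\<bar>"
        using good_radiusD(3)[OF R v] \<sigma> by auto
      show "?\<gamma> ` {0<..<\<sigma>} \<inter> S = {}"
      proof (rule ccontr)
        assume "?\<gamma> ` {0<..<\<sigma>} \<inter> S \<noteq> {}"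
        then obtain t where t: "0 < t" "t < \<sigma>" "?\<gamma> t \<in> S" by auto
        moreover have "dist p (?\<gamma> t) = t" using dist_center_move[OF R v] t \<sigma> by simp
        ultimately show False using \<delta>(2) \<sigma> by force
      qed
    qed
    then obtain c d where cd: "\<And>t. 0 < t \<Longrightarrow> t < \<sigma> \<Longrightarrow> f (?\<gamma> t) = c + of_real t * d" by auto
    have "((\<lambda>t. f (?\<gamma> t)) \<longlongrightarrow> f p) (at_right 0)"
    proof -
      have "(?\<gamma> \<longlongrightarrow> p) (at_right 0)"
      proof (rule tendstoI)
        fix e :: real assume e: "0 < e"
        have "eventually (\<lambda>t::real. 0 < t \<and> t < min e \<sigma>) (at_right 0)"
          using e \<sigma> by (auto simp: eventually_at_right_field intro!: exI[of _ "min e \<sigma>"])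
        then show "eventually (\<lambda>t. dist (?\<gamma> t) p < e) (at_right 0)"
          by eventually_elim (use dist_center_move[OF R v] \<sigma> in \<open>simp add: dist_commute\<close>)
      qed
      moreover have "isCont f p" using assms by (auto simp: CPA_def continuous_on_eq_continuous_at)
      ultimately show ?thesis by (metis isCont_tendsto_compose)
    qed
    moreover have "((\<lambda>t. f (?\<gamma> t)) \<longlongrightarrow> c) (at_right 0)"
    proof -
      have "((\<lambda>t. c + complex_of_real t * d) \<longlongrightarrow> c + of_real 0 * d) (at_right 0)" by (intro tendsto_intros)
      moreover have "eventually (\<lambda>t. c + complex_of_real t * d = f (?\<gamma> t)) (at_right 0)"
      proof -
        have "eventually (\<lambda>t::real. 0 < t \<and> t < \<sigma>) (at_right 0)"
          using \<sigma> by (auto simp: eventually_at_right_field)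
        then show ?thesis by eventually_elim (simp add: cd)
      qed
      ultimately show ?thesis using tendsto_cong[of "\<lambda>t. c + complex_of_real t * d"] by force
    qed
    ultimately have "f p = c" using tendsto_unique[OF trivial_limit_at_right_real] by blast
    then have "f (?\<gamma> t) = f p + of_real t * d" if "0 \<le> t" "t < \<sigma>" for t
      using cd[of t] that by (cases "t = 0") auto
    then show ?thesis by blast
  qed
  then obtain d where "\<And>v t. v \<in> Vec p \<Longrightarrow> 0 \<le> t \<Longrightarrow> t < \<sigma> \<Longrightarrow> f (graph_move p t v) = f p + of_real t * d v"
    by metis
  with \<sigma>(1) show ?thesis by (rule that)
qed

lemma CPA_laplacian:
  assumes "f \<in> CPA"
  shows "ray_affine (\<lambda>x. Re (f x)) p" "ray_affine (\<lambda>x. Im (f x)) p"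
    "(\<Sum>v\<in>Vec p. dir_deriv f p v) = - Complex (lapl (\<lambda>x. Re (f x)) p) (lapl (\<lambda>x. Im (f x)) p)"
proof -
  obtain \<sigma> d where \<sigma>: "\<sigma> > 0"
    "\<And>v t. v \<in> Vec p \<Longrightarrow> 0 \<le> t \<Longrightarrow> t < \<sigma> \<Longrightarrow> f (graph_move p t v) = f p + of_real t * d v"
    using CPA_affine_on_rays[OF assms] by blast
  have re: "Re (f (graph_move p t v)) = Re (f p) + t * Re (d v)"
    and im: "Im (f (graph_move p t v)) = Im (f p) + t * Im (d v)"
    if "v \<in> Vec p" "0 \<le> t" "t < \<sigma>" for v t
    using \<sigma>(2)[OF that] by simp_all
  show "ray_affine (\<lambda>x. Re (f x)) p" by (rule lapl_at_center(1)[OF \<sigma>(1)]) (rule re; assumption)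
  show "ray_affine (\<lambda>x. Im (f x)) p" by (rule lapl_at_center(1)[OF \<sigma>(1)]) (rule im; assumption)
  have lre: "lapl (\<lambda>x. Re (f x)) p = - (\<Sum>v\<in>Vec p. Re (d v))"
    by (rule lapl_at_center(2)[OF \<sigma>(1)]) (rule re; assumption)
  have lim: "lapl (\<lambda>x. Im (f x)) p = - (\<Sum>v\<in>Vec p. Im (d v))"
    by (rule lapl_at_center(2)[OF \<sigma>(1)]) (rule im; assumption)
  have "dir_deriv f p v = d v" if v: "v \<in> Vec p" for v
    unfolding dir_deriv_def
  proof (rule tendsto_Lim)
    have "eventually (\<lambda>t::real. 0 < t \<and> t < \<sigma>) (at_right 0)"
      using \<sigma>(1) by (auto simp: eventually_at_right_field)
    then have "eventually (\<lambda>t. (f (graph_move p t v) - f p) / complex_of_real t = d v) (at_right 0)"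
      by eventually_elim (simp add: \<sigma>(2)[OF v])
    then show "((\<lambda>t. (f (graph_move p t v) - f p) / complex_of_real t) \<longlongrightarrow> d v) (at_right 0)"
      by (rule tendsto_eventually)
  qed simp
  then have "(\<Sum>v\<in>Vec p. dir_deriv f p v) = (\<Sum>v\<in>Vec p. d v)" by (intro sum.cong refl)
  then show "(\<Sum>v\<in>Vec p. dir_deriv f p v) = - Complex (lapl (\<lambda>x. Re (f x)) p) (lapl (\<lambda>x. Im (f x)) p)"
    by (simp add: lre lim complex_eq_iff)
qed

text \<open>For uniqueness the Laplacian is evaluated on singletons: the real part solves the dipole problem, and
  the imaginary part is harmonic and vanishes at \<open>z\<close>.\<close>

theorem j_kernel_eq_green: "j_kernel z x y = complex_of_real (green z y x)"
proof -
  let ?g = "\<lambda>x. complex_of_real (green z y x)"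
  let ?P = "\<lambda>f. f \<in> CPA \<and> (\<forall>A\<in>sets borel. graph_laplacian f A = dirac y A - dirac z A) \<and> f z = 0"
  have "(THE f. ?P f) = ?g"
  proof (rule the_equality)
    have g: "?g \<in> CPA" by (intro locally_affine_in_CPA locally_affine_green)
    have d: "(\<Sum>v\<in>Vec p. dir_deriv ?g p v) = of_bool (p = z) - of_bool (p = y)" for p
      using CPA_laplacian(3)[OF g, of p] lapl_green[of z y p] lapl_const(2)[of 0 p]
      by (simp add: complex_eq_iff)
    have "graph_laplacian ?g A = dirac y A - dirac z A" for A
    proof -
      have "(\<Sum>\<^sub>\<infinity>p\<in>A. \<Sum>v\<in>Vec p. dir_deriv ?g p v) = (\<Sum>\<^sub>\<infinity>p\<in>A \<inter> {y, z}. of_bool (p = z) - of_bool (p = y) :: complex)"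
        unfolding d by (rule infsum_cong_neutral) auto
      also have "\<dots> = (\<Sum>p\<in>A \<inter> {y, z}. of_bool (p = z) - of_bool (p = y))" by (rule infsum_finite) simp
      also have "\<dots> = dirac z A - dirac y A"
        by (cases "y = z"; cases "y \<in> A"; cases "z \<in> A") (auto simp: dirac_def)
      finally show ?thesis by (simp add: graph_laplacian_def)
    qed
    then show "?P ?g" using g by simp
  next
    fix f assume f: "?P f"
    then have C: "f \<in> CPA" by (rule conjunct1)
    have L: "Complex (lapl (\<lambda>x. Re (f x)) p) (lapl (\<lambda>x. Im (f x)) p) = of_bool (p = y) - of_bool (p = z)" for p
    proof -
      have "{p} \<in> sets borel" by (intro borel_closed) simp
      then have "graph_laplacian f {p} = dirac y {p} - dirac z {p}" using f by blast
      moreover have "graph_laplacian f {p} = - (\<Sum>v\<in>Vec p. dir_deriv f p v)"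
        unfolding graph_laplacian_def by (subst infsum_finite) auto
      ultimately show ?thesis unfolding CPA_laplacian(3)[OF C] by (auto simp: dirac_def indicator_def)
    qed
    have la: "locally_affine (\<lambda>x. Re (f x))" "locally_affine (\<lambda>x. Im (f x))"
      unfolding locally_affine_def using CPA_laplacian[OF C] by auto
    have "(\<lambda>x. Re (f x)) = green z y"
    proof (rule green_unique[OF la(1)])
      show "lapl (\<lambda>x. Re (f x)) q = of_bool (q = y) - of_bool (q = z)" for q
        using arg_cong[OF L[of q], of Re] by simp
    qed (use f in simp)
    moreover have "Im (f x) = Im (f z)" for x
    proof (rule harmonic_const[OF la(2)])
      show "lapl (\<lambda>x. Im (f x)) q = 0" for q
        using arg_cong[OF L[of q], of Im] by simp
    qed
    ultimately show "f = ?g" using f by (auto simp: fun_eq_iff complex_eq_iff)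
  qed
  then show ?thesis by (simp add: j_kernel_def)
qed

text \<open>As functions of \<open>x\<close>, both sides vanish at \<open>w\<close> and have the Laplacian of the dipole from \<open>w\<close> to \<open>y\<close>.\<close>

lemma green_change_base: "green w y x = green z x y - green z x w - green z w y + green z w w"
proof -
  have "(\<lambda>x. (green z y x - green z w x) + (green z w w - green z w y)) = green w y"
  proof (rule green_unique)
    show la: "locally_affine (\<lambda>x. (green z y x - green z w x) + (green z w w - green z w y))"
      by (intro locally_affine_intros locally_affine_green)
    have la': "locally_affine (\<lambda>x. green z y x - green z w x)"
      by (intro locally_affine_intros locally_affine_green)
    show "lapl (\<lambda>x. (green z y x - green z w x) + (green z w w - green z w y)) q = of_bool (q = y) - of_bool (q = w)" for q
      by (simp add: lapl_add(2)[OF locally_affineD[OF la'] lapl_const(1)]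
        lapl_diff(2)[OF locally_affineD locally_affineD, OF locally_affine_green locally_affine_green] lapl_green)
    show "(green z y w - green z w w) + (green z w w - green z w y) = 0" by (simp add: green_symmetric[of z y w])
  qed
  then show ?thesis by (metis (no_types, lifting) add.commute add_diff_eq diff_add_eq green_symmetric)
qed

section \<open>Bounded measures as differences of finite measures\<close>

definition sigma_additive :: "('a::topological_space set \<Rightarrow> 'b::real_normed_vector) \<Rightarrow> bool" where
  "sigma_additive \<sigma> \<longleftrightarrow> (\<forall>A::nat \<Rightarrow> 'a set. range A \<subseteq> sets borel \<longrightarrow> disjoint_family A \<longrightarrow>
     (\<lambda>i. \<sigma> (A i)) sums \<sigma> (\<Union>i. A i))"

lemma sigma_additiveD:
  assumes "sigma_additive \<sigma>" "range A \<subseteq> sets borel" "disjoint_family A"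
  shows "(\<lambda>i. \<sigma> (A i)) sums \<sigma> (\<Union>i::nat. A i)"
  using assms unfolding sigma_additive_def by blast

lemma sigma_additive_empty:
  assumes "sigma_additive \<sigma>" shows "\<sigma> {} = 0"
proof -
  have "(\<lambda>i::nat. \<sigma> {}) sums \<sigma> {}"
    using sigma_additiveD[OF assms, of "\<lambda>i. {}"] by (simp add: disjoint_family_on_def)
  then have "(\<lambda>i::nat. \<sigma> {}) \<longlonglongrightarrow> 0" using sums_summable summable_LIMSEQ_zero by blast
  then show ?thesis using LIMSEQ_const_iff by metis
qed

lemma sigma_additive_Un:
  assumes \<sigma>: "sigma_additive \<sigma>" and A: "A \<in> sets borel" "B \<in> sets borel" "A \<inter> B = {}"
  shows "\<sigma> (A \<union> B) = \<sigma> A + \<sigma> B"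
proof -
  have "(\<lambda>i. \<sigma> (binaryset A B i)) sums \<sigma> (\<Union>i. binaryset A B i)"
    using A by (intro sigma_additiveD[OF \<sigma>])
      (auto simp: range_binaryset_eq disjoint_family_on_def binaryset_def)
  moreover have "(\<lambda>i. \<sigma> (binaryset A B i)) sums (\<Sum>i\<in>{0, Suc 0}. \<sigma> (binaryset A B i))"
    by (rule sums_finite) (auto simp: binaryset_def sigma_additive_empty[OF \<sigma>])
  ultimately show ?thesis
    unfolding UN_binaryset_eq using sums_unique2 by (fastforce simp: binaryset_def)
qed

lemma sigma_additive_UN:
  assumes \<sigma>: "sigma_additive \<sigma>" and I: "finite I" "\<And>i. i \<in> I \<Longrightarrow> A i \<in> sets borel" "disjoint_family_on A I"
  shows "\<sigma> (\<Union>i\<in>I. A i) = (\<Sum>i\<in>I. \<sigma> (A i))"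
  using I
proof (induction I)
  case (insert i I)
  have dis: "A i \<inter> (\<Union>j\<in>I. A j) = {}"
    using insert.prems(2) insert.hyps unfolding disjoint_family_on_def by fastforce
  have "disjoint_family_on A I" using insert.prems(2) by (rule disjoint_family_on_mono[rotated]) auto
  then have IH: "\<sigma> (\<Union>i\<in>I. A i) = (\<Sum>i\<in>I. \<sigma> (A i))" using insert by auto
  have "(\<Union>j\<in>I. A j) \<in> sets borel" using insert by auto
  then have "\<sigma> (A i \<union> (\<Union>j\<in>I. A j)) = \<sigma> (A i) + \<sigma> (\<Union>j\<in>I. A j)"
    using insert.prems(1) by (intro sigma_additive_Un[OF \<sigma> _ _ dis]) auto
  then show ?case using insert.hyps IH by simp
qed (simp add: sigma_additive_empty[OF \<sigma>])

definition pos_var :: "('a::topological_space set \<Rightarrow> real) \<Rightarrow> 'a set \<Rightarrow> ennreal" where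
  "pos_var \<sigma> A = (SUP B\<in>{B\<in>sets borel. B \<subseteq> A}. ennreal (\<sigma> B))"

lemma pos_var_upper: "B \<in> sets borel \<Longrightarrow> B \<subseteq> A \<Longrightarrow> ennreal (\<sigma> B) \<le> pos_var \<sigma> A"
  unfolding pos_var_def by (rule SUP_upper) auto

lemma pos_var_mono: "A \<subseteq> A' \<Longrightarrow> pos_var \<sigma> A \<le> pos_var \<sigma> A'"
  unfolding pos_var_def by (rule SUP_subset_mono) auto

text \<open>Optimal subsets of \<open>A\<close> and of \<open>A'\<close> can be united. Where \<open>\<sigma>\<close> is negative, \<open>ennreal\<close> truncates, and the
  inequality reduces to a single subset.\<close>

lemma pos_var_superadditive:
  assumes \<sigma>: "sigma_additive \<sigma>" and dis: "A \<inter> A' = {}"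
  shows "pos_var \<sigma> A + pos_var \<sigma> A' \<le> pos_var \<sigma> (A \<union> A')"
proof -
  let ?I = "\<lambda>A. {B\<in>sets borel. B \<subseteq> A}"
  have ne: "?I A \<noteq> {}" for A :: "'a set" by (auto intro!: exI[of _ "{}"])
  have key: "ennreal (\<sigma> B) + ennreal (\<sigma> B') \<le> pos_var \<sigma> (A \<union> A')"
    if B: "B \<in> ?I A" "B' \<in> ?I A'" for B B'
  proof -
    have dB: "B \<inter> B' = {}" using B dis by auto
    have "\<sigma> (B \<union> B') = \<sigma> B + \<sigma> B'" using B by (intro sigma_additive_Un[OF \<sigma> _ _ dB]) auto
    then have 1: "ennreal (\<sigma> B + \<sigma> B') \<le> pos_var \<sigma> (A \<union> A')"
      using pos_var_upper[of "B \<union> B'" "A \<union> A'" \<sigma>] B by auto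
    have 2: "ennreal (\<sigma> B) \<le> pos_var \<sigma> (A \<union> A')" using B by (intro pos_var_upper) auto
    have 3: "ennreal (\<sigma> B') \<le> pos_var \<sigma> (A \<union> A')" using B by (intro pos_var_upper) auto
    show ?thesis
    proof (cases "0 \<le> \<sigma> B \<and> 0 \<le> \<sigma> B'")
      case True
      then show ?thesis using 1 by (simp add: ennreal_plus)
    next
      case False
      then show ?thesis using 2 3 by (auto simp: not_le ennreal_neg)
    qed
  qed
  have "pos_var \<sigma> A + pos_var \<sigma> A' = (SUP B\<in>?I A. ennreal (\<sigma> B) + pos_var \<sigma> A')"
    unfolding pos_var_def[of \<sigma> A] by (rule ennreal_SUP_add_left[OF ne, symmetric])
  also have "\<dots> = (SUP B\<in>?I A. SUP B'\<in>?I A'. ennreal (\<sigma> B) + ennreal (\<sigma> B'))"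
    unfolding pos_var_def[of \<sigma> A'] by (simp only: ennreal_SUP_add_right[OF ne])
  also have "\<dots> \<le> pos_var \<sigma> (A \<union> A')" by (intro SUP_least key)
  finally show ?thesis .
qed

lemma pos_var_countably_additive:
  assumes \<sigma>: "sigma_additive \<sigma>"
  shows "countably_additive (sets borel) (pos_var \<sigma>)"
  unfolding countably_additive_def
proof (intro allI impI)
  fix A :: "nat \<Rightarrow> 'a set"
  assume A: "range A \<subseteq> sets borel" "disjoint_family A" "(\<Union>i. A i) \<in> sets borel"
  have part: "(\<Sum>i<n. pos_var \<sigma> (A i)) \<le> pos_var \<sigma> (\<Union>i<n. A i)" for n
  proof (induction n)
    case (Suc n)
    have "A i \<inter> A n = {}" if "i < n" for i using disjoint_family_onD[OF A(2), of i n] that by simp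
    then have "(\<Union>i<n. A i) \<inter> A n = {}" by blast
    then have sup: "pos_var \<sigma> (\<Union>i<n. A i) + pos_var \<sigma> (A n) \<le> pos_var \<sigma> ((\<Union>i<n. A i) \<union> A n)"
      by (rule pos_var_superadditive[OF \<sigma>])
    have "(\<Sum>i<Suc n. pos_var \<sigma> (A i)) = (\<Sum>i<n. pos_var \<sigma> (A i)) + pos_var \<sigma> (A n)" by simp
    also have "\<dots> \<le> pos_var \<sigma> (\<Union>i<n. A i) + pos_var \<sigma> (A n)" by (rule add_right_mono[OF Suc])
    also note sup
    also have "(\<Union>i<n. A i) \<union> A n = (\<Union>i<Suc n. A i)" by (auto simp: less_Suc_eq)
    finally show ?case .
  qed simp
  have "(\<Sum>i. pos_var \<sigma> (A i)) \<le> pos_var \<sigma> (\<Union>i. A i)"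
    by (intro suminf_le_const summableI order_trans[OF part] pos_var_mono) auto
  moreover have "pos_var \<sigma> (\<Union>i. A i) \<le> (\<Sum>i. pos_var \<sigma> (A i))"
    unfolding pos_var_def[of \<sigma> "\<Union>i. A i"]
  proof (rule SUP_least)
    fix B assume "B \<in> {B \<in> sets borel. B \<subseteq> (\<Union>i. A i)}"
    then have B: "B \<in> sets borel" "B \<subseteq> (\<Union>i. A i)" by auto
    have "(\<lambda>i. \<sigma> (B \<inter> A i)) sums \<sigma> (\<Union>i. B \<inter> A i)"
      using A B by (intro sigma_additiveD[OF \<sigma>]) (auto simp: disjoint_family_on_def)
    moreover have "(\<Union>i. B \<inter> A i) = B" using B by auto
    ultimately have "(\<lambda>n. \<Sum>i<n. \<sigma> (B \<inter> A i)) \<longlonglongrightarrow> \<sigma> B" by (simp add: sums_def)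
    then have "(\<lambda>n. ennreal (\<Sum>i<n. \<sigma> (B \<inter> A i))) \<longlonglongrightarrow> ennreal (\<sigma> B)" by (rule tendsto_ennrealI)
    moreover have "ennreal (\<Sum>i<n. \<sigma> (B \<inter> A i)) \<le> (\<Sum>i. pos_var \<sigma> (A i))" for n
    proof -
      have "(\<Sum>i<n. \<sigma> (B \<inter> A i)) \<le> (\<Sum>i<n. max 0 (\<sigma> (B \<inter> A i)))" by (intro sum_mono) simp
      then have "ennreal (\<Sum>i<n. \<sigma> (B \<inter> A i)) \<le> ennreal (\<Sum>i<n. max 0 (\<sigma> (B \<inter> A i)))" by (rule ennreal_leI)
      also have "\<dots> = (\<Sum>i<n. ennreal (max 0 (\<sigma> (B \<inter> A i))))" by (rule sum_ennreal[symmetric]) simp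
      also have "\<dots> = (\<Sum>i<n. ennreal (\<sigma> (B \<inter> A i)))"
        by (intro sum.cong refl) (simp add: max_def ennreal_neg)
      also have "\<dots> \<le> (\<Sum>i<n. pos_var \<sigma> (A i))"
        using A(1) B(1) by (intro sum_mono pos_var_upper) auto
      also have "\<dots> \<le> (\<Sum>i. pos_var \<sigma> (A i))" by (intro sum_le_suminf summableI) auto
      finally show ?thesis .
    qed
    ultimately show "ennreal (\<sigma> B) \<le> (\<Sum>i. pos_var \<sigma> (A i))"
      using LIMSEQ_le_const2 by blast
  qed
  ultimately show "(\<Sum>i. pos_var \<sigma> (A i)) = pos_var \<sigma> (\<Union>i. A i)" by (rule antisym)
qed

lemma pos_variation_alt: "pos_variation \<sigma> = measure_of UNIV (sets borel) (pos_var \<sigma>)"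
  unfolding pos_variation_def pos_var_def ..

lemma pos_variation_space_sets [simp]:
  "sets (pos_variation (\<sigma> :: 'a::topological_space set \<Rightarrow> real)) = sets borel" "space (pos_variation \<sigma>) = UNIV"
  unfolding pos_variation_alt
  using sets.sets_measure_of_eq[of "borel :: 'a measure"] by (auto simp: space_measure_of_conv)

lemma emeasure_pos_variation:
  assumes \<sigma>: "sigma_additive \<sigma>" and A: "A \<in> sets borel"
  shows "emeasure (pos_variation \<sigma>) A = pos_var \<sigma> A"
  unfolding pos_variation_alt
proof (rule emeasure_measure_of_sigma[OF _ _ pos_var_countably_additive[OF \<sigma>] A])
  show "sigma_algebra UNIV (sets (borel :: 'a measure))"
    using sets.sigma_algebra_axioms[of "borel :: 'a measure"] by simp
  have "{B \<in> sets borel. B \<subseteq> {}} = {{} :: 'a set}" by auto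
  then show "positive (sets borel) (pos_var \<sigma>)"
    by (simp add: positive_def pos_var_def sigma_additive_empty[OF \<sigma>])
qed

definition bounded_signed :: "('a::topological_space set \<Rightarrow> real) \<Rightarrow> bool" where
  "bounded_signed \<sigma> \<longleftrightarrow> sigma_additive \<sigma> \<and> (\<exists>K. \<forall>B\<in>sets borel. \<bar>\<sigma> B\<bar> \<le> K)"

lemma bounded_signed_uminus:
  assumes "bounded_signed \<sigma>" shows "bounded_signed (\<lambda>A. - \<sigma> A)"
  using assms unfolding bounded_signed_def sigma_additive_def by (auto intro: sums_minus)

lemma finite_measure_pos_variation:
  assumes \<sigma>: "bounded_signed \<sigma>" shows "finite_measure (pos_variation \<sigma>)"
proof (rule finite_measureI)
  obtain K where K: "\<And>B. B \<in> sets borel \<Longrightarrow> \<bar>\<sigma> B\<bar> \<le> K" using \<sigma> unfolding bounded_signed_def by blast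
  have "emeasure (pos_variation \<sigma>) (space (pos_variation \<sigma>)) = pos_var \<sigma> UNIV"
    using \<sigma> by (simp add: emeasure_pos_variation bounded_signed_def)
  also have "\<dots> \<le> ennreal K" unfolding pos_var_def
  proof (rule SUP_least)
    fix B :: "'a set" assume "B \<in> {B \<in> sets borel. B \<subseteq> UNIV}"
    then show "ennreal (\<sigma> B) \<le> ennreal K" using K[of B] by (intro ennreal_leI) auto
  qed
  finally show "emeasure (pos_variation \<sigma>) (space (pos_variation \<sigma>)) \<noteq> \<infinity>"
    by (auto simp: top_unique)
qed

lemma measure_pos_variation_le:
  assumes \<sigma>: "bounded_signed \<sigma>" and A: "A \<in> sets borel"
    and le: "\<And>B. B \<in> sets borel \<Longrightarrow> B \<subseteq> A \<Longrightarrow> \<sigma> B \<le> x"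
  shows "measure (pos_variation \<sigma>) A \<le> x"
proof -
  have sa: "sigma_additive \<sigma>" using \<sigma> by (simp add: bounded_signed_def)
  have x: "0 \<le> x" using le[of "{}"] sigma_additive_empty[OF sa] by simp
  have "emeasure (pos_variation \<sigma>) A \<le> ennreal x"
    unfolding emeasure_pos_variation[OF sa A] pos_var_def
    by (rule SUP_least) (auto intro!: ennreal_leI le)
  then show ?thesis using x by (simp add: measure_def enn2real_leI)
qed

lemma measure_pos_variation_ge:
  assumes \<sigma>: "bounded_signed \<sigma>" and A: "A \<in> sets borel" and B: "B \<in> sets borel" "B \<subseteq> A"
  shows "\<sigma> B \<le> measure (pos_variation \<sigma>) A"
proof -
  interpret finite_measure "pos_variation \<sigma>" by (rule finite_measure_pos_variation[OF \<sigma>])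
  have "ennreal (\<sigma> B) \<le> emeasure (pos_variation \<sigma>) A"
    using \<sigma> emeasure_pos_variation[OF _ A] pos_var_upper[OF B] by (simp add: bounded_signed_def)
  then have "ennreal (\<sigma> B) \<le> ennreal (measure (pos_variation \<sigma>) A)" by (simp add: emeasure_eq_measure)
  moreover have "0 \<le> measure (pos_variation \<sigma>) A" by simp
  ultimately show ?thesis by (simp add: ennreal_le_iff)
qed

text \<open>For \<open>B \<subseteq> A\<close> one has \<open>\<sigma> B = \<sigma> A + (- \<sigma>)(A - B)\<close>, so the suprema over \<open>B\<close> and over \<open>A - B\<close> differ by \<open>\<sigma> A\<close>.\<close>

theorem jordan_decomposition:
  assumes \<sigma>: "bounded_signed \<sigma>" and A: "A \<in> sets borel"
  shows "\<sigma> A = measure (pos_variation \<sigma>) A - measure (pos_variation (\<lambda>A. - \<sigma> A)) A"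
proof -
  note \<sigma>' = bounded_signed_uminus[OF \<sigma>]
  have split: "\<sigma> A = \<sigma> B + \<sigma> (A - B)" if "B \<in> sets borel" "B \<subseteq> A" for B
    using sigma_additive_Un[of \<sigma> B "A - B"] \<sigma> A that
    by (simp add: bounded_signed_def Un_absorb1 sets.Diff)
  have "measure (pos_variation \<sigma>) A \<le> \<sigma> A + measure (pos_variation (\<lambda>A. - \<sigma> A)) A"
  proof (rule measure_pos_variation_le[OF \<sigma> A])
    fix B assume B: "B \<in> sets borel" "B \<subseteq> A"
    then have "- \<sigma> (A - B) \<le> measure (pos_variation (\<lambda>A. - \<sigma> A)) A"
      using A by (intro measure_pos_variation_ge[OF \<sigma>' A]) auto
    then show "\<sigma> B \<le> \<sigma> A + measure (pos_variation (\<lambda>A. - \<sigma> A)) A" using split[OF B] by simp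
  qed
  moreover have "measure (pos_variation (\<lambda>A. - \<sigma> A)) A \<le> measure (pos_variation \<sigma>) A - \<sigma> A"
  proof (rule measure_pos_variation_le[OF \<sigma>' A])
    fix B assume B: "B \<in> sets borel" "B \<subseteq> A"
    then have "\<sigma> (A - B) \<le> measure (pos_variation \<sigma>) A"
      using A by (intro measure_pos_variation_ge[OF \<sigma> A]) auto
    then show "- \<sigma> B \<le> measure (pos_variation \<sigma>) A - \<sigma> A" using split[OF B] by simp
  qed
  ultimately show ?thesis by simp
qed

lemma Meas_total_variation:
  fixes \<nu> :: "'a::topological_space set \<Rightarrow> complex"
  assumes \<nu>: "\<nu> \<in> Meas"
  obtains K where "0 \<le> K" "\<And>P. finite P \<Longrightarrow> P \<subseteq> sets borel \<Longrightarrow> disjoint P \<Longrightarrow> \<Union>P = UNIV \<Longrightarrow> (\<Sum>E\<in>P. norm (\<nu> E)) \<le> K"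
proof -
  have fin: "total_variation \<nu> UNIV < \<infinity>" using \<nu> by (simp add: Meas_def)
  show ?thesis
  proof (rule that[of "enn2real (total_variation \<nu> UNIV)"])
    fix P :: "'a set set" assume P: "finite P" "P \<subseteq> sets borel" "disjoint P" "\<Union>P = UNIV"
    have "ennreal (\<Sum>E\<in>P. norm (\<nu> E)) = (\<Sum>E\<in>P. ennreal (norm (\<nu> E)))" by (rule sum_ennreal[symmetric]) simp
    also have "\<dots> \<le> total_variation \<nu> UNIV" unfolding total_variation_def using P by (intro SUP_upper) auto
    also have "\<dots> = ennreal (enn2real (total_variation \<nu> UNIV))" using fin by (simp add: less_top)
    finally show "(\<Sum>E\<in>P. norm (\<nu> E)) \<le> enn2real (total_variation \<nu> UNIV)" by simp
  qed simp
qed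

lemma Meas_bounded:
  fixes \<nu> :: "'a::topological_space set \<Rightarrow> complex"
  assumes \<nu>: "\<nu> \<in> Meas"
  obtains K where "\<And>B. B \<in> sets borel \<Longrightarrow> norm (\<nu> B) \<le> K"
proof -
  obtain K where K: "0 \<le> K" "\<And>P. finite P \<Longrightarrow> P \<subseteq> sets borel \<Longrightarrow> disjoint P \<Longrightarrow> \<Union>P = UNIV \<Longrightarrow> (\<Sum>E\<in>P. norm (\<nu> E)) \<le> K"
    by (rule Meas_total_variation[OF \<nu>]) (rule that)
  show ?thesis
  proof (rule that[of K])
    fix B :: "'a set" assume B: "B \<in> sets borel"
    have "norm (\<nu> B) \<le> (\<Sum>E\<in>{B, - B}. norm (\<nu> E))" by (intro member_le_sum) auto
    also have "\<dots> \<le> K" using B by (intro K(2)) (auto simp: pairwise_def disjnt_def)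
    finally show "norm (\<nu> B) \<le> K" .
  qed
qed

lemma Meas_sigma_additive: "\<nu> \<in> Meas \<Longrightarrow> sigma_additive \<nu>"
  unfolding Meas_def sigma_additive_def by blast

lemma Meas_bounded_signed:
  assumes \<nu>: "\<nu> \<in> Meas"
  shows "bounded_signed (\<lambda>A. Re (\<nu> A))" "bounded_signed (\<lambda>A. Im (\<nu> A))"
proof -
  have sa: "(\<lambda>i. \<nu> (A i)) sums \<nu> (\<Union>i::nat. A i)" if "range A \<subseteq> sets borel" "disjoint_family A" for A
    using sigma_additiveD[OF Meas_sigma_additive[OF \<nu>] that] .
  obtain K where K: "\<And>B. B \<in> sets borel \<Longrightarrow> norm (\<nu> B) \<le> K" by (rule Meas_bounded[OF \<nu>]) (rule that)
  have 1: "\<bar>Re (\<nu> B)\<bar> \<le> K" "\<bar>Im (\<nu> B)\<bar> \<le> K" if "B \<in> sets borel" for B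
    using K[OF that] abs_Re_le_cmod[of "\<nu> B"] abs_Im_le_cmod[of "\<nu> B"] by linarith+
  show "bounded_signed (\<lambda>A. Re (\<nu> A))" "bounded_signed (\<lambda>A. Im (\<nu> A))"
    unfolding bounded_signed_def sigma_additive_def using sa 1 by (auto intro!: sums_Re sums_Im)
qed

lemma Meas_cnj:
  assumes "\<nu> \<in> Meas" shows "(\<lambda>A. cnj (\<nu> A)) \<in> Meas"
  using assms unfolding Meas_def total_variation_def by (auto simp: sums_cnj)

section \<open>Integration by Riemann sums\<close>

lemma continuous_integrable:
  fixes f :: "'a::metrized_graph \<Rightarrow> complex"
  assumes M: "finite_measure M" "sets M = sets borel" and f: "continuous_on UNIV f"
  shows "integrable M f"
proof -
  have "compact (range f)" using compact_continuous_image[OF f compact_graph] .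
  then obtain B where B: "\<And>x. norm (f x) \<le> B" using compact_imp_bounded bounded_iff by (metis rangeI)
  have "f \<in> borel_measurable M"
    using borel_measurable_continuous_onI[OF f] measurable_cong_sets[OF M(2) refl] by blast
  then show ?thesis by (intro finite_measure.integrable_const_bound[OF M(1)]) (auto intro: B)
qed

definition riemann_sum :: "('a \<Rightarrow> 'a) \<Rightarrow> ('a set \<Rightarrow> complex) \<Rightarrow> ('a \<Rightarrow> complex) \<Rightarrow> complex" where
  "riemann_sum \<tau> \<nu> f = (\<Sum>q\<in>range \<tau>. f q * \<nu> (\<tau> -` {q}))"

text \<open>A finite Borel partition with tags is encoded as the map \<open>\<tau>\<close> that sends a point to the tag of its
  cell; the cell of the tag \<open>q\<close> is the preimage of \<open>{q}\<close>.\<close>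

definition tagging :: "('a::topological_space \<Rightarrow> 'a) \<Rightarrow> bool" where
  "tagging \<tau> \<longleftrightarrow> finite (range \<tau>) \<and> (\<forall>q. \<tau> -` {q} \<in> sets borel)"

text \<open>The functional \<open>I\<close> is approximated on continuous functions by Riemann sums of \<open>\<nu>\<close>, with an error
  proportional to the oscillation on the cells. This passes to linear combinations, and so from
  positive measures to all bounded ones.\<close>

definition riemann_approx :: "(('a::topological_space \<Rightarrow> complex) \<Rightarrow> complex) \<Rightarrow> ('a set \<Rightarrow> complex) \<Rightarrow> real \<Rightarrow> bool" where
  "riemann_approx I \<nu> K \<longleftrightarrow> 0 \<le> K \<and> (\<forall>f \<tau> \<epsilon>. continuous_on UNIV f \<longrightarrow> tagging \<tau> \<longrightarrow>
     (\<forall>x. norm (f x - f (\<tau> x)) \<le> \<epsilon>) \<longrightarrow> norm (I f - riemann_sum \<tau> \<nu> f) \<le> K * \<epsilon>)"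

lemma riemann_approxD:
  assumes "riemann_approx I \<nu> K" "continuous_on UNIV f" "tagging \<tau>" "\<forall>x. norm (f x - f (\<tau> x)) \<le> \<epsilon>"
  shows "norm (I f - riemann_sum \<tau> \<nu> f) \<le> K * \<epsilon>"
  using assms unfolding riemann_approx_def by blast

lemma riemann_approx_linear:
  fixes \<nu> \<nu>' :: "'a::topological_space set \<Rightarrow> complex"
  assumes I: "riemann_approx I \<nu> K" and J: "riemann_approx J \<nu>' L"
  shows "riemann_approx (\<lambda>f. I f + c * J f) (\<lambda>A. \<nu> A + c * \<nu>' A) (K + norm c * L)"
  unfolding riemann_approx_def
proof (intro conjI allI impI)
  show "0 \<le> K + norm c * L" using I J by (simp add: riemann_approx_def)
  fix f :: "'a \<Rightarrow> complex" and \<tau> :: "'a \<Rightarrow> 'a" and \<epsilon> :: real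
  assume f: "continuous_on UNIV f" "tagging \<tau>" "\<forall>x. norm (f x - f (\<tau> x)) \<le> \<epsilon>"
  have eq: "I f + c * J f - riemann_sum \<tau> (\<lambda>A. \<nu> A + c * \<nu>' A) f
      = (I f - riemann_sum \<tau> \<nu> f) + c * (J f - riemann_sum \<tau> \<nu>' f)"
    by (simp add: riemann_sum_def distrib_left sum.distrib sum_distrib_left algebra_simps)
  have "norm (I f + c * J f - riemann_sum \<tau> (\<lambda>A. \<nu> A + c * \<nu>' A) f)
      \<le> norm (I f - riemann_sum \<tau> \<nu> f) + norm (c * (J f - riemann_sum \<tau> \<nu>' f))"
    unfolding eq by (rule norm_triangle_ineq)
  also have "\<dots> \<le> K * \<epsilon> + norm c * (L * \<epsilon>)"
    using riemann_approxD[OF I f] riemann_approxD[OF J f] by (simp add: norm_mult add_mono mult_left_mono)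
  finally show "norm (I f + c * J f - riemann_sum \<tau> (\<lambda>A. \<nu> A + c * \<nu>' A) f) \<le> (K + norm c * L) * \<epsilon>"
    by (simp add: algebra_simps)
qed

lemma riemann_approx_cong:
  assumes I: "riemann_approx I \<nu> K" and eq: "\<And>A. A \<in> sets borel \<Longrightarrow> \<nu> A = \<nu>' A"
  shows "riemann_approx I \<nu>' K"
proof -
  have "riemann_sum \<tau> \<nu> f = riemann_sum \<tau> \<nu>' f" if "tagging \<tau>" for \<tau> f
    using that unfolding riemann_sum_def by (intro sum.cong refl) (simp add: tagging_def eq)
  then show ?thesis using I by (simp add: riemann_approx_def)
qed

text \<open>The Riemann sum is the integral of the simple function \<open>f \<circ> \<tau>\<close>.\<close>

lemma integral_riemann_approx:
  fixes M :: "'a::metrized_graph measure"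
  assumes M: "finite_measure M" "sets M = sets borel"
  shows "riemann_approx (\<lambda>f. \<integral>x. f x \<partial>M) (\<lambda>A. complex_of_real (measure M A)) (measure M (space M))"
  unfolding riemann_approx_def
proof (intro conjI allI impI)
  fix f :: "'a \<Rightarrow> complex" and \<tau> :: "'a \<Rightarrow> 'a" and \<epsilon> :: real
  assume f: "continuous_on UNIV f" and \<tau>: "tagging \<tau>" and \<epsilon>: "\<forall>x. norm (f x - f (\<tau> x)) \<le> \<epsilon>"
  interpret finite_measure M by fact
  have fin: "finite (range \<tau>)" and meas: "\<tau> -` {q} \<in> sets M" for q using \<tau> M(2) by (auto simp: tagging_def)
  have eq: "f (\<tau> x) = (\<Sum>q\<in>range \<tau>. indicator (\<tau> -` {q}) x *\<^sub>R f q)" for x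
  proof -
    have "(\<Sum>q\<in>range \<tau>. indicator (\<tau> -` {q}) x *\<^sub>R f q) = (\<Sum>q\<in>range \<tau>. if q = \<tau> x then f (\<tau> x) else 0)"
      by (intro sum.cong refl) (auto simp: indicator_def)
    then show ?thesis using fin by simp
  qed
  have i1: "integrable M (\<lambda>x. indicator (\<tau> -` {q}) x *\<^sub>R f q)" for q
    using meas by (intro integrable_scaleR_left integrable_real_indicator) (auto simp: emeasure_eq_measure)
  have i: "integrable M (\<lambda>x. f (\<tau> x))" unfolding eq by (intro Bochner_Integration.integrable_sum i1)
  have "(\<integral>x. f (\<tau> x) \<partial>M) = (\<Sum>q\<in>range \<tau>. \<integral>x. indicator (\<tau> -` {q}) x *\<^sub>R f q \<partial>M)"
    unfolding eq by (rule Bochner_Integration.integral_sum) (rule i1)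
  also have "\<dots> = (\<Sum>q\<in>range \<tau>. f q * of_real (measure M (\<tau> -` {q})))"
  proof (intro sum.cong refl)
    fix q
    have "(\<integral>x. indicator (\<tau> -` {q}) x *\<^sub>R f q \<partial>M) = (\<integral>x. indicator (\<tau> -` {q}) x \<partial>M) *\<^sub>R f q"
      using meas by (intro integral_scaleR_left integrable_real_indicator) (auto simp: emeasure_eq_measure)
    also have "(\<integral>x. indicator (\<tau> -` {q}) x \<partial>M) = measure M (\<tau> -` {q})"
      using sets.sets_into_space[OF meas] by (simp add: Int_absorb2)
    finally show "(\<integral>x. indicator (\<tau> -` {q}) x *\<^sub>R f q \<partial>M) = f q * of_real (measure M (\<tau> -` {q}))"
      by (simp add: scaleR_conv_of_real)
  qed
  finally have "(\<integral>x. f x \<partial>M) - (\<Sum>q\<in>range \<tau>. f q * of_real (measure M (\<tau> -` {q}))) = (\<integral>x. f x - f (\<tau> x) \<partial>M)"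
    using i continuous_integrable[OF M f] by simp
  also have "norm \<dots> \<le> (\<integral>x. norm (f x - f (\<tau> x)) \<partial>M)" by (rule integral_norm_bound)
  also have "\<dots> \<le> (\<integral>x. \<epsilon> \<partial>M)"
    using i continuous_integrable[OF M f] by (intro integral_mono) (auto simp: \<epsilon>)
  finally show "norm ((\<integral>x. f x \<partial>M) - riemann_sum \<tau> (\<lambda>A. complex_of_real (measure M A)) f) \<le> measure M (space M) * \<epsilon>"
    by (simp add: riemann_sum_def)
qed simp

lemma signed_integral_riemann_approx:
  assumes \<sigma>: "bounded_signed (\<sigma> :: 'a::metrized_graph set \<Rightarrow> real)"
  shows "\<exists>K. riemann_approx (signed_integral \<sigma>) (\<lambda>A. complex_of_real (\<sigma> A)) K"
proof -
  let ?P = "pos_variation \<sigma>" and ?N = "pos_variation (\<lambda>A. - \<sigma> A)"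
  have P: "riemann_approx (\<lambda>f. \<integral>x. f x \<partial>?P) (\<lambda>A. complex_of_real (measure ?P A)) (measure ?P (space ?P))"
    by (intro integral_riemann_approx finite_measure_pos_variation \<sigma>) simp
  have N: "riemann_approx (\<lambda>f. \<integral>x. f x \<partial>?N) (\<lambda>A. complex_of_real (measure ?N A)) (measure ?N (space ?N))"
    by (intro integral_riemann_approx finite_measure_pos_variation bounded_signed_uminus \<sigma>) simp
  have eq: "signed_integral \<sigma> = (\<lambda>f. (\<integral>x. f x \<partial>?P) + (- 1) * (\<integral>x. f x \<partial>?N))"
    by (simp add: signed_integral_def fun_eq_iff)
  show ?thesis
    unfolding eq by (intro exI, rule riemann_approx_cong[OF riemann_approx_linear[OF P N]])
      (simp add: jordan_decomposition[OF \<sigma>])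
qed

lemma meas_integral_riemann_approx:
  fixes \<nu> :: "'a::metrized_graph set \<Rightarrow> complex"
  assumes \<nu>: "\<nu> \<in> Meas"
  shows "\<exists>K. riemann_approx (meas_integral \<nu>) \<nu> K"
proof -
  obtain K L where KL: "riemann_approx (signed_integral (\<lambda>A. Re (\<nu> A))) (\<lambda>A. complex_of_real (Re (\<nu> A))) K"
    "riemann_approx (signed_integral (\<lambda>A. Im (\<nu> A))) (\<lambda>A. complex_of_real (Im (\<nu> A))) L"
    using signed_integral_riemann_approx Meas_bounded_signed[OF \<nu>] by blast
  have eq: "meas_integral \<nu> = (\<lambda>f. signed_integral (\<lambda>A. Re (\<nu> A)) f + \<i> * signed_integral (\<lambda>A. Im (\<nu> A)) f)"
    by (simp add: meas_integral_def fun_eq_iff)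
  show ?thesis
    unfolding eq by (intro exI, rule riemann_approx_cong[OF riemann_approx_linear[OF KL]])
      (simp flip: complex_eq)
qed

lemma tagging_exists:
  assumes d: "d > 0"
  obtains \<tau> :: "'a::metrized_graph \<Rightarrow> 'a" where "tagging \<tau>" "\<And>x. dist x (\<tau> x) < d"
proof -
  obtain C :: "'a set" where C: "finite C" "\<And>x. \<exists>c\<in>C. dist c x < d" using finite_ball_cover[of "\<lambda>_. d"] d by blast
  have "\<exists>\<tau>. tagging \<tau> \<and> (\<forall>x. (\<exists>c\<in>C. dist c x < d) \<longrightarrow> dist x (\<tau> x) < d)" using C(1)
  proof (induction C)
    case empty
    have "tagging (\<lambda>x. undefined :: 'a)"
      unfolding tagging_def by (auto simp: vimage_def)
    then show ?case by auto
  next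
    case (insert c C)
    then obtain \<tau> where \<tau>: "tagging \<tau>" "\<forall>x. (\<exists>c\<in>C. dist c x < d) \<longrightarrow> dist x (\<tau> x) < d" by blast
    let ?\<tau> = "\<lambda>x. if x \<in> ball c d then c else \<tau> x"
    have "range ?\<tau> \<subseteq> insert c (range \<tau>)" by auto
    then have "finite (range ?\<tau>)" using \<tau>(1) by (auto simp: tagging_def intro: finite_subset)
    moreover have "?\<tau> -` {q} \<in> sets borel" for q
    proof -
      have "?\<tau> -` {q} = (if q = c then ball c d else {}) \<union> (\<tau> -` {q} - ball c d)" by auto
      then show ?thesis using \<tau>(1) by (auto simp: tagging_def)
    qed
    ultimately have "tagging ?\<tau>" by (simp add: tagging_def)
    moreover have "\<forall>x. (\<exists>c\<in>insert c C. dist c x < d) \<longrightarrow> dist x (?\<tau> x) < d" using \<tau>(2) by (auto simp: dist_commute)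
    ultimately show ?case by blast
  qed
  then show ?thesis using that C(2) by blast
qed

lemma riemann_sum_norm_le:
  assumes \<nu>: "\<nu> \<in> (Meas :: ('a::topological_space set \<Rightarrow> complex) set)"
  obtains K where "0 \<le> K" "\<And>f \<tau> \<epsilon>. tagging \<tau> \<Longrightarrow> (\<forall>x. norm (f x) \<le> \<epsilon>) \<Longrightarrow> norm (riemann_sum \<tau> \<nu> f) \<le> K * \<epsilon>"
proof -
  obtain K where K: "0 \<le> K" "\<And>P. finite P \<Longrightarrow> P \<subseteq> sets borel \<Longrightarrow> disjoint P \<Longrightarrow> \<Union>P = UNIV \<Longrightarrow> (\<Sum>E\<in>P. norm (\<nu> E)) \<le> K"
    by (rule Meas_total_variation[OF \<nu>]) (rule that)
  show ?thesis
  proof (rule that[OF K(1)])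
    fix f :: "'a \<Rightarrow> complex" and \<tau> :: "'a \<Rightarrow> 'a" and \<epsilon> :: real assume \<tau>: "tagging \<tau>" and f: "\<forall>x. norm (f x) \<le> \<epsilon>"
    have \<epsilon>: "0 \<le> \<epsilon>" using f norm_ge_zero order_trans by blast
    have inj: "inj_on (\<lambda>q. \<tau> -` {q}) (range \<tau>)" by (auto simp: inj_on_def)
    have "norm (riemann_sum \<tau> \<nu> f) \<le> (\<Sum>q\<in>range \<tau>. \<epsilon> * norm (\<nu> (\<tau> -` {q})))"
      unfolding riemann_sum_def by (rule sum_norm_le) (use f in \<open>auto simp: norm_mult intro: mult_right_mono\<close>)
    also have "\<dots> = (\<Sum>E\<in>(\<lambda>q. \<tau> -` {q}) ` range \<tau>. norm (\<nu> E)) * \<epsilon>"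
      by (simp add: sum.reindex[OF inj] sum_distrib_left mult.commute)
    also have "\<dots> \<le> K * \<epsilon>"
      using \<tau> by (intro mult_right_mono K(2) \<epsilon>) (auto simp: tagging_def pairwise_def disjnt_def)
    finally show "norm (riemann_sum \<tau> \<nu> f) \<le> K * \<epsilon>" .
  qed
qed

definition mesh_tagging :: "nat \<Rightarrow> 'a::metrized_graph \<Rightarrow> 'a" where
  "mesh_tagging n = (SOME \<tau>. tagging \<tau> \<and> (\<forall>x. dist x (\<tau> x) < 1 / real (Suc n)))"

lemma mesh_tagging:
  fixes x :: "'a::metrized_graph"
  shows "tagging (mesh_tagging n :: 'a \<Rightarrow> 'a)" "dist x (mesh_tagging n x) < 1 / real (Suc n)"
proof -
  have "\<exists>\<tau> :: 'a \<Rightarrow> 'a. tagging \<tau> \<and> (\<forall>x. dist x (\<tau> x) < 1 / real (Suc n))"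
    using tagging_exists[of "1 / real (Suc n)"] by (metis of_nat_0_less_iff zero_less_Suc zero_less_divide_1_iff)
  from someI_ex[OF this] show "tagging (mesh_tagging n :: 'a \<Rightarrow> 'a)" "dist x (mesh_tagging n x) < 1 / real (Suc n)"
    unfolding mesh_tagging_def by blast+
qed

abbreviation RS :: "nat \<Rightarrow> ('a::metrized_graph set \<Rightarrow> complex) \<Rightarrow> ('a \<Rightarrow> complex) \<Rightarrow> complex" where
  "RS n \<equiv> riemann_sum (mesh_tagging n)"

lemma mesh_eventually:
  assumes "d > 0"
  shows "eventually (\<lambda>n. \<forall>x. dist x (mesh_tagging n x) < d) sequentially"
proof -
  obtain N where N: "1 / real (Suc N) < d" using nat_approx_posE[OF assms] by blast
  have "dist x (mesh_tagging n x) < d" if "n \<ge> N" for n x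
  proof -
    have "1 / real (Suc n) \<le> 1 / real (Suc N)" using that by (intro divide_left_mono) auto
    then show ?thesis using mesh_tagging(2)[of x n] N by linarith
  qed
  then show ?thesis unfolding eventually_sequentially by blast
qed

theorem riemann_sum_tendsto:
  assumes \<nu>: "\<nu> \<in> Meas" and f: "continuous_on UNIV f"
  shows "(\<lambda>n. RS n \<nu> f) \<longlonglongrightarrow> meas_integral \<nu> f"
proof -
  obtain K where K: "riemann_approx (meas_integral \<nu>) \<nu> K" using meas_integral_riemann_approx[OF \<nu>] by blast
  then have K0: "0 \<le> K" by (simp add: riemann_approx_def)
  have uc: "uniformly_continuous_on UNIV f" by (rule compact_uniformly_continuous[OF f compact_graph])
  show ?thesis
  proof (rule LIMSEQ_I)
    fix r :: real assume r: "0 < r"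
    define \<epsilon> where "\<epsilon> = r / (K + 1)"
    have \<epsilon>: "0 < \<epsilon>" "K * \<epsilon> < r" using r K0 by (auto simp: \<epsilon>_def field_simps)
    obtain d where d: "d > 0" "\<And>x y. dist y x < d \<Longrightarrow> dist (f y) (f x) < \<epsilon>"
      using uc \<epsilon>(1) unfolding uniformly_continuous_on_def by (metis UNIV_I)
    have "eventually (\<lambda>n. norm (RS n \<nu> f - meas_integral \<nu> f) < r) sequentially"
      using mesh_eventually[OF d(1), where 'a = 'a]
    proof eventually_elim
      case (elim n)
      have "\<forall>x. norm (f x - f (mesh_tagging n x)) \<le> \<epsilon>" using elim d(2) by (metis dist_norm less_imp_le)
      from riemann_approxD[OF K f mesh_tagging(1) this] \<epsilon>(2) show ?case by (simp add: norm_minus_commute)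
    qed
    then show "\<exists>no. \<forall>n\<ge>no. norm (RS n \<nu> f - meas_integral \<nu> f) < r" by (simp add: eventually_sequentially)
  qed
qed

text \<open>Equicontinuity of \<open>k\<close> makes the inner Riemann sums converge uniformly in \<open>y\<close>. A double sum
  does not depend on the order of summation, so this takes the place of Fubini's theorem.\<close>

theorem double_riemann_sum_tendsto:
  fixes k :: "'a::metrized_graph \<Rightarrow> 'a \<Rightarrow> complex"
  assumes \<nu>: "\<nu> \<in> Meas" and \<nu>': "\<nu>' \<in> Meas"
    and k: "\<And>x. continuous_on UNIV (k x)" "\<And>y. continuous_on UNIV (\<lambda>x. k x y)"
    and equi: "\<And>\<epsilon>. \<epsilon> > 0 \<Longrightarrow> \<exists>d>0. \<forall>x x' y. dist x x' < d \<longrightarrow> norm (k x y - k x' y) < \<epsilon>"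
  shows "continuous_on UNIV (\<lambda>y. meas_integral \<nu> (\<lambda>x. k x y))"
    "(\<lambda>n. RS n \<nu>' (\<lambda>y. RS n \<nu> (\<lambda>x. k x y))) \<longlonglongrightarrow> meas_integral \<nu>' (\<lambda>y. meas_integral \<nu> (\<lambda>x. k x y))"
proof -
  let ?U = "\<lambda>y. meas_integral \<nu> (\<lambda>x. k x y)"
  obtain K where K: "riemann_approx (meas_integral \<nu>) \<nu> K" using meas_integral_riemann_approx[OF \<nu>] by blast
  then have K0: "0 \<le> K" by (simp add: riemann_approx_def)
  have ev: "eventually (\<lambda>n. \<forall>y. norm (RS n \<nu> (\<lambda>x. k x y) - ?U y) \<le> K * \<epsilon>) sequentially" if \<epsilon>: "\<epsilon> > 0" for \<epsilon>
  proof -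
    obtain d where d: "d > 0" "\<forall>x x' y. dist x x' < d \<longrightarrow> norm (k x y - k x' y) < \<epsilon>" using equi[OF \<epsilon>] by blast
    show ?thesis using mesh_eventually[OF d(1), where 'a = 'a]
    proof eventually_elim
      case (elim n)
      show ?case
      proof
        fix y
        have "\<forall>x. norm (k x y - k (mesh_tagging n x) y) \<le> \<epsilon>" using elim d(2) less_imp_le by blast
        from riemann_approxD[OF K k(2) mesh_tagging(1) this] show "norm (RS n \<nu> (\<lambda>x. k x y) - ?U y) \<le> K * \<epsilon>"
          by (simp add: norm_minus_commute)
      qed
    qed
  qed
  have unif: "eventually (\<lambda>n. \<forall>y. norm (RS n \<nu> (\<lambda>x. k x y) - ?U y) < \<epsilon>) sequentially" if "\<epsilon> > 0" for \<epsilon>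
  proof -
    have "\<epsilon> / (K + 1) > 0" "K * (\<epsilon> / (K + 1)) < \<epsilon>" using that K0 by (auto simp: field_simps)
    then show ?thesis using ev[of "\<epsilon> / (K + 1)"] by (auto elim!: eventually_mono intro: le_less_trans)
  qed
  have fin: "finite (range (mesh_tagging n :: 'a \<Rightarrow> 'a))" for n using mesh_tagging(1) by (auto simp: tagging_def)
  have lim: "uniform_limit UNIV (\<lambda>n y. RS n \<nu> (\<lambda>x. k x y)) ?U sequentially"
    by (rule uniform_limitI) (use unif in \<open>simp add: dist_norm\<close>)
  have contRS: "continuous_on UNIV (\<lambda>y. RS n \<nu> (\<lambda>x. k x y))" for n
    unfolding riemann_sum_def by (intro continuous_intros k fin)
  show cont: "continuous_on UNIV ?U"
    by (rule uniform_limit_theorem[OF _ lim]) (simp_all add: contRS)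
  obtain L where L: "0 \<le> L" "\<And>f \<tau> \<epsilon>. tagging \<tau> \<Longrightarrow> (\<forall>x. norm (f x) \<le> \<epsilon>) \<Longrightarrow> norm (riemann_sum \<tau> \<nu>' f) \<le> L * \<epsilon>"
    by (rule riemann_sum_norm_le[OF \<nu>']) (rule that)
  have "(\<lambda>n. RS n \<nu>' (\<lambda>y. RS n \<nu> (\<lambda>x. k x y)) - RS n \<nu>' ?U) \<longlonglongrightarrow> 0"
  proof (rule LIMSEQ_I)
    fix r :: real assume r: "0 < r"
    define \<epsilon> where "\<epsilon> = r / (L + 1)"
    have \<epsilon>: "0 < \<epsilon>" "L * \<epsilon> < r" using r L(1) by (auto simp: \<epsilon>_def field_simps)
    have "eventually (\<lambda>n. norm (RS n \<nu>' (\<lambda>y. RS n \<nu> (\<lambda>x. k x y)) - RS n \<nu>' ?U - 0) < r) sequentially"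
      using unif[OF \<epsilon>(1)]
    proof eventually_elim
      case (elim n)
      have "RS n \<nu>' (\<lambda>y. RS n \<nu> (\<lambda>x. k x y)) - RS n \<nu>' ?U = RS n \<nu>' (\<lambda>y. RS n \<nu> (\<lambda>x. k x y) - ?U y)"
        unfolding riemann_sum_def[of _ \<nu>'] by (simp add: left_diff_distrib sum_subtractf)
      moreover have "norm (RS n \<nu>' (\<lambda>y. RS n \<nu> (\<lambda>x. k x y) - ?U y)) \<le> L * \<epsilon>"
        using elim by (intro L(2) mesh_tagging(1)) (auto intro: less_imp_le)
      ultimately show ?case using \<epsilon>(2) by simp
    qed
    then show "\<exists>no. \<forall>n\<ge>no. norm (RS n \<nu>' (\<lambda>y. RS n \<nu> (\<lambda>x. k x y)) - RS n \<nu>' ?U - 0) < r"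
      by (simp add: eventually_sequentially)
  qed
  from tendsto_add[OF this riemann_sum_tendsto[OF \<nu>' cont]]
  show "(\<lambda>n. RS n \<nu>' (\<lambda>y. RS n \<nu> (\<lambda>x. k x y))) \<longlonglongrightarrow> meas_integral \<nu>' ?U" by simp
qed

lemma range_mesh_finite: "finite (range (mesh_tagging n :: 'a::metrized_graph \<Rightarrow> 'a))"
  using mesh_tagging(1) unfolding tagging_def by blast

lemma meas_integral_eqI:
  fixes \<nu> :: "'a::metrized_graph set \<Rightarrow> complex"
  assumes "\<nu> \<in> Meas" "continuous_on UNIV f" "(\<lambda>n. RS n \<nu> f) \<longlonglongrightarrow> c"
  shows "meas_integral \<nu> f = c"
  using riemann_sum_tendsto[OF assms(1,2)] assms(3) by (rule LIMSEQ_unique)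

lemma meas_integral_add:
  fixes \<nu> :: "'a::metrized_graph set \<Rightarrow> complex"
  assumes \<nu>: "\<nu> \<in> Meas" and f: "continuous_on UNIV f" and g: "continuous_on UNIV g"
  shows "meas_integral \<nu> (\<lambda>x. f x + g x) = meas_integral \<nu> f + meas_integral \<nu> g"
proof (rule meas_integral_eqI[OF \<nu> continuous_on_add[OF f g]])
  have "RS n \<nu> (\<lambda>x. f x + g x) = RS n \<nu> f + RS n \<nu> g" for n
    by (simp add: riemann_sum_def distrib_right sum.distrib)
  then show "(\<lambda>n. RS n \<nu> (\<lambda>x. f x + g x)) \<longlonglongrightarrow> meas_integral \<nu> f + meas_integral \<nu> g"
    using tendsto_add[OF riemann_sum_tendsto[OF \<nu> f] riemann_sum_tendsto[OF \<nu> g]] by simp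
qed

lemma meas_integral_cmult:
  fixes \<nu> :: "'a::metrized_graph set \<Rightarrow> complex"
  assumes \<nu>: "\<nu> \<in> Meas" and f: "continuous_on UNIV f"
  shows "meas_integral \<nu> (\<lambda>x. c * f x) = c * meas_integral \<nu> f"
proof (rule meas_integral_eqI[OF \<nu> continuous_on_mult_left[OF f]])
  have "RS n \<nu> (\<lambda>x. c * f x) = c * RS n \<nu> f" for n
    by (simp add: riemann_sum_def mult.assoc sum_distrib_left)
  then show "(\<lambda>n. RS n \<nu> (\<lambda>x. c * f x)) \<longlonglongrightarrow> c * meas_integral \<nu> f"
    using tendsto_mult_left[OF riemann_sum_tendsto[OF \<nu> f], of c] by simp
qed

lemma meas_integral_diff:
  fixes \<nu> :: "'a::metrized_graph set \<Rightarrow> complex"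
  assumes \<nu>: "\<nu> \<in> Meas" and f: "continuous_on UNIV f" and g: "continuous_on UNIV g"
  shows "meas_integral \<nu> (\<lambda>x. f x - g x) = meas_integral \<nu> f - meas_integral \<nu> g"
  using meas_integral_add[OF \<nu> f continuous_on_mult_left[OF g], of "-1"] meas_integral_cmult[OF \<nu> g, of "-1"]
  by simp

lemma meas_integral_const:
  fixes \<nu> :: "'a::metrized_graph set \<Rightarrow> complex"
  assumes \<nu>: "\<nu> \<in> Meas"
  shows "meas_integral \<nu> (\<lambda>x. c) = c * \<nu> UNIV"
proof (rule meas_integral_eqI[OF \<nu> continuous_on_const])
  have "RS n \<nu> (\<lambda>x. c) = c * \<nu> UNIV" for n
  proof -
    have "\<nu> (\<Union>q\<in>range (mesh_tagging n). mesh_tagging n -` {q}) = (\<Sum>q\<in>range (mesh_tagging n). \<nu> (mesh_tagging n -` {q}))"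
      using mesh_tagging(1)[of n, where 'a = 'a]
      by (intro sigma_additive_UN Meas_sigma_additive \<nu> range_mesh_finite) (auto simp: tagging_def disjoint_family_on_def)
    moreover have "(\<Union>q\<in>range (mesh_tagging n). mesh_tagging n -` {q}) = (UNIV :: 'a set)" by auto
    ultimately show ?thesis by (simp add: riemann_sum_def sum_distrib_left)
  qed
  then show "(\<lambda>n. RS n \<nu> (\<lambda>x. c)) \<longlonglongrightarrow> c * \<nu> UNIV" by simp
qed

lemma meas_integral_sum:
  fixes \<nu> :: "'a::metrized_graph set \<Rightarrow> complex"
  assumes \<nu>: "\<nu> \<in> Meas" and I: "finite I" and f: "\<And>i. i \<in> I \<Longrightarrow> continuous_on UNIV (f i)"
  shows "meas_integral \<nu> (\<lambda>x. \<Sum>i\<in>I. f i x) = (\<Sum>i\<in>I. meas_integral \<nu> (f i))"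
  using I f
proof (induction I)
  case empty
  then show ?case using meas_integral_const[OF \<nu>, of 0] by simp
next
  case (insert i I)
  have "meas_integral \<nu> (\<lambda>x. f i x + (\<Sum>i\<in>I. f i x)) = meas_integral \<nu> (f i) + meas_integral \<nu> (\<lambda>x. \<Sum>i\<in>I. f i x)"
    by (rule meas_integral_add[OF \<nu>]) (auto intro!: continuous_on_sum insert.prems)
  then show ?case using insert by simp
qed

section \<open>Potentials and the energy\<close>

lemma continuous_green_left: "continuous_on UNIV (\<lambda>x. complex_of_real (green z x y))"
  unfolding green_symmetric[of z _ y]
  by (intro continuous_on_of_real locally_affine_continuous locally_affine_green)

lemma continuous_green_right: "continuous_on UNIV (\<lambda>y. complex_of_real (green z x y))"
  by (intro continuous_on_of_real locally_affine_continuous locally_affine_green)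

lemma continuous_green_diag: "continuous_on UNIV (\<lambda>x. complex_of_real (green z x x))"
proof -
  have "continuous_on UNIV (\<lambda>x. (\<lambda>(x, y). green z x y) (x, x))"
    by (rule continuous_on_compose2[OF continuous_green]) (auto intro!: continuous_intros)
  then show ?thesis by (intro continuous_on_of_real) simp
qed

lemma green_equicontinuous_complex:
  assumes "\<epsilon> > 0"
  shows "\<exists>d>0. \<forall>x x' y. dist x x' < d \<longrightarrow> norm (complex_of_real (green z x y) - complex_of_real (green z x' y)) < \<epsilon>"
  using green_equicontinuous[OF assms] by (simp flip: of_real_diff)

definition potential :: "'a::metrized_graph \<Rightarrow> ('a set \<Rightarrow> complex) \<Rightarrow> 'a \<Rightarrow> complex" where
  "potential z \<nu> y = meas_integral \<nu> (\<lambda>x. complex_of_real (green z x y))"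

lemma continuous_potential:
  assumes \<nu>: "\<nu> \<in> Meas"
  shows "continuous_on UNIV (potential z \<nu>)"
  unfolding potential_def
  by (rule double_riemann_sum_tendsto(1)[where \<nu>' = \<nu>])
    (rule \<nu> continuous_green_left continuous_green_right green_equicontinuous_complex | assumption)+

lemma double_sum_tendsto:
  fixes \<nu> :: "'a::metrized_graph set \<Rightarrow> complex"
  assumes "\<nu> \<in> Meas" "\<nu>' \<in> Meas"
  shows "(\<lambda>n. \<Sum>y\<in>range (mesh_tagging n). \<Sum>x\<in>range (mesh_tagging n). complex_of_real (green z x y) *
      \<nu> (mesh_tagging n -` {x}) * \<nu>' (mesh_tagging n -` {y})) \<longlonglongrightarrow> meas_integral \<nu>' (potential z \<nu>)"
proof -
  have "(\<lambda>n. RS n \<nu>' (\<lambda>y. RS n \<nu> (\<lambda>x. complex_of_real (green z x y)))) \<longlonglongrightarrow> meas_integral \<nu>' (potential z \<nu>)"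
    unfolding potential_def
    by (rule double_riemann_sum_tendsto(2)[OF assms])
      (rule continuous_green_left continuous_green_right green_equicontinuous_complex | assumption)+
  then show ?thesis unfolding riemann_sum_def by (simp add: sum_distrib_right)
qed

text \<open>Integrating the formula for moving the base point. In the integral over \<open>x\<close> the two occurrences of
  \<open>U y\<close> cancel, which is why the constant \<open>c\<^bsub>\<mu>\<^esub>\<close> is well defined.\<close>

lemma g_mu_eq:
  fixes \<mu> :: "'a::metrized_graph set \<Rightarrow> complex"
  assumes \<mu>: "\<mu> \<in> Meas" "\<mu> UNIV = 1"
  shows "g_mu \<mu> x y = complex_of_real (green z x y) - potential z \<mu> x - potential z \<mu> y
    + meas_integral \<mu> (potential z \<mu>)"
proof -
  let ?k = "\<lambda>x y. complex_of_real (green z x y)" and ?U = "potential z \<mu>"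
  let ?D = "meas_integral \<mu> (\<lambda>w. ?k w w)"
  have j: "j_mu \<mu> x y = ?k x y - ?U x - ?U y + ?D" for x y
  proof -
    have "(\<lambda>w. j_kernel w x y) = (\<lambda>w. ((?k x y - ?k w x) - ?k w y) + ?k w w)"
    proof
      fix w
      have "green w y x = ((green z x y - green z w x) - green z w y) + green z w w"
        using green_change_base[of w y x z] unfolding green_symmetric[of z x w] .
      then show "j_kernel w x y = ((?k x y - ?k w x) - ?k w y) + ?k w w"
        unfolding j_kernel_eq_green by simp
    qed
    then have "j_mu \<mu> x y = meas_integral \<mu> (\<lambda>w. ((?k x y - ?k w x) - ?k w y) + ?k w w)"
      by (simp add: j_mu_def)
    also have "\<dots> = meas_integral \<mu> (\<lambda>w. (?k x y - ?k w x) - ?k w y) + ?D"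
      by (intro meas_integral_add \<mu> continuous_on_diff continuous_on_const continuous_green_left continuous_green_diag)
    also have "meas_integral \<mu> (\<lambda>w. (?k x y - ?k w x) - ?k w y) = meas_integral \<mu> (\<lambda>w. ?k x y - ?k w x) - ?U y"
      unfolding potential_def
      by (intro meas_integral_diff \<mu> continuous_on_diff continuous_on_const continuous_green_left)
    also have "meas_integral \<mu> (\<lambda>w. ?k x y - ?k w x) = meas_integral \<mu> (\<lambda>w. ?k x y) - ?U x"
      unfolding potential_def by (intro meas_integral_diff \<mu> continuous_on_const continuous_green_left)
    also have "meas_integral \<mu> (\<lambda>w. ?k x y) = ?k x y" by (simp add: meas_integral_const \<mu>)
    finally show ?thesis .
  qed
  note U = continuous_potential[OF \<mu>(1), of z]
  have c: "meas_integral \<mu> (\<lambda>x. j_mu \<mu> x y) = ?D - meas_integral \<mu> ?U" for y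
  proof -
    have "meas_integral \<mu> (\<lambda>x. j_mu \<mu> x y) = meas_integral \<mu> (\<lambda>x. (?k x y - ?U x) + (?D - ?U y))"
      unfolding j by (simp add: algebra_simps)
    also have "\<dots> = meas_integral \<mu> (\<lambda>x. ?k x y - ?U x) + meas_integral \<mu> (\<lambda>x. ?D - ?U y)"
      by (intro meas_integral_add \<mu> continuous_on_diff continuous_on_const continuous_green_left U)
    also have "meas_integral \<mu> (\<lambda>x. ?k x y - ?U x) = ?U y - meas_integral \<mu> ?U"
      unfolding potential_def[of z \<mu> y] by (intro meas_integral_diff \<mu> continuous_green_left U)
    also have "meas_integral \<mu> (\<lambda>x. ?D - ?U y) = ?D - ?U y" by (simp add: meas_integral_const \<mu>)
    finally show ?thesis by simp
  qed
  have "c_mu \<mu> = ?D - meas_integral \<mu> ?U"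
    unfolding c_mu_def c by (rule the_equality) auto
  then show ?thesis by (simp add: g_mu_def j)
qed

lemma energy_eq:
  fixes \<mu> \<nu> :: "'a::metrized_graph set \<Rightarrow> complex"
  assumes \<mu>: "\<mu> \<in> Meas" "\<mu> UNIV = 1" and \<nu>: "\<nu> \<in> Meas" "\<nu> UNIV = 1"
  shows "energy \<mu> \<nu> = meas_integral (\<lambda>A. cnj (\<nu> A)) (potential z \<nu>) - meas_integral \<nu> (potential z \<mu>)
    - meas_integral (\<lambda>A. cnj (\<nu> A)) (potential z \<mu>) + meas_integral \<mu> (potential z \<mu>)"
proof -
  let ?k = "\<lambda>x y. complex_of_real (green z x y)" and ?U = "potential z \<mu>"
  let ?V = "meas_integral \<mu> ?U"
  note U = continuous_potential[OF \<mu>(1), of z]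
  note \<nu>' = Meas_cnj[OF \<nu>(1)]
  have inner: "meas_integral \<nu> (\<lambda>x. g_mu \<mu> x y) = (potential z \<nu> y - ?U y) + (?V - meas_integral \<nu> ?U)" for y
  proof -
    have "meas_integral \<nu> (\<lambda>x. g_mu \<mu> x y) = meas_integral \<nu> (\<lambda>x. (?k x y - ?U x) + (?V - ?U y))"
      unfolding g_mu_eq[OF \<mu>, of _ y z] by (simp add: algebra_simps)
    also have "\<dots> = meas_integral \<nu> (\<lambda>x. ?k x y - ?U x) + meas_integral \<nu> (\<lambda>x. ?V - ?U y)"
      by (intro meas_integral_add \<nu> continuous_on_diff continuous_on_const continuous_green_left U)
    also have "meas_integral \<nu> (\<lambda>x. ?k x y - ?U x) = potential z \<nu> y - meas_integral \<nu> ?U"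
      unfolding potential_def[of z \<nu> y] by (intro meas_integral_diff \<nu> continuous_green_left U)
    also have "meas_integral \<nu> (\<lambda>x. ?V - ?U y) = ?V - ?U y" by (simp add: meas_integral_const \<nu>)
    finally show ?thesis by (simp add: algebra_simps)
  qed
  have "energy \<mu> \<nu> = meas_integral (\<lambda>A. cnj (\<nu> A)) (\<lambda>y. (potential z \<nu> y - ?U y) + (?V - meas_integral \<nu> ?U))"
    by (simp only: energy_def inner)
  also have "\<dots> = meas_integral (\<lambda>A. cnj (\<nu> A)) (\<lambda>y. potential z \<nu> y - ?U y)
      + meas_integral (\<lambda>A. cnj (\<nu> A)) (\<lambda>y. ?V - meas_integral \<nu> ?U)"
    by (intro meas_integral_add \<nu>' continuous_on_diff continuous_on_const continuous_potential \<nu> \<mu>)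
  also have "meas_integral (\<lambda>A. cnj (\<nu> A)) (\<lambda>y. potential z \<nu> y - ?U y)
      = meas_integral (\<lambda>A. cnj (\<nu> A)) (potential z \<nu>) - meas_integral (\<lambda>A. cnj (\<nu> A)) ?U"
    by (intro meas_integral_diff \<nu>' continuous_potential \<nu> \<mu>)
  also have "meas_integral (\<lambda>A. cnj (\<nu> A)) (\<lambda>y. ?V - meas_integral \<nu> ?U) = ?V - meas_integral \<nu> ?U"
    by (simp add: meas_integral_const[OF \<nu>'] \<nu>)
  finally show ?thesis by simp
qed

text \<open>The energy of the complex point charges \<open>w\<close> on \<open>X\<close>.\<close>

definition green_form :: "'a::metrized_graph \<Rightarrow> 'a set \<Rightarrow> ('a \<Rightarrow> complex) \<Rightarrow> complex" where
  "green_form z X w = (\<Sum>y\<in>X. \<Sum>x\<in>X. complex_of_real (green z x y) * w x * cnj (w y))"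

text \<open>The four terms of \<open>energy_eq\<close> are the limits of the four terms of the Hermitian form in
  \<open>\<nu> - \<mu>\<close>.\<close>

lemma energy_tendsto:
  fixes \<mu> \<nu> :: "'a::metrized_graph set \<Rightarrow> complex"
  assumes \<mu>: "\<mu> \<in> Meas" "\<And>A. \<mu> A \<in> \<real>" "\<mu> UNIV = 1" and \<nu>: "\<nu> \<in> Meas" "\<nu> UNIV = 1"
  shows "(\<lambda>n. green_form z (range (mesh_tagging n)) (\<lambda>q. \<nu> (mesh_tagging n -` {q}) - \<mu> (mesh_tagging n -` {q})))
    \<longlonglongrightarrow> energy \<mu> \<nu>"
proof -
  let ?R = "\<lambda>n. range (mesh_tagging n :: 'a \<Rightarrow> 'a)"
  let ?a = "\<lambda>n q. \<nu> (mesh_tagging n -` {q})" and ?b = "\<lambda>n q. \<mu> (mesh_tagging n -` {q})"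
  let ?k = "\<lambda>x y. complex_of_real (green z x y)"
  let ?T = "\<lambda>n (c :: 'a \<Rightarrow> complex) (d :: 'a \<Rightarrow> complex). \<Sum>y\<in>?R n. \<Sum>x\<in>?R n. ?k x y * c x * d y"
  note \<nu>' = Meas_cnj[OF \<nu>(1)]
  have real: "cnj (\<mu> A) = \<mu> A" for A using \<mu>(2) Reals_cnj_iff by blast
  have swap: "?T n c d = ?T n d c" for n c d
    by (subst sum.swap) (simp add: green_symmetric[of z] mult_ac)
  have eq: "green_form z (?R n) (\<lambda>q. ?a n q - ?b n q)
     = ?T n (?a n) (\<lambda>q. cnj (?a n q)) - ?T n (?b n) (?a n) - ?T n (?b n) (\<lambda>q. cnj (?a n q)) + ?T n (?b n) (?b n)" for n
  proof -
    have "green_form z (?R n) (\<lambda>q. ?a n q - ?b n q)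
      = ?T n (?a n) (\<lambda>q. cnj (?a n q)) - ?T n (?a n) (?b n) - ?T n (?b n) (\<lambda>q. cnj (?a n q)) + ?T n (?b n) (?b n)"
      unfolding green_form_def sum_subtractf[symmetric] sum.distrib[symmetric]
      by (intro sum.cong refl) (simp add: real algebra_simps)
    then show ?thesis unfolding swap[where n = n and c = "?a n" and d = "?b n"] .
  qed
  show ?thesis
    unfolding eq energy_eq[OF \<mu>(1,3) \<nu>, of z]
    by (intro tendsto_intros double_sum_tendsto \<mu> \<nu> \<nu>')
qed

lemma cauchy_schwarz_discriminant:
  fixes Q S K :: real
  assumes K: "0 \<le> K" and form: "\<And>t. 0 \<le> Q + 2 * t * S + t\<^sup>2 * K"
  shows "S\<^sup>2 \<le> Q * K"
proof (cases "K = 0")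
  case True
  have "S = 0"
  proof (rule ccontr)
    assume "S \<noteq> 0"
    then show False using form[of "- (Q + 1) / (2 * S)"] True by (simp add: field_simps)
  qed
  then show ?thesis using True by simp
next
  case False
  then show ?thesis using form[of "- S / K"] K by (simp add: power2_eq_square field_simps)
qed

lemma green_diag_nonneg: "0 \<le> green z p p"
  using green_positive_semidefinite[of "{p}" "\<lambda>x. 1" z] by simp

text \<open>The form evaluated at the charges \<open>a\<close> plus a charge \<open>t\<close> at \<open>p\<close> is a nonnegative quadratic polynomial
  in \<open>t\<close>.\<close>

lemma green_cauchy_schwarz:
  assumes X: "finite X"
  shows "(\<Sum>x\<in>X. a x * green z x p)\<^sup>2 \<le> (\<Sum>x\<in>X. \<Sum>y\<in>X. a x * a y * green z x y) * green z p p"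
proof (rule cauchy_schwarz_discriminant[OF green_diag_nonneg])
  fix t :: real
  let ?X = "insert p X"
  let ?G = "green z"
  have fin: "finite ?X" using X by simp
  define \<alpha> where "\<alpha> x = (if x \<in> X then a x else 0)" for x
  define \<beta> where "\<beta> x = (if x = p then t else 0)" for x
  define S where "S = (\<Sum>x\<in>X. a x * ?G x p)"
  have sa: "(\<Sum>x\<in>?X. \<alpha> x * g x) = (\<Sum>x\<in>X. a x * g x)" for g :: "'a \<Rightarrow> real"
    by (rule sum.mono_neutral_cong_right) (use X in \<open>auto simp: \<alpha>_def\<close>)
  have sb: "(\<Sum>x\<in>?X. \<beta> x * g x) = t * g p" for g :: "'a \<Rightarrow> real"
  proof -
    have "(\<Sum>x\<in>?X. \<beta> x * g x) = (\<Sum>x\<in>?X. if x = p then t * g p else 0)"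
      by (intro sum.cong refl) (simp add: \<beta>_def)
    then show ?thesis using fin by simp
  qed
  have row: "(\<Sum>y\<in>?X. (\<alpha> y + \<beta> y) * ?G x y) = (\<Sum>y\<in>X. a y * ?G x y) + t * ?G x p" for x
    by (simp only: distrib_right sum.distrib sa sb)
  have "0 \<le> (\<Sum>x\<in>?X. \<Sum>y\<in>?X. (\<alpha> x + \<beta> x) * (\<alpha> y + \<beta> y) * ?G x y)"
    by (rule green_positive_semidefinite[OF fin])
  also have "\<dots> = (\<Sum>x\<in>?X. (\<alpha> x + \<beta> x) * ((\<Sum>y\<in>X. a y * ?G x y) + t * ?G x p))"
    by (simp only: mult.assoc sum_distrib_left[symmetric] row)
  also have "\<dots> = (\<Sum>x\<in>X. a x * ((\<Sum>y\<in>X. a y * ?G x y) + t * ?G x p)) + t * ((\<Sum>y\<in>X. a y * ?G p y) + t * ?G p p)"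
    by (simp only: distrib_right sum.distrib sa sb)
  also have "(\<Sum>y\<in>X. a y * ?G p y) = S" unfolding S_def by (simp only: green_symmetric[of z p])
  also have "(\<Sum>x\<in>X. a x * ((\<Sum>y\<in>X. a y * ?G x y) + t * ?G x p)) = (\<Sum>x\<in>X. \<Sum>y\<in>X. a x * a y * ?G x y) + t * S"
    unfolding S_def by (simp add: distrib_left sum.distrib sum_distrib_left mult_ac)
  finally show "0 \<le> (\<Sum>x\<in>X. \<Sum>y\<in>X. a x * a y * ?G x y) + 2 * t * (\<Sum>x\<in>X. a x * ?G x p) + t\<^sup>2 * ?G p p"
    unfolding S_def by (simp add: algebra_simps power2_eq_square)
qed

lemma green_form_eq:
  "green_form z X w = complex_of_real ((\<Sum>x\<in>X. \<Sum>y\<in>X. Re (w x) * Re (w y) * green z x y)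
     + (\<Sum>x\<in>X. \<Sum>y\<in>X. Im (w x) * Im (w y) * green z x y))"
proof (rule complex_eqI)
  have "Re (green_form z X w) = (\<Sum>y\<in>X. \<Sum>x\<in>X. Re (w y) * Re (w x) * green z y x + Im (w y) * Im (w x) * green z y x)"
    unfolding green_form_def Re_sum by (intro sum.cong refl) (simp add: green_symmetric[of z] algebra_simps)
  then show "Re (green_form z X w) = Re (complex_of_real ((\<Sum>x\<in>X. \<Sum>y\<in>X. Re (w x) * Re (w y) * green z x y)
     + (\<Sum>x\<in>X. \<Sum>y\<in>X. Im (w x) * Im (w y) * green z x y)))"
    by (simp add: sum.distrib)
  have "Im (green_form z X w) = (\<Sum>y\<in>X. \<Sum>x\<in>X. green z x y * (Im (w x) * Re (w y)) - green z x y * (Re (w x) * Im (w y)))"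
    unfolding green_form_def Im_sum by (intro sum.cong refl) (simp add: algebra_simps)
  also have "\<dots> = (\<Sum>y\<in>X. \<Sum>x\<in>X. green z x y * (Im (w x) * Re (w y))) - (\<Sum>y\<in>X. \<Sum>x\<in>X. green z x y * (Re (w x) * Im (w y)))"
    by (simp add: sum_subtractf)
  also have "(\<Sum>y\<in>X. \<Sum>x\<in>X. green z x y * (Re (w x) * Im (w y))) = (\<Sum>y\<in>X. \<Sum>x\<in>X. green z x y * (Im (w x) * Re (w y)))"
    by (subst sum.swap) (intro sum.cong refl, simp add: green_symmetric[of z] mult.commute)
  finally show "Im (green_form z X w) = Im (complex_of_real ((\<Sum>x\<in>X. \<Sum>y\<in>X. Re (w x) * Re (w y) * green z x y)
     + (\<Sum>x\<in>X. \<Sum>y\<in>X. Im (w x) * Im (w y) * green z x y)))"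
    by simp
qed

lemma green_form_real_nonneg:
  assumes "finite X"
  shows "green_form z X w \<in> \<real>" "0 \<le> Re (green_form z X w)"
  unfolding green_form_eq
  using green_positive_semidefinite[OF assms, of "\<lambda>x. Re (w x)" z] green_positive_semidefinite[OF assms, of "\<lambda>x. Im (w x)" z]
  by (simp_all only: Reals_of_real Re_complex_of_real add_nonneg_nonneg)

lemma green_form_cauchy_schwarz:
  assumes X: "finite X"
  shows "(norm (\<Sum>x\<in>X. complex_of_real (green z x p) * w x))\<^sup>2 \<le> Re (green_form z X w) * green z p p"
proof -
  have "(norm (\<Sum>x\<in>X. complex_of_real (green z x p) * w x))\<^sup>2
      = (\<Sum>x\<in>X. Re (w x) * green z x p)\<^sup>2 + (\<Sum>x\<in>X. Im (w x) * green z x p)\<^sup>2"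
    by (simp add: cmod_power2 Re_sum Im_sum mult.commute)
  also have "\<dots> \<le> (\<Sum>x\<in>X. \<Sum>y\<in>X. Re (w x) * Re (w y) * green z x y) * green z p p
      + (\<Sum>x\<in>X. \<Sum>y\<in>X. Im (w x) * Im (w y) * green z x y) * green z p p"
    by (intro add_mono green_cauchy_schwarz X)
  also have "\<dots> = Re (green_form z X w) * green z p p"
    unfolding green_form_eq by (simp only: Re_complex_of_real distrib_right)
  finally show ?thesis .
qed

text \<open>The potential of \<open>\<nu> - \<mu>\<close> at \<open>p\<close> is its pairing with a unit charge at \<open>p\<close>, so Cauchy-Schwarz bounds it
  by the energy.\<close>

lemma potential_eq_if_energy_0:
  fixes \<mu> \<nu> :: "'a::metrized_graph set \<Rightarrow> complex"
  assumes \<mu>: "\<mu> \<in> Meas" "\<And>A. \<mu> A \<in> \<real>" "\<mu> UNIV = 1" and \<nu>: "\<nu> \<in> Meas" "\<nu> UNIV = 1"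
    and E: "Re (energy \<mu> \<nu>) \<le> 0"
  shows "potential z \<nu> p = potential z \<mu> p"
proof -
  let ?w = "\<lambda>n q. \<nu> (mesh_tagging n -` {q}) - \<mu> (mesh_tagging n -` {q})"
  let ?R = "\<lambda>n. range (mesh_tagging n :: 'a \<Rightarrow> 'a)"
  have "(\<lambda>n. (RS n \<nu> (\<lambda>x. complex_of_real (green z x p))) - (RS n \<mu> (\<lambda>x. complex_of_real (green z x p))))
      \<longlonglongrightarrow> potential z \<nu> p - potential z \<mu> p"
    unfolding potential_def by (intro tendsto_diff riemann_sum_tendsto continuous_green_left \<mu> \<nu>)
  moreover have "RS n \<nu> (\<lambda>x. complex_of_real (green z x p)) - RS n \<mu> (\<lambda>x. complex_of_real (green z x p))
      = (\<Sum>x\<in>?R n. complex_of_real (green z x p) * ?w n x)" for n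
    by (simp add: riemann_sum_def right_diff_distrib sum_subtractf)
  ultimately have "(\<lambda>n. \<Sum>x\<in>?R n. complex_of_real (green z x p) * ?w n x) \<longlonglongrightarrow> potential z \<nu> p - potential z \<mu> p"
    by simp
  then have L: "(\<lambda>n. (norm (\<Sum>x\<in>?R n. complex_of_real (green z x p) * ?w n x))\<^sup>2)
      \<longlonglongrightarrow> (norm (potential z \<nu> p - potential z \<mu> p))\<^sup>2"
    by (intro tendsto_power tendsto_norm)
  have Rl: "(\<lambda>n. Re (green_form z (?R n) (?w n)) * green z p p) \<longlonglongrightarrow> Re (energy \<mu> \<nu>) * green z p p"
    by (intro tendsto_mult tendsto_Re energy_tendsto tendsto_const \<mu> \<nu>)
  have "(norm (potential z \<nu> p - potential z \<mu> p))\<^sup>2 \<le> Re (energy \<mu> \<nu>) * green z p p"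
    by (rule LIMSEQ_le[OF L Rl]) (intro exI allI impI green_form_cauchy_schwarz range_mesh_finite)
  also have "\<dots> \<le> 0"
    using E green_diag_nonneg[of z p] by (simp add: mult_nonpos_nonneg)
  finally show ?thesis by simp
qed

section \<open>Piecewise affine functions determine a measure\<close>

lemma meas_integral_locally_affine:
  fixes \<nu> :: "'a::metrized_graph set \<Rightarrow> complex"
  assumes \<nu>: "\<nu> \<in> Meas" and f: "locally_affine f"
  shows "meas_integral \<nu> (\<lambda>x. complex_of_real (f x)) = complex_of_real (f z) * \<nu> UNIV
    + (\<Sum>q | lapl f q \<noteq> 0. complex_of_real (lapl f q) * potential z \<nu> q)"
proof -
  let ?S = "{q. lapl f q \<noteq> 0}"
  let ?k = "\<lambda>x y. complex_of_real (green z x y)"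
  have fin: "finite ?S" by (rule finite_lapl_support[OF f])
  have "complex_of_real (f x) = complex_of_real (f z) + (\<Sum>q\<in>?S. complex_of_real (lapl f q) * ?k x q)" for x
    using arg_cong[OF lapl_total_mass(2)[OF f, of x z], of complex_of_real]
    by (simp add: green_symmetric[of z _ x])
  then have "meas_integral \<nu> (\<lambda>x. complex_of_real (f x))
      = meas_integral \<nu> (\<lambda>x. complex_of_real (f z) + (\<Sum>q\<in>?S. complex_of_real (lapl f q) * ?k x q))"
    by (intro arg_cong[where f = "meas_integral \<nu>"] ext)
  also have "\<dots> = meas_integral \<nu> (\<lambda>x. complex_of_real (f z))
      + meas_integral \<nu> (\<lambda>x. \<Sum>q\<in>?S. complex_of_real (lapl f q) * ?k x q)"
    by (intro meas_integral_add \<nu> continuous_on_const continuous_on_sum continuous_on_mult_left continuous_green_left)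
  also have "meas_integral \<nu> (\<lambda>x. \<Sum>q\<in>?S. complex_of_real (lapl f q) * ?k x q)
      = (\<Sum>q\<in>?S. complex_of_real (lapl f q) * potential z \<nu> q)"
    unfolding potential_def
    by (subst meas_integral_sum[OF \<nu> fin])
      (auto intro!: sum.cong meas_integral_cmult \<nu> continuous_on_mult_left continuous_green_left)
  finally show ?thesis by (simp add: meas_integral_const[OF \<nu>])
qed

text \<open>Finitely many star tents of radius below \<open>e\<close> centred in \<open>C\<close>, scaled to be at least \<open>1\<close> on balls of half
  their radius that cover \<open>C\<close>; their sum is cut off at \<open>1\<close>.\<close>

lemma closed_set_bump:
  fixes C :: "'a::metrized_graph set"
  assumes C: "closed C" and e: "0 < e"
  shows "\<exists>h. locally_affine h \<and> (\<forall>x. 0 \<le> h x \<and> h x \<le> 1) \<and> (\<forall>x\<in>C. h x = 1)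
    \<and> (\<forall>x. (\<forall>c\<in>C. e \<le> dist c x) \<longrightarrow> h x = 0)"
proof -
  have "\<exists>s T. 0 < s \<and> s < e \<and> locally_affine T \<and> (\<forall>x. T x = max 0 (s - dist p x))" for p :: 'a
  proof -
    obtain R where R: "good_radius p R" using good_radius_exists by blast
    define s where "s = min R e / 2"
    have s: "0 < s" "s < R" "s < e" using good_radiusD(1)[OF R] e by (auto simp: s_def)
    obtain T where T: "locally_affine T" "\<And>x. T x = max 0 (s - dist p x)"
      "\<And>u. (\<Sum>q | lapl T q \<noteq> 0. u q * lapl T q) = (\<Sum>v\<in>Vec p. u p - u (graph_move p s v))"
      by (rule star_tent[OF R s(1,2)]) (rule that)
    show ?thesis by (intro exI[of _ s] exI[of _ T] conjI allI s T(1,2))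
  qed
  then obtain s T where s: "\<And>p :: 'a. 0 < s p" "\<And>p. s p < e" and T: "\<And>p. locally_affine (T p)"
    "\<And>p x. T p x = max 0 (s p - dist p x)" by metis
  have "compact C" using compact_Int_closed[OF compact_graph C] by simp
  then obtain F where F: "F \<subseteq> C" "finite F" "C \<subseteq> (\<Union>p\<in>F. ball p (s p / 2))"
  proof (rule compactE_image[of C C "\<lambda>p. ball p (s p / 2)"])
    show "C \<subseteq> (\<Union>p\<in>C. ball p (s p / 2))" using s(1) by force
  qed auto
  define g where "g x = (\<Sum>p\<in>F. 2 / s p * T p x)" for x
  have g: "locally_affine g" unfolding g_def by (intro locally_affine_intros F T)
  have nonneg: "0 \<le> 2 / s p * T p x" for p x using s(1)[of p] by (simp add: T(2))
  show ?thesis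
  proof (intro exI[of _ "\<lambda>x. min (g x) 1"] conjI allI ballI impI)
    show "locally_affine (\<lambda>x. min (g x) 1)" by (rule locally_affine_min_const[OF g])
    show "0 \<le> min (g x) 1" for x unfolding g_def using nonneg by (simp add: sum_nonneg)
    show "min (g x) 1 \<le> 1" for x by simp
    show "min (g x) 1 = 1" if x: "x \<in> C" for x
    proof -
      obtain p where p: "p \<in> F" "dist p x < s p / 2" using F(3) x by auto
      have "1 \<le> 2 / s p * T p x" using p(2) s(1)[of p] by (simp add: T(2) field_simps)
      also have "\<dots> \<le> g x" unfolding g_def using F(2) p(1) nonneg by (intro member_le_sum) auto
      finally show ?thesis by simp
    qed
    show "min (g x) 1 = 0" if x: "\<forall>c\<in>C. e \<le> dist c x" for x
    proof -
      have "T p x = 0" if "p \<in> F" for p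
      proof -
        have "e \<le> dist p x" using x that F(1) by blast
        then show ?thesis using s(2)[of p] by (simp add: T(2))
      qed
      then show ?thesis by (simp add: g_def)
    qed
  qed
qed

lemma signed_integral_bumps_tendsto:
  assumes \<sigma>: "bounded_signed (\<sigma> :: 'a::metrized_graph set \<Rightarrow> real)" and C: "C \<in> sets borel"
    and h: "\<And>n. continuous_on UNIV (h n)" "\<And>n x. norm (h n x :: complex) \<le> 1"
    and lim: "\<And>x. (\<lambda>n. h n x) \<longlonglongrightarrow> indicator C x"
  shows "(\<lambda>n. signed_integral \<sigma> (h n)) \<longlonglongrightarrow> complex_of_real (\<sigma> C)"
proof -
  have part: "(\<lambda>n. \<integral>x. h n x \<partial>M) \<longlonglongrightarrow> complex_of_real (measure M C)"
    if M: "finite_measure M" "sets M = sets borel" for M :: "'a measure"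
  proof -
    interpret finite_measure M by fact
    have CM: "C \<in> sets M" using C M(2) by simp
    have "(\<lambda>n. \<integral>x. h n x \<partial>M) \<longlonglongrightarrow> (\<integral>x. complex_of_real (indicator C x) \<partial>M)"
    proof (rule integral_dominated_convergence[where w = "\<lambda>x. 1"])
      show "h n \<in> borel_measurable M" for n
        using borel_measurable_continuous_onI[OF h(1)] measurable_cong_sets[OF M(2) refl] by blast
      show "(\<lambda>x. complex_of_real (indicator C x)) \<in> borel_measurable M" using CM by measurable
      show "AE x in M. (\<lambda>n. h n x) \<longlonglongrightarrow> complex_of_real (indicator C x)"
        using lim by (simp add: of_real_indicator)
      show "AE x in M. norm (h n x) \<le> 1" for n using h(2) by simp
    qed simp
    also have "(\<integral>x. complex_of_real (indicator C x) \<partial>M) = complex_of_real (measure M C)"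
      using sets.sets_into_space[OF CM] by (simp add: Int_absorb2)
    finally show ?thesis .
  qed
  show ?thesis
    unfolding signed_integral_def jordan_decomposition[OF \<sigma> C] of_real_diff
    by (intro tendsto_diff part finite_measure_pos_variation bounded_signed_uminus \<sigma>) auto
qed

lemma meas_integral_bumps_tendsto:
  assumes \<nu>: "\<nu> \<in> (Meas :: ('a::metrized_graph set \<Rightarrow> complex) set)" and C: "C \<in> sets borel"
    and h: "\<And>n. continuous_on UNIV (h n)" "\<And>n x. norm (h n x :: complex) \<le> 1"
    and lim: "\<And>x. (\<lambda>n. h n x) \<longlonglongrightarrow> indicator C x"
  shows "(\<lambda>n. meas_integral \<nu> (h n)) \<longlonglongrightarrow> \<nu> C"
proof -
  have "(\<lambda>n. meas_integral \<nu> (h n)) \<longlonglongrightarrow> complex_of_real (Re (\<nu> C)) + \<i> * complex_of_real (Im (\<nu> C))"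
    unfolding meas_integral_def
    by (intro tendsto_add tendsto_mult tendsto_const signed_integral_bumps_tendsto Meas_bounded_signed \<nu> C h lim)
  then show ?thesis by (simp flip: complex_eq)
qed

text \<open>The bumps around a closed set shrink to its indicator, so the measures agree on closed sets, which
  form an intersection-stable generator of the Borel sets.\<close>

theorem measure_eq_if_locally_affine_integrals_eq:
  fixes \<mu> \<nu> :: "'a::metrized_graph set \<Rightarrow> complex"
  assumes \<mu>: "\<mu> \<in> Meas" and \<nu>: "\<nu> \<in> Meas"
    and eq: "\<And>f. locally_affine f \<Longrightarrow>
      meas_integral \<mu> (\<lambda>x. complex_of_real (f x)) = meas_integral \<nu> (\<lambda>x. complex_of_real (f x))"
  shows "\<mu> = \<nu>"
proof -
  have closed: "\<mu> C = \<nu> C" if C: "closed C" for C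
  proof -
    have "\<exists>h. locally_affine h \<and> (\<forall>x. 0 \<le> h x \<and> h x \<le> 1) \<and> (\<forall>x\<in>C. h x = 1)
      \<and> (\<forall>x. (\<forall>c\<in>C. 1 / real (Suc n) \<le> dist c x) \<longrightarrow> h x = 0)" for n
      by (rule closed_set_bump[OF C]) simp
    then obtain h where h: "\<And>n. locally_affine (h n)" "\<And>n x. 0 \<le> h n x \<and> h n x \<le> 1"
      "\<And>n x. x \<in> C \<Longrightarrow> h n x = 1" "\<And>n x. (\<forall>c\<in>C. 1 / real (Suc n) \<le> dist c x) \<Longrightarrow> h n x = 0" by metis
    have lim: "(\<lambda>n. complex_of_real (h n x)) \<longlonglongrightarrow> indicator C x" for x
    proof (cases "x \<in> C")
      case True
      then show ?thesis using h(3) by simp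
    next
      case False
      then obtain d where d: "d > 0" "ball x d \<subseteq> - C" using C open_contains_ball[of "- C"] by auto
      obtain N where N: "1 / real (Suc N) < d" using nat_approx_posE[OF d(1)] by blast
      have "h n x = 0" if "n \<ge> N" for n
      proof (rule h(4), intro ballI)
        fix c assume "c \<in> C"
        then have "\<not> dist x c < d" using d(2) by auto
        moreover have "1 / real (Suc n) \<le> 1 / real (Suc N)" using that by (intro divide_left_mono) auto
        ultimately show "1 / real (Suc n) \<le> dist c x" using N by (simp add: dist_commute)
      qed
      then have "eventually (\<lambda>n. complex_of_real (h n x) = 0) sequentially"
        unfolding eventually_sequentially by auto
      then show ?thesis using False by (simp add: tendsto_eventually)
    qed
    have cont: "continuous_on UNIV (\<lambda>x. complex_of_real (h n x))" for n
      by (intro continuous_on_of_real locally_affine_continuous h)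
    have bound: "norm (complex_of_real (h n x)) \<le> 1" for n x using h(2)[of n x] by simp
    have "C \<in> sets borel" using C by simp
    note bumps = meas_integral_bumps_tendsto[OF _ this cont bound lim]
    show ?thesis using bumps[OF \<mu>] bumps[OF \<nu>] unfolding eq[OF h(1)] by (rule LIMSEQ_unique)
  qed
  have borel_eq: "sets (borel :: 'a measure) = sigma_sets UNIV (Collect closed)"
    unfolding borel_eq_closed by simp
  note sa = Meas_sigma_additive[OF \<mu>] Meas_sigma_additive[OF \<nu>]
  have "\<mu> A = \<nu> A" if "A \<in> sigma_sets UNIV (Collect closed)" for A
  proof (rule sigma_sets_induct_disjoint[OF _ _ that])
    show "Int_stable (Collect closed :: 'a set set)" by (auto simp: Int_stable_def)
    show "(Collect closed :: 'a set set) \<subseteq> Pow UNIV" by simp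
    show "\<mu> A = \<nu> A" if "A \<in> Collect closed" for A using closed that by simp
    show "\<mu> {} = \<nu> {}" using sa by (simp add: sigma_additive_empty)
    show "\<mu> (UNIV - A) = \<nu> (UNIV - A)" if A: "A \<in> sigma_sets UNIV (Collect closed)" "\<mu> A = \<nu> A" for A
    proof -
      have A': "A \<in> sets borel" using A(1) borel_eq by simp
      have U: "\<mu> UNIV = \<nu> UNIV" by (rule closed) simp
      have "UNIV - A \<in> sets borel" using sets.compl_sets[OF A'] by simp
      then have "\<mu> (A \<union> (UNIV - A)) = \<mu> A + \<mu> (UNIV - A)" "\<nu> (A \<union> (UNIV - A)) = \<nu> A + \<nu> (UNIV - A)"
        by (rule sigma_additive_Un[OF sa(1) A'] sigma_additive_Un[OF sa(2) A'], blast)+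
      then show ?thesis using A(2) U by simp
    qed
    show "\<mu> (\<Union>i. A i) = \<nu> (\<Union>i. A i)"
      if A: "disjoint_family A" "range A \<subseteq> sigma_sets UNIV (Collect closed)" "\<And>i. \<mu> (A i) = \<nu> (A i)" for A :: "nat \<Rightarrow> 'a set"
    proof -
      have "range A \<subseteq> sets borel" using A(2) borel_eq by simp
      then have "(\<lambda>i. \<mu> (A i)) sums \<mu> (\<Union>i. A i)" "(\<lambda>i. \<nu> (A i)) sums \<nu> (\<Union>i. A i)"
        using sigma_additiveD[OF sa(1)] sigma_additiveD[OF sa(2)] A(1) by blast+
      then show ?thesis unfolding A(3) by (rule sums_unique2)
    qed
  qed
  moreover have "\<mu> A = \<nu> A" if "A \<notin> sets borel" for A
    using \<mu> \<nu> that by (simp add: Meas_def)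
  ultimately show ?thesis using borel_eq by (intro ext) blast
qed

theorem theorem1p6:
  fixes \<mu> :: "'a::metrized_graph set \<Rightarrow> complex"
  assumes "\<mu> \<in> Meas" and "\<And>A. \<mu> A \<in> \<real>" and "\<mu> UNIV = 1"
  shows "(\<forall>\<nu>\<in>Meas. \<nu> UNIV = 1 \<longrightarrow> energy \<mu> \<nu> \<in> \<real>) \<and>
    (\<forall>\<nu>. is_arg_min (\<lambda>\<nu>. Re (energy \<mu> \<nu>)) (\<lambda>\<nu>. \<nu> \<in> Meas \<and> \<nu> UNIV = 1) \<nu> \<longleftrightarrow> \<nu> = \<mu>)"
proof -
  note \<mu> = assms
  fix z :: 'a
  note lim = energy_tendsto[OF \<mu>, of _ z]
  have real: "energy \<mu> \<nu> \<in> \<real>" if \<nu>: "\<nu> \<in> Meas" "\<nu> UNIV = 1" for \<nu>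
    by (rule Lim_in_closed_set[OF closed_complex_Reals _ _ lim[OF \<nu>]])
      (simp_all add: green_form_real_nonneg range_mesh_finite)
  have nonneg: "0 \<le> Re (energy \<mu> \<nu>)" if \<nu>: "\<nu> \<in> Meas" "\<nu> UNIV = 1" for \<nu>
    by (rule LIMSEQ_le_const[OF tendsto_Re[OF lim[OF \<nu>]]])
      (use green_form_real_nonneg(2)[OF range_mesh_finite] in blast)
  have "(\<lambda>n. 0) \<longlonglongrightarrow> energy \<mu> \<mu>" using lim[OF \<mu>(1,3)] by (simp add: green_form_def)
  then have zero: "energy \<mu> \<mu> = 0" using LIMSEQ_const_iff by metis
  have unique: "\<nu> = \<mu>" if \<nu>: "\<nu> \<in> Meas" "\<nu> UNIV = 1" and E: "Re (energy \<mu> \<nu>) \<le> 0" for \<nu>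
  proof (rule measure_eq_if_locally_affine_integrals_eq[OF \<nu>(1) \<mu>(1)])
    fix f :: "'a \<Rightarrow> real" assume f: "locally_affine f"
    show "meas_integral \<nu> (\<lambda>x. complex_of_real (f x)) = meas_integral \<mu> (\<lambda>x. complex_of_real (f x))"
      unfolding meas_integral_locally_affine[OF \<nu>(1) f, of z] meas_integral_locally_affine[OF \<mu>(1) f, of z]
      by (simp add: potential_eq_if_energy_0[OF \<mu> \<nu> E] \<nu> \<mu>)
  qed
  show ?thesis
    unfolding is_arg_min_def using real nonneg zero unique \<mu>
    by (auto simp: not_less)
qed

end
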